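(* Assume conditions (A), (B), (C) of the context hold and that the linear system $z'(t)=M(t)z(t)+M_0(t)z(\gamma(t))$ has an $\alpha$-exponential dichotomy on $\mathbb{R}$ with constants $K\ge 1$ and $\alpha>0$. Assume further that $$8K\ell\rho^{\ast}(M)\alpha^{-1}\le 1,\qquad 4Kr\rho^{\ast}(M)\alpha^{-1}\le 1,$$ where $\rho^\ast(M)=\rho(M)e^{\alpha\theta}$. Then the system $$z'(t)=M(t)z(t)+M_0(t)z(\gamma(t))+h(t,z(t),z(\gamma(t)))$$ has a unique solution bounded on $\mathbb{R}$, which can be represented as $$z(t)=\int_{-\infty}^t\tilde G_1(t,s)h(s,z(s),z(\gamma(s)))\,ds-\int_t^{+\infty}\tilde G_2(t,s)h(s,z(s),z(\gamma(s)))\,ds,$$ and $$|z(t)|\le 2K\mu\rho^\ast(M)\,(\alpha-4rK\rho^\ast(M))^{-1}.$$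
   Context: $|\cdot|$ denotes a vector norm or matrix norm. $t\in\mathbb{R}$, $z(t)\in\mathbb{R}^n$, $M(t),M_0(t)$ are $n\times n$ matrices, $h:\mathbb{R}\times\mathbb{R}^n\times\mathbb{R}^n\to\mathbb{R}^n$, $\gamma:\mathbb{R}\to\mathbb{R}$. Condition (A): there are real sequences $\{t_i\}_{i\in\mathbb{Z}}$, $\{\zeta_i\}_{i\in\mathbb{Z}}$ with $t_i<t_{i+1}$ and $t_i\le\zeta_i\le t_{i+1}$ for all $i$; $t_i\to\pm\infty$ as $i\to\pm\infty$; $\gamma(t)=\zeta_i$ for $t\in I_i:=[t_i,t_{i+1})$; and there is a constant $\theta>0$ with $t_{i+1}-t_i\le\theta$ for all $i$. Condition (B): $M$, $M_0$ and $h(t,z(t),z(\gamma(t)))$ are locally integrable on $\mathbb{R}$; there are constants $r>0$, $\mu>0$, $\ell>0$ such that for all $t\in\mathbb{R}$ and $z,w,\hat z,\hat w\in\mathbb{R}^n$: $|h(t,z,w)|\le r(|z|+|w|)+\mu$ and $|h(t,z,w)-h(t,\hat z,\hat w)|\le\ell(|z-\hat z|+|w-\hat w|)$. Condition (C): for a matrix function $Q$ put $\rho_i^+(Q)=\exp(\int_{t_i}^{\zeta_i}|Q(s)|ds)$, $\rho_i^-(Q)=\exp(\int_{\zeta_i}^{t_{i+1}}|Q(s)|ds)$. There are $0<\nu^+<1$, $0<\nu^-<1$ with $\sup_i\rho_i^+(M)\ln\rho_i^+(M_0)\le\nu^+$, $\sup_i\rho_i^-(M)\ln\rho_i^-(M_0)\le\nu^-$,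 and $1\le\rho(M):=\sup_i\rho_i^+(M)\rho_i^-(M)<+\infty$. Solution: a continuous function $z$ on $\mathbb{R}$ whose derivative exists at each point except possibly at the points $t_i$, where one-sided derivatives exist, and which satisfies the equation on each $(t_i,t_{i+1})$, and with the right derivative at each $t_i$. Transition matrices: $\Phi(t)$ is the fundamental matrix of $x'=M(t)x$ with $\Phi(0)=I$, and $\Phi(t,s)=\Phi(t)\Phi^{-1}(s)$. $E(t,\tau)=\Phi(t,\tau)+\int_\tau^t\Phi(t,s)M_0(s)ds$. Under (A), (B), (C) the matrices $E(t,\zeta_j)$, $t\in[t_j,t_{j+1}]$, are invertible; $Z(t,\tau)=E(t,\zeta_j)E(\tau,\zeta_j)^{-1}$ for $t,\tau\in[t_j,t_{j+1}]$, extended to all $t,\tau\in\mathbb{R}$ by $Z(t,\tau)Z(\tau,s)=Z(t,s)$. Thus $t\mapsto Z(t,\tau)\xi$ is the solution of the linear system with value $\xi$ at $\tau$. $\alpha$-exponential dichotomy on $\mathbb{R}$: there are a projection $P$ and constants $K\ge1$, $\alpha>0$ with $|Z_P(t,s)|\le Ke^{-\alpha|t-s|}$ for all $t,s$, where $Z_P(t,s)=Z(t,0)PZ(0,s)$ if $t\ge s$ and $Z_P(t,s)=-Z(t,0)(I-P)Z(0,s)$ if $s>t$. Green function. If $t\in(\zeta_j,t_{j+1})$: $\tilde G(t,s)=Z_P(t,t_r)\Phi(t_r,s)$ if $s\in[t_r,\zeta_r)$ for any $r\in\mathbb{Z}$; $\tilde G(t,s)=Z_P(t,t_{r+1})\Phi(t_{r+1},s)$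 if $s\in[\zeta_r,t_{r+1})$ for any $r\in\mathbb{Z}\setminus\{j\}$; $\tilde G(t,s)=\Phi(t,s)$ if $s\in[\zeta_j,t)$; $\tilde G(t,s)=0$ if $s\in[t,t_{j+1}]$. If $t\in[t_j,\zeta_j]$: $\tilde G(t,s)=Z_P(t,t_r)\Phi(t_r,s)$ if $s\in[t_r,\zeta_r)$ for any $r\in\mathbb{Z}\setminus\{j\}$; $\tilde G(t,s)=Z_P(t,t_{r+1})\Phi(t_{r+1},s)$ if $s\in[\zeta_r,t_{r+1})$ for any $r\in\mathbb{Z}$; $\tilde G(t,s)=0$ if $s\in[t_j,t)$; $\tilde G(t,s)=-\Phi(t,s)$ if $s\in[t,\zeta_j)$. Put $\tilde G_1(t,s)=\tilde G(t,s)$ for $t\ge s$ and $\tilde G_2(t,s)=-\tilde G(t,s)$ for $t<s$.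
   Formalization: The Green function regains its missing r=j term (as printed, the representation fails); solutions are in integrated form, classical if M, M_0, h are continuous in t on each [t_i,t_{i+1}) with left limits; the bound reads +∞ if α=4rKρ*(M). *)

theory Defs
  imports "HOL-Analysis.Analysis"
begin

text \<open>
  Vectors are \<^typ>\<open>real ^ 'n\<close> and matrices \<^typ>\<open>real ^ 'n ^ 'n\<close>. The vector norm and the matrix norm
  are parameters \<open>vn\<close>, \<open>mn\<close>: any norm on the space, and any submultiplicative norm on matrices that is
  consistent with it (for instance the induced operator norm).
\<close>

definition is_norm :: "('a::real_vector \<Rightarrow> real) \<Rightarrow> bool" where
  "is_norm N \<longleftrightarrow> (\<forall>x. N x = 0 \<longleftrightarrow> x = 0) \<and> (\<forall>c x. N (c *\<^sub>R x) = \<bar>c\<bar> * N x)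
     \<and> (\<forall>x y. N (x + y) \<le> N x + N y)"

definition vector_matrix_norm :: "(real ^ 'n \<Rightarrow> real) \<Rightarrow> (real ^ 'n ^ 'n \<Rightarrow> real) \<Rightarrow> bool" where
  "vector_matrix_norm vn mn \<longleftrightarrow> is_norm vn \<and> is_norm mn
     \<and> (\<forall>A B. mn (A ** B) \<le> mn A * mn B) \<and> (\<forall>A x. vn (A *v x) \<le> mn A * vn x)"

definition locally_integrable :: "(real \<Rightarrow> 'a::euclidean_space) \<Rightarrow> bool" where
  "locally_integrable f \<longleftrightarrow> (\<forall>a b. f absolutely_integrable_on {a..b})"

definition oriented_integral :: "real \<Rightarrow> real \<Rightarrow> (real \<Rightarrow> 'a::euclidean_space) \<Rightarrow> 'a" where
  "oriented_integral a b f = (if a \<le> b then integral {a..b} f else - integral {b..a} f)"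

text \<open>The grid \<open>t\<^sub>i\<close> is written \<open>\<tau> i\<close> throughout.\<close>

definition condition_A ::
  "(int \<Rightarrow> real) \<Rightarrow> (int \<Rightarrow> real) \<Rightarrow> (real \<Rightarrow> real) \<Rightarrow> real \<Rightarrow> bool" where
  "condition_A \<tau> \<zeta> \<gamma> \<theta> \<longleftrightarrow>
     (\<forall>i. \<tau> i < \<tau> (i + 1)) \<and> (\<forall>i. \<tau> i \<le> \<zeta> i \<and> \<zeta> i \<le> \<tau> (i + 1))
     \<and> filterlim \<tau> at_top at_top \<and> filterlim \<tau> at_bot at_bot
     \<and> (\<forall>i. \<forall>t\<in>{\<tau> i..<\<tau> (i + 1)}. \<gamma> t = \<zeta> i)
     \<and> \<theta> > 0 \<and> (\<forall>i. \<tau> (i + 1) - \<tau> i \<le> \<theta>)"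

definition condition_B ::
  "(real ^ 'n \<Rightarrow> real) \<Rightarrow> (real \<Rightarrow> real) \<Rightarrow> (real \<Rightarrow> real ^ 'n ^ 'n) \<Rightarrow> (real \<Rightarrow> real ^ 'n ^ 'n)
    \<Rightarrow> (real \<Rightarrow> real ^ 'n \<Rightarrow> real ^ 'n \<Rightarrow> real ^ 'n) \<Rightarrow> real \<Rightarrow> real \<Rightarrow> real \<Rightarrow> bool" where
  "condition_B vn \<gamma> M M0 h r \<mu> l \<longleftrightarrow>
     locally_integrable M \<and> locally_integrable M0
     \<and> (\<forall>z. continuous_on UNIV z \<longrightarrow> locally_integrable (\<lambda>t. h t (z t) (z (\<gamma> t))))
     \<and> r > 0 \<and> \<mu> > 0 \<and> l > 0
     \<and> (\<forall>t z w. vn (h t z w) \<le> r * (vn z + vn w) + \<mu>)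
     \<and> (\<forall>t z w z' w'. vn (h t z w - h t z' w') \<le> l * (vn (z - z') + vn (w - w')))"

definition rho_plus ::
  "(real ^ 'n ^ 'n \<Rightarrow> real) \<Rightarrow> (int \<Rightarrow> real) \<Rightarrow> (int \<Rightarrow> real) \<Rightarrow> (real \<Rightarrow> real ^ 'n ^ 'n) \<Rightarrow> int \<Rightarrow> real" where
  "rho_plus mn \<tau> \<zeta> Q i = exp (integral {\<tau> i..\<zeta> i} (\<lambda>s. mn (Q s)))"

definition rho_minus ::
  "(real ^ 'n ^ 'n \<Rightarrow> real) \<Rightarrow> (int \<Rightarrow> real) \<Rightarrow> (int \<Rightarrow> real) \<Rightarrow> (real \<Rightarrow> real ^ 'n ^ 'n) \<Rightarrow> int \<Rightarrow> real" where
  "rho_minus mn \<tau> \<zeta> Q i = exp (integral {\<zeta> i..\<tau> (i + 1)} (\<lambda>s. mn (Q s)))"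

definition rho ::
  "(real ^ 'n ^ 'n \<Rightarrow> real) \<Rightarrow> (int \<Rightarrow> real) \<Rightarrow> (int \<Rightarrow> real) \<Rightarrow> (real \<Rightarrow> real ^ 'n ^ 'n) \<Rightarrow> real" where
  "rho mn \<tau> \<zeta> Q = (SUP i. rho_plus mn \<tau> \<zeta> Q i * rho_minus mn \<tau> \<zeta> Q i)"

text \<open>
  A bound \<open>sup\<^sub>i a\<^sub>i \<le> \<nu>\<close> is written as \<open>a\<^sub>i \<le> \<nu>\<close> for all \<open>i\<close>, and finiteness of the supremum as
  \<^const>\<open>bdd_above\<close>, because a real \<^const>\<open>Sup\<close> of an unbounded set is unspecified.
\<close>

definition condition_C ::
  "(real ^ 'n ^ 'n \<Rightarrow> real) \<Rightarrow> (int \<Rightarrow> real) \<Rightarrow> (int \<Rightarrow> real) \<Rightarrow> (real \<Rightarrow> real ^ 'n ^ 'n)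
    \<Rightarrow> (real \<Rightarrow> real ^ 'n ^ 'n) \<Rightarrow> bool" where
  "condition_C mn \<tau> \<zeta> M M0 \<longleftrightarrow>
     (\<exists>\<nu>p \<nu>m. 0 < \<nu>p \<and> \<nu>p < 1 \<and> 0 < \<nu>m \<and> \<nu>m < 1
        \<and> (\<forall>i. rho_plus mn \<tau> \<zeta> M i * ln (rho_plus mn \<tau> \<zeta> M0 i) \<le> \<nu>p)
        \<and> (\<forall>i. rho_minus mn \<tau> \<zeta> M i * ln (rho_minus mn \<tau> \<zeta> M0 i) \<le> \<nu>m))
     \<and> bdd_above (range (\<lambda>i. rho_plus mn \<tau> \<zeta> M i * rho_minus mn \<tau> \<zeta> M i))
     \<and> 1 \<le> rho mn \<tau> \<zeta> M"

text \<open>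
  Since \<open>M\<close> is only locally integrable, \<open>x' = M(t) x\<close> is understood in the sense of Caratheodory,
  that is, in integrated form.
\<close>

definition fundamental_matrix :: "(real \<Rightarrow> real ^ 'n ^ 'n) \<Rightarrow> real \<Rightarrow> real ^ 'n ^ 'n" where
  "fundamental_matrix M = (THE X. continuous_on UNIV X \<and> X 0 = mat 1
     \<and> (\<forall>a b. a \<le> b \<longrightarrow> ((\<lambda>s. M s ** X s) has_integral (X b - X a)) {a..b}))"

definition Phi :: "(real \<Rightarrow> real ^ 'n ^ 'n) \<Rightarrow> real \<Rightarrow> real \<Rightarrow> real ^ 'n ^ 'n" where
  "Phi M t s = fundamental_matrix M t ** matrix_inv (fundamental_matrix M s)"

definition E_mat ::
  "(real \<Rightarrow> real ^ 'n ^ 'n) \<Rightarrow> (real \<Rightarrow> real ^ 'n ^ 'n) \<Rightarrow> real \<Rightarrow> real \<Rightarrow> real ^ 'n ^ 'n" where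
  "E_mat M M0 t u = Phi M t u + oriented_integral u t (\<lambda>s. Phi M t s ** M0 s)"

definition Z_mat ::
  "(int \<Rightarrow> real) \<Rightarrow> (int \<Rightarrow> real) \<Rightarrow> (real \<Rightarrow> real ^ 'n ^ 'n) \<Rightarrow> (real \<Rightarrow> real ^ 'n ^ 'n)
    \<Rightarrow> real \<Rightarrow> real \<Rightarrow> real ^ 'n ^ 'n" where
  "Z_mat \<tau> \<zeta> M M0 = (THE Z.
     (\<forall>j. \<forall>t\<in>{\<tau> j..\<tau> (j + 1)}. \<forall>u\<in>{\<tau> j..\<tau> (j + 1)}.
        Z t u = E_mat M M0 t (\<zeta> j) ** matrix_inv (E_mat M M0 u (\<zeta> j)))
     \<and> (\<forall>t u s. Z t u ** Z u s = Z t s))"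

definition Z_proj ::
  "(int \<Rightarrow> real) \<Rightarrow> (int \<Rightarrow> real) \<Rightarrow> (real \<Rightarrow> real ^ 'n ^ 'n) \<Rightarrow> (real \<Rightarrow> real ^ 'n ^ 'n)
    \<Rightarrow> real ^ 'n ^ 'n \<Rightarrow> real \<Rightarrow> real \<Rightarrow> real ^ 'n ^ 'n" where
  "Z_proj \<tau> \<zeta> M M0 P t s =
     (if t \<ge> s then Z_mat \<tau> \<zeta> M M0 t 0 ** P ** Z_mat \<tau> \<zeta> M M0 0 s
      else - (Z_mat \<tau> \<zeta> M M0 t 0 ** (mat 1 - P) ** Z_mat \<tau> \<zeta> M M0 0 s))"

definition exponential_dichotomy ::
  "(real ^ 'n ^ 'n \<Rightarrow> real) \<Rightarrow> (int \<Rightarrow> real) \<Rightarrow> (int \<Rightarrow> real) \<Rightarrow> (real \<Rightarrow> real ^ 'n ^ 'n)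
    \<Rightarrow> (real \<Rightarrow> real ^ 'n ^ 'n) \<Rightarrow> real ^ 'n ^ 'n \<Rightarrow> real \<Rightarrow> real \<Rightarrow> bool" where
  "exponential_dichotomy mn \<tau> \<zeta> M M0 P K \<alpha> \<longleftrightarrow>
     P ** P = P \<and> K \<ge> 1 \<and> \<alpha> > 0
     \<and> (\<forall>t s. mn (Z_proj \<tau> \<zeta> M M0 P t s) \<le> K * exp (- \<alpha> * \<bar>t - s\<bar>))"

definition grid_index :: "(int \<Rightarrow> real) \<Rightarrow> real \<Rightarrow> int" where
  "grid_index \<tau> t = (THE i. \<tau> i \<le> t \<and> t < \<tau> (i + 1))"

text \<open>
  The Green function \<open>G\<close>, with \<open>j\<close> and \<open>r\<close> the indices of the grid intervals of \<open>t\<close> and \<open>s\<close>.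
  An impulse acting at time \<open>s\<close> is transported by \<open>\<Phi>\<close> to the end point of its half interval,
  \<open>t\<^sub>r\<close> if \<open>s < \<zeta>\<^sub>r\<close> and \<open>t\<^sub>r\<^sub>+\<^sub>1\<close> otherwise, and from there by \<open>Z\<^sub>P\<close> to time \<open>t\<close>; between \<open>t\<close> and \<open>\<zeta>\<^sub>j\<close> there
  is in addition the local term \<open>\<plusminus>\<Phi>(t,s)\<close>. The transported term must also be present for \<open>r = j\<close>:
  the variation of constants formula on \<open>[t\<^sub>j, t\<^sub>j\<^sub>+\<^sub>1]\<close> is
  \<open>z(t) = Z(t,t\<^sub>j) (z(t\<^sub>j) + \<integral>[t\<^sub>j,\<zeta>\<^sub>j] \<Phi>(t\<^sub>j,s) f(s) ds) + \<integral>[\<zeta>\<^sub>j,t] \<Phi>(t,s) f(s) ds\<close>,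
  and for \<open>M\<^sub>0 = 0\<close> only the sum of the two terms reduces to the classical kernel
  (\<open>\<Phi>(t,0) P \<Phi>(0,s)\<close> for \<open>s < t\<close> and \<open>-\<Phi>(t,0) (I - P) \<Phi>(0,s)\<close> for \<open>t < s\<close>).
\<close>

definition Green ::
  "(int \<Rightarrow> real) \<Rightarrow> (int \<Rightarrow> real) \<Rightarrow> (real \<Rightarrow> real ^ 'n ^ 'n) \<Rightarrow> (real \<Rightarrow> real ^ 'n ^ 'n)
    \<Rightarrow> real ^ 'n ^ 'n \<Rightarrow> real \<Rightarrow> real \<Rightarrow> real ^ 'n ^ 'n" where
  "Green \<tau> \<zeta> M M0 P t s =
     (let j = grid_index \<tau> t; r = grid_index \<tau> s in
       (if s < \<zeta> r then Z_proj \<tau> \<zeta> M M0 P t (\<tau> r) ** Phi M (\<tau> r) s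
        else Z_proj \<tau> \<zeta> M M0 P t (\<tau> (r + 1)) ** Phi M (\<tau> (r + 1)) s)
       + (if \<zeta> j \<le> s \<and> s < t then Phi M t s
          else if t \<le> s \<and> s < \<zeta> j then - Phi M t s
          else 0))"

definition Green1 ::
  "(int \<Rightarrow> real) \<Rightarrow> (int \<Rightarrow> real) \<Rightarrow> (real \<Rightarrow> real ^ 'n ^ 'n) \<Rightarrow> (real \<Rightarrow> real ^ 'n ^ 'n)
    \<Rightarrow> real ^ 'n ^ 'n \<Rightarrow> real \<Rightarrow> real \<Rightarrow> real ^ 'n ^ 'n" where
  "Green1 \<tau> \<zeta> M M0 P t s = (if s \<le> t then Green \<tau> \<zeta> M M0 P t s else 0)"

definition Green2 ::
  "(int \<Rightarrow> real) \<Rightarrow> (int \<Rightarrow> real) \<Rightarrow> (real \<Rightarrow> real ^ 'n ^ 'n) \<Rightarrow> (real \<Rightarrow> real ^ 'n ^ 'n)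
    \<Rightarrow> real ^ 'n ^ 'n \<Rightarrow> real \<Rightarrow> real \<Rightarrow> real ^ 'n ^ 'n" where
  "Green2 \<tau> \<zeta> M M0 P t s = (if t < s then - Green \<tau> \<zeta> M M0 P t s else 0)"

definition depcag_rhs ::
  "(real \<Rightarrow> real) \<Rightarrow> (real \<Rightarrow> real ^ 'n ^ 'n) \<Rightarrow> (real \<Rightarrow> real ^ 'n ^ 'n)
    \<Rightarrow> (real \<Rightarrow> real ^ 'n \<Rightarrow> real ^ 'n \<Rightarrow> real ^ 'n) \<Rightarrow> (real \<Rightarrow> real ^ 'n) \<Rightarrow> real \<Rightarrow> real ^ 'n" where
  "depcag_rhs \<gamma> M M0 h z t = M t *v z t + M0 t *v z (\<gamma> t) + h t (z t) (z (\<gamma> t))"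

text \<open>
  Two notions of solution. The pointwise one asks for a derivative at every point off the grid; it
  is the usual notion for data that are piecewise continuous along the grid, but for data that are
  only locally integrable such solutions need not exist (a jump of \<open>M\<close> inside a grid interval is
  enough to exclude them). The Caratheodory one makes sense for all locally integrable data, and
  every pointwise solution is a Caratheodory solution.
\<close>

definition pointwise_solution ::
  "(int \<Rightarrow> real) \<Rightarrow> (real \<Rightarrow> real) \<Rightarrow> (real \<Rightarrow> real ^ 'n ^ 'n) \<Rightarrow> (real \<Rightarrow> real ^ 'n ^ 'n)
    \<Rightarrow> (real \<Rightarrow> real ^ 'n \<Rightarrow> real ^ 'n \<Rightarrow> real ^ 'n) \<Rightarrow> (real \<Rightarrow> real ^ 'n) \<Rightarrow> bool" where
  "pointwise_solution \<tau> \<gamma> M M0 h z \<longleftrightarrow> continuous_on UNIV z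
     \<and> (\<forall>i. \<forall>t\<in>{\<tau> i<..<\<tau> (i + 1)}. (z has_vector_derivative depcag_rhs \<gamma> M M0 h z t) (at t))
     \<and> (\<forall>i. (z has_vector_derivative depcag_rhs \<gamma> M M0 h z (\<tau> i)) (at_right (\<tau> i)))
     \<and> (\<forall>i. \<exists>d. (z has_vector_derivative d) (at_left (\<tau> i)))"

definition caratheodory_solution ::
  "(real \<Rightarrow> real) \<Rightarrow> (real \<Rightarrow> real ^ 'n ^ 'n) \<Rightarrow> (real \<Rightarrow> real ^ 'n ^ 'n)
    \<Rightarrow> (real \<Rightarrow> real ^ 'n \<Rightarrow> real ^ 'n \<Rightarrow> real ^ 'n) \<Rightarrow> (real \<Rightarrow> real ^ 'n) \<Rightarrow> bool" where
  "caratheodory_solution \<gamma> M M0 h z \<longleftrightarrow> continuous_on UNIV z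
     \<and> (\<forall>a b. a \<le> b \<longrightarrow> (depcag_rhs \<gamma> M M0 h z has_integral (z b - z a)) {a..b})"

definition grid_continuous :: "(int \<Rightarrow> real) \<Rightarrow> (real \<Rightarrow> 'a::topological_space) \<Rightarrow> bool" where
  "grid_continuous \<tau> f \<longleftrightarrow>
     (\<forall>i. continuous_on {\<tau> i..<\<tau> (i + 1)} f \<and> (\<exists>l. (f \<longlongrightarrow> l) (at_left (\<tau> (i + 1)))))"

end

theory Submission
  imports Defs
begin

text \<open>
  On one cell \<open>[\<tau>\<^sub>j, \<tau>\<^sub>j\<^sub>+\<^sub>1]\<close> the deviating argument \<open>z(\<gamma>(s))\<close> is the constant \<open>z(\<zeta>\<^sub>j)\<close>. A solution of
  \<open>z' = M z + M\<^sub>0 z(\<gamma>) + f\<close> is therefore determined on a cell by \<open>z(\<zeta>\<^sub>j)\<close>, namely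
  \<open>z(t) = E(t,\<zeta>\<^sub>j) z(\<zeta>\<^sub>j) + \<integral>[\<zeta>\<^sub>j,t] \<Phi>(t,s) f(s) ds\<close> (\<open>solves_iff\<close>), and condition (C) makes \<open>E(t,\<zeta>\<^sub>j)\<close>
  invertible, so that homogeneous solutions are transported by the cocycle \<open>Z\<close>.

  For a bounded force \<open>f\<close> the linear equation has exactly one bounded solution, the response
  \<open>\<integral> G(t,s) f(s) ds\<close>. Uniqueness holds because a bounded homogeneous solution is killed by the dichotomy in
  both time directions (\<open>bounded_homogeneous_solution_zero\<close>). That the response solves the equation
  (\<open>response_solves\<close>) is a bookkeeping of nodes: the force on \<open>[\<zeta>\<^sub>r\<^sub>-\<^sub>1, \<zeta>\<^sub>r)\<close> is carried by \<open>\<Phi>\<close> to the node \<open>\<tau>\<^sub>r\<close>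
  and from there by \<open>Z\<^sub>P\<close> to \<open>t\<close>; when \<open>t\<close> crosses \<open>\<tau>\<^sub>r\<close>, this piece changes from the \<open>I - P\<close> side to the
  \<open>P\<close> side, and because \<open>P + (I - P) = I\<close> the jump is exactly what the local term \<open>\<plusminus>\<Phi>(t,s)\<close> compensates.

  The nonlinear equation thus is the fixed point equation \<open>z = response (h(\<cdot>, z, z \<circ> \<gamma>))\<close>. With the bound
  \<open>\<integral> |G(t,s)| ds \<le> 2 K \<rho>\<^sup>* / \<alpha>\<close> the first smallness condition turns it into a contraction with factor \<open>1/2\<close>
  (\<open>picard_contraction\<close>), and the growth condition, inserted into the fixed point equation, gives the a priori
  bound (\<open>fixed_point_bound\<close>).

  The constant \<open>2 K \<rho>\<^sup>* / \<alpha>\<close> is delicate. Bounding \<open>exp (- \<alpha> \<bar>t - \<tau>\<^sub>r\<bar>)\<close> pointwise by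
  \<open>exp (\<alpha> \<theta>) exp (- \<alpha> \<bar>t - s\<bar>)\<close> uses all of it for the transported term and leaves nothing for the local
  term. Instead the weights are summed over whole cells: by \<open>u \<le> 2 sinh (u/2)\<close> this costs only the factor
  \<open>exp (\<alpha> \<theta> / 2)\<close>, and the gain pays for the cell of \<open>t\<close> and for the local term (\<open>step_weight_integral\<close>,
  \<open>green_constant\<close>).

  The coefficients are only locally integrable, so solutions are primitives of Henstock-Kurzweil integrable
  functions and need not be differentiable at any prescribed point. The calculus of such primitives rests on one
  principle: a function whose increments are bounded by the square of the increments of a continuous monotone
  function does not increase (\<open>nonincreasing_if_quadratic_increments\<close>). It yields the product rule, hence the
  fundamental matrix and the variation of constants formula, and Gronwall's inequality in the given norm.
\<close>

section \<open>General norms on Euclidean spaces\<close>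

lemma is_norm_zero: "is_norm N \<Longrightarrow> N 0 = 0"
  and is_norm_eq_0: "is_norm N \<Longrightarrow> N x = 0 \<longleftrightarrow> x = 0"
  and is_norm_scale: "is_norm N \<Longrightarrow> N (c *\<^sub>R x) = \<bar>c\<bar> * N x"
  and is_norm_triangle: "is_norm N \<Longrightarrow> N (x + y) \<le> N x + N y"
  by (auto simp: is_norm_def)

lemma is_norm_minus: "is_norm N \<Longrightarrow> N (- x) = N x"
  using is_norm_scale[of N "-1" x] by simp

lemma is_norm_diff: "is_norm N \<Longrightarrow> N (x - y) \<le> N x + N y"
  using is_norm_triangle[of N x "- y"] by (simp add: is_norm_minus)

lemma is_norm_diff_commute: "is_norm N \<Longrightarrow> N (x - y) = N (y - x)"
  using is_norm_minus[of N "x - y"] by simp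

lemma is_norm_ge_0: "is_norm N \<Longrightarrow> 0 \<le> N x"
  using is_norm_diff[of N x x] is_norm_zero[of N] by simp

lemma is_norm_pos: "is_norm N \<Longrightarrow> x \<noteq> 0 \<Longrightarrow> 0 < N x"
  using is_norm_ge_0[of N x] is_norm_eq_0[of N x] by linarith

lemma is_norm_abs_diff: "is_norm N \<Longrightarrow> \<bar>N x - N y\<bar> \<le> N (x - y)"
  using is_norm_triangle[of N "x - y" y] is_norm_triangle[of N "y - x" x]
    is_norm_diff_commute[of N x y] by simp

lemma is_norm_upper:
  fixes N :: "'a::euclidean_space \<Rightarrow> real"
  assumes N: "is_norm N"
  obtains c where "c > 0" "\<And>x. N x \<le> c * norm x"
proof -
  have sum: "N (sum f A) \<le> (\<Sum>i\<in>A. N (f i))" if "finite A" for f :: "'a \<Rightarrow> 'a" and A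
    using that
  proof (induction A)
    case (insert i A)
    then show ?case using is_norm_triangle[OF N, of "f i" "sum f A"] by simp
  qed (simp add: is_norm_zero[OF N])
  have "N x \<le> ((\<Sum>i\<in>Basis. N i) + 1) * norm x" for x
  proof -
    have "N x = N (\<Sum>i\<in>Basis. (x \<bullet> i) *\<^sub>R i)" by (simp add: euclidean_representation)
    also have "\<dots> \<le> (\<Sum>i\<in>Basis. N ((x \<bullet> i) *\<^sub>R i))" by (rule sum) simp
    also have "\<dots> \<le> (\<Sum>i\<in>Basis. norm x * N i)"
      by (intro sum_mono) (simp add: is_norm_scale[OF N] is_norm_ge_0[OF N] mult_right_mono Basis_le_norm)
    also have "\<dots> = norm x * (\<Sum>i\<in>Basis. N i)" by (rule sum_distrib_left[symmetric])
    also have "\<dots> \<le> ((\<Sum>i\<in>Basis. N i) + 1) * norm x" by (simp add: algebra_simps)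
    finally show ?thesis .
  qed
  moreover have "(\<Sum>i\<in>Basis. N i) + 1 > (0::real)"
    using sum_nonneg[of Basis N] is_norm_ge_0[OF N] by (simp add: add_nonneg_pos)
  ultimately show ?thesis using that by blast
qed

lemma continuous_on_is_norm:
  fixes N :: "'a::euclidean_space \<Rightarrow> real"
  assumes N: "is_norm N"
  shows "continuous_on S N"
proof -
  obtain c where c: "c > 0" "\<And>x. N x \<le> c * norm x" using is_norm_upper[OF N] by blast
  have "c-lipschitz_on S N"
    unfolding lipschitz_on_def dist_norm
    using c is_norm_abs_diff[OF N] by (auto intro: order_trans)
  then show ?thesis by (rule lipschitz_on_continuous_on)
qed

lemma is_norm_lower:
  fixes N :: "'a::euclidean_space \<Rightarrow> real"
  assumes N: "is_norm N"
  obtains c where "c > 0" "\<And>x. norm x \<le> c * N x"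
proof -
  obtain u where u: "u \<in> sphere (0::'a) 1" "\<And>x. x \<in> sphere 0 1 \<Longrightarrow> N u \<le> N x"
    using continuous_attains_inf[of "sphere (0::'a) 1" N] continuous_on_is_norm[OF N]
    by (metis compact_sphere sphere_eq_empty not_one_less_zero order_less_irrefl)
  have pos: "N u > 0" using u is_norm_pos[OF N, of u] by fastforce
  have "norm x \<le> inverse (N u) * N x" for x
  proof (cases "x = 0")
    case False
    then have "N u \<le> N ((1 / norm x) *\<^sub>R x)" by (intro u) simp
    then show ?thesis using pos False by (simp add: is_norm_scale[OF N] field_simps)
  qed (simp add: is_norm_zero[OF N])
  then show ?thesis using that pos by (meson inverse_positive_iff_positive)
qed

text \<open>
  A separating hyperplane between \<open>x\<close> and the open ball of radius \<open>N x\<close>, rescaled to the value \<open>N x\<close> at \<open>x\<close>.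
  It reduces vector-valued estimates in the norm \<open>N\<close> to scalar ones.
\<close>
lemma is_norm_supporting_functional:
  fixes N :: "'a::euclidean_space \<Rightarrow> real"
  assumes N: "is_norm N"
  obtains a where "a \<bullet> x = N x" "\<And>y. a \<bullet> y \<le> N y"
proof (cases "x = 0")
  case True
  then show ?thesis using that[of 0] by (simp add: is_norm_zero[OF N] is_norm_ge_0[OF N])
next
  case False
  let ?S = "{y. N y < N x}"
  have xpos: "N x > 0" using False by (rule is_norm_pos[OF N])
  have "convex ?S"
  proof (rule convexI)
    fix p q and u v :: real
    assume *: "p \<in> ?S" "q \<in> ?S" "0 \<le> u" "0 \<le> v" "u + v = 1"
    have "N (u *\<^sub>R p + v *\<^sub>R q) \<le> u * N p + v * N q"
      using is_norm_triangle[OF N, of "u *\<^sub>R p" "v *\<^sub>R q"] * by (simp add: is_norm_scale[OF N])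
    also have "\<dots> < N x"
      using * convex_bound_lt[of "N p" "N x" "N q" u v] by simp
    finally show "u *\<^sub>R p + v *\<^sub>R q \<in> ?S" by simp
  qed
  then obtain a b where ab: "a \<noteq> 0" "\<And>y. N y < N x \<Longrightarrow> a \<bullet> y \<le> b" "a \<bullet> x \<ge> b"
    using separating_hyperplane_sets[of ?S "{x}"] xpos is_norm_zero[OF N] by auto
  have apos: "N a > 0" using ab by (simp add: is_norm_pos[OF N])
  have "a \<bullet> ((N x / (2 * N a)) *\<^sub>R a) \<le> b"
    by (rule ab) (use xpos apos in \<open>simp add: is_norm_scale[OF N]\<close>)
  then have bpos: "a \<bullet> x > 0"
    using ab(1,3) xpos apos by (smt (verit) divide_pos_pos inner_gt_zero_iff inner_scaleR_right mult_pos_pos)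
  have le: "(a \<bullet> y) * N x \<le> (a \<bullet> x) * N y" for y
  proof (cases "y = 0")
    case False
    then have ypos: "N y > 0" by (rule is_norm_pos[OF N])
    have "a \<bullet> y * (N x * k / N y) \<le> a \<bullet> x" if "0 < k" "k < 1" for k
    proof -
      have "a \<bullet> ((N x * k / N y) *\<^sub>R y) \<le> b"
        by (rule ab) (use that xpos ypos in \<open>simp add: is_norm_scale[OF N]\<close>)
      then show ?thesis using ab(3) by (simp add: mult.commute)
    qed
    then have "k * (a \<bullet> y * N x) \<le> a \<bullet> x * N y" if "0 < k" "k < 1" for k
      using that ypos by (simp add: field_simps)
    then show ?thesis by (metis field_le_mult_one_interval)
  qed (simp add: is_norm_zero[OF N])
  show ?thesis
  proof (rule that[of "(N x / (a \<bullet> x)) *\<^sub>R a"])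
    show "((N x / (a \<bullet> x)) *\<^sub>R a) \<bullet> x = N x" using bpos by simp
    show "((N x / (a \<bullet> x)) *\<^sub>R a) \<bullet> y \<le> N y" for y
      using le[of y] bpos by (simp add: field_simps)
  qed
qed

text \<open>
  The triangle inequality for integrals holds for every norm: apply the functional supporting \<open>N\<close> at the value
  of the integral and exchange it with the integral.
\<close>
lemma is_norm_integral_le:
  fixes N :: "'a::euclidean_space \<Rightarrow> real" and f :: "'b::euclidean_space \<Rightarrow> 'a"
  assumes N: "is_norm N" and "f integrable_on S" "k integrable_on S" "\<And>s. s \<in> S \<Longrightarrow> N (f s) \<le> k s"
  shows "N (integral S f) \<le> integral S k"
proof -
  obtain a where a: "a \<bullet> integral S f = N (integral S f)" "\<And>y. a \<bullet> y \<le> N y"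
    using is_norm_supporting_functional[OF N] by blast
  have "((\<lambda>s. a \<bullet> f s) has_integral (a \<bullet> integral S f)) S"
    using has_integral_linear[OF integrable_integral[OF assms(2)] bounded_linear_inner_right[of a]]
    by (simp add: o_def)
  then have "a \<bullet> integral S f \<le> integral S k"
    by (rule has_integral_le[OF _ integrable_integral[OF assms(3)]]) (meson a assms(4) order_trans)
  then show ?thesis using a by simp
qed

lemma is_norm_absolutely_integrable:
  fixes N :: "'a::euclidean_space \<Rightarrow> real" and f :: "real \<Rightarrow> 'a"
  assumes N: "is_norm N" and f: "f absolutely_integrable_on S" "S \<in> sets lebesgue"
  shows "(\<lambda>s. N (f s)) absolutely_integrable_on S"
proof -
  obtain c where c: "c > 0" "\<And>x. N x \<le> c * norm x" using is_norm_upper[OF N] by blast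
  have "N \<in> borel_measurable borel"
    using continuous_on_is_norm[OF N] by (simp add: borel_measurable_continuous_onI)
  then have "(\<lambda>s. N (f s)) \<in> borel_measurable (lebesgue_on S)"
    using absolutely_integrable_imp_borel_measurable[OF f] by measurable
  then show ?thesis
    by (rule measurable_bounded_by_integrable_imp_absolutely_integrable[where g = "\<lambda>s. c * norm (f s)"])
      (use f c is_norm_ge_0[OF N] in \<open>auto simp: absolutely_integrable_on_def\<close>)
qed

lemma vector_matrix_normD:
  assumes "vector_matrix_norm vn mn"
  shows "is_norm vn" "is_norm mn" "mn (A ** B) \<le> mn A * mn B" "vn (A *v x) \<le> mn A * vn x"
  using assms by (auto simp: vector_matrix_norm_def)

section \<open>Primitives of integrable functions\<close>

definition primitive_on :: "real set \<Rightarrow> (real \<Rightarrow> 'a::euclidean_space) \<Rightarrow> (real \<Rightarrow> 'a) \<Rightarrow> bool" where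
  "primitive_on S F f \<longleftrightarrow> (\<forall>a\<in>S. \<forall>b\<in>S. a \<le> b \<longrightarrow> (f has_integral (F b - F a)) {a..b})"

lemma matrix_add_distrib_right: "(B + C) ** (A :: real^'k^'n) = B ** A + C ** (A :: real^'k^'n)"
  by (vector matrix_matrix_mult_def sum.distrib[symmetric] field_simps)

lemma bilinear_matrix_mult: "bilinear ((**) :: real^'n^'m \<Rightarrow> real^'k^'n \<Rightarrow> real^'k^'m)"
  unfolding bilinear_def
  by (auto intro!: linearI simp: matrix_add_ldistrib matrix_add_distrib_right matrix_scalar_ac simp flip: scalar_matrix_assoc)

lemma bilinear_matrix_vector_mult: "bilinear ((*v) :: real^'n^'m \<Rightarrow> real^'n \<Rightarrow> real^'m)"
  unfolding bilinear_def
  by (auto intro!: linearI simp: matrix_vector_right_distrib matrix_vector_mult_add_rdistrib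
     matrix_vector_mult_scaleR scaleR_matrix_vector_assoc)

lemma primitive_onD:
  "primitive_on S F f \<Longrightarrow> a \<in> S \<Longrightarrow> b \<in> S \<Longrightarrow> a \<le> b \<Longrightarrow> (f has_integral (F b - F a)) {a..b}"
  by (auto simp: primitive_on_def)

lemma primitive_on_subset: "primitive_on S F f \<Longrightarrow> T \<subseteq> S \<Longrightarrow> primitive_on T F f"
  by (auto simp: primitive_on_def)

lemma primitive_on_integral:
  assumes "f integrable_on {a..b}"
  shows "primitive_on {a..b} (\<lambda>t. integral {a..t} f) f"
  unfolding primitive_on_def
proof (intro ballI impI)
  fix s t assume st: "s \<in> {a..b}" "t \<in> {a..b}" "s \<le> t"
  have "f integrable_on {a..t}" "f integrable_on {s..t}"
    using st assms by (auto intro: integrable_on_subinterval)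
  moreover have "integral {a..s} f + integral {s..t} f = integral {a..t} f"
    using st calculation by (intro Henstock_Kurzweil_Integration.integral_combine) auto
  ultimately show "(f has_integral (integral {a..t} f - integral {a..s} f)) {s..t}"
    by (metis add_diff_cancel_left' integrable_integral)
qed

lemma primitive_on_continuous:
  assumes F: "primitive_on {a..b} F f"
  shows "continuous_on {a..b} F"
proof (cases "a \<le> b")
  case True
  have F': "F t = F a + integral {a..t} f" if "t \<in> {a..b}" for t
    using primitive_onD[OF F, of a t] that True by (auto simp: has_integral_iff)
  have "f integrable_on {a..b}"
    using primitive_onD[OF F, of a b] True by (auto simp: has_integral_iff)
  then have "continuous_on {a..b} (\<lambda>t. F a + integral {a..t} f)"
    by (intro continuous_intros indefinite_integral_continuous_1)
  then show ?thesis using F' by (metis (no_types, lifting) continuous_on_cong)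
qed auto

lemma primitive_on_UNIV_continuous:
  assumes F: "primitive_on UNIV F f"
  shows "continuous_on UNIV F"
proof -
  have "isCont F x" for x
  proof -
    have "continuous_on {x-1..x+1} F"
      by (rule primitive_on_continuous[OF primitive_on_subset[OF F]]) auto
    then have "continuous_on {x-1<..<x+1} F"
      by (rule continuous_on_subset) auto
    then show ?thesis by (simp add: continuous_on_eq_continuous_at)
  qed
  then show ?thesis by (simp add: continuous_at_imp_continuous_on)
qed

lemma absolutely_integrable_bilinear_right:
  fixes p :: "'a::euclidean_space \<Rightarrow> 'b::euclidean_space \<Rightarrow> 'c::euclidean_space"
  assumes p: "bilinear p" and g: "continuous_on {a..b::real} g" and f: "f absolutely_integrable_on {a..b}"
  shows "(\<lambda>s. p (g s) (f s)) absolutely_integrable_on {a..b}"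
proof -
  have m: "g \<in> borel_measurable (lebesgue_on {a..b})"
    using g by (rule continuous_imp_measurable_on_sets_lebesgue) simp
  have bd: "bounded (g ` {a..b})"
    using g by (intro compact_imp_bounded compact_continuous_image) auto
  show ?thesis
    by (rule absolutely_integrable_bounded_measurable_product[OF p m _ bd f]) auto
qed

lemma absolutely_integrable_bilinear_left:
  fixes p :: "'a::euclidean_space \<Rightarrow> 'b::euclidean_space \<Rightarrow> 'c::euclidean_space"
  assumes p: "bilinear p" and f: "f absolutely_integrable_on {a..b::real}" and g: "continuous_on {a..b} g"
  shows "(\<lambda>s. p (f s) (g s)) absolutely_integrable_on {a..b}"
proof -
  have "bilinear (\<lambda>x y. p y x)" using p by (auto simp: bilinear_def)
  from absolutely_integrable_bilinear_right[OF this g f] show ?thesis by simp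
qed

text \<open>
  On a partition so fine that every increment of \<open>m\<close> is at most \<open>e\<close>, the squares add up to at most
  \<open>e * (m b - m a)\<close>, and \<open>e\<close> is arbitrary.
\<close>
lemma nonincreasing_if_quadratic_increments:
  fixes F m :: "real \<Rightarrow> real"
  assumes "a \<le> b" "C \<ge> 0" and m: "continuous_on {a..b} m"
    and mono: "\<And>s t. a \<le> s \<Longrightarrow> s \<le> t \<Longrightarrow> t \<le> b \<Longrightarrow> m s \<le> m t"
    and F: "\<And>s t. a \<le> s \<Longrightarrow> s \<le> t \<Longrightarrow> t \<le> b \<Longrightarrow> F t - F s \<le> C * (m t - m s)\<^sup>2"
  shows "F b \<le> F a"
proof (rule field_le_epsilon)
  fix e0 :: real assume "e0 > 0"
  \<comment> \<open>The summand 1 avoids a division by zero and makes the final estimate at most \<open>e0\<close>.\<close>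
  define e where "e = e0 / (C * (m b - m a) + 1)"
  have nn: "C * (m b - m a) \<ge> 0" using mono[of a b] assms by simp
  have e: "e > 0" using \<open>e0 > 0\<close> nn by (simp add: e_def)
  obtain d where d: "d > 0" "\<And>s t. s \<in> {a..b} \<Longrightarrow> t \<in> {a..b} \<Longrightarrow> dist s t < d \<Longrightarrow> dist (m s) (m t) < e"
    using compact_uniformly_continuous[OF m] e unfolding uniformly_continuous_on_def by (metis compact_Icc)
  obtain n :: nat where n: "(b - a) / d < real n" using reals_Archimedean2 by blast
  have n0: "real n > 0" using n d assms(1) by (smt (verit) divide_nonneg_pos)
  have nd: "(b - a) / n < d" using n n0 d by (simp add: field_simps)
  define p where "p k = a + real k * ((b - a) / n)" for k
  have p_le: "p k \<le> b" if "k \<le> n" for k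
  proof -
    have "real k * ((b - a) / n) \<le> n * ((b - a) / n)"
      using that assms(1) by (intro mult_right_mono) auto
    then show ?thesis using n0 by (simp add: p_def)
  qed
  have p_ge: "a \<le> p k" for k using assms(1) by (simp add: p_def)
  have "k \<le> n \<Longrightarrow> F (p k) - F a \<le> C * e * (m (p k) - m a)" for k
  proof (induction k)
    case (Suc k)
    have diff: "p (Suc k) - p k = (b - a) / n"
      unfolding p_def of_nat_Suc distrib_right by simp
    then have ps: "p k \<le> p (Suc k)" using assms(1) by (smt (verit) divide_nonneg_nonneg of_nat_0_le_iff)
    have "dist (m (p k)) (m (p (Suc k))) < e"
      by (rule d) (use Suc.prems p_le[of k] p_le[of "Suc k"] p_ge nd diff ps in \<open>auto simp: dist_real_def\<close>)
    then have dm: "m (p (Suc k)) - m (p k) \<le> e" "m (p (Suc k)) - m (p k) \<ge> 0"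
      using mono[of "p k" "p (Suc k)"] ps p_ge p_le[of "Suc k"] Suc.prems by (auto simp: dist_real_def)
    have "F (p (Suc k)) - F (p k) \<le> C * (m (p (Suc k)) - m (p k))\<^sup>2"
      using Suc.prems ps p_ge p_le[of "Suc k"] by (intro F) auto
    also have "\<dots> \<le> C * (e * (m (p (Suc k)) - m (p k)))"
      using dm assms(2) by (auto simp: power2_eq_square intro!: mult_left_mono mult_right_mono)
    finally show ?case using Suc by (simp add: algebra_simps)
  qed (simp add: p_def)
  from this[of n] have "F b - F a \<le> C * e * (m b - m a)" using n0 by (simp add: p_def)
  also have "\<dots> = e * (C * (m b - m a))" by simp
  also have "\<dots> \<le> e0" using nn \<open>e0 > 0\<close> by (simp add: e_def field_simps)
  finally show "F b \<le> F a + e0" by simp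
qed

lemma constant_if_quadratic_increments:
  fixes F :: "real \<Rightarrow> 'a::real_normed_vector" and m :: "real \<Rightarrow> real"
  assumes "a \<le> b" "C \<ge> 0" "continuous_on {a..b} m"
    and "\<And>s t. a \<le> s \<Longrightarrow> s \<le> t \<Longrightarrow> t \<le> b \<Longrightarrow> m s \<le> m t"
    and F: "\<And>s t. a \<le> s \<Longrightarrow> s \<le> t \<Longrightarrow> t \<le> b \<Longrightarrow> norm (F t - F s) \<le> C * (m t - m s)\<^sup>2"
  shows "F b = F a"
proof -
  have "norm (F b - F a) \<le> norm (F a - F a)"
  proof (rule nonincreasing_if_quadratic_increments[OF assms(1-4), where F = "\<lambda>t. norm (F t - F a)"])
    fix s t assume "a \<le> s" "s \<le> t" "t \<le> b"
    then show "norm (F t - F a) - norm (F s - F a) \<le> C * (m t - m s)\<^sup>2"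
      using F[of s t] norm_triangle_ineq2[of "F t - F a" "F s - F a"] by simp
  qed auto
  then show ?thesis by simp
qed

lemma has_integral_norm_le:
  fixes f :: "'b::euclidean_space \<Rightarrow> 'a::euclidean_space"
  assumes "(f has_integral i) S" "(g has_integral k) S" "\<And>s. s \<in> S \<Longrightarrow> norm (f s) \<le> g s"
  shows "norm i \<le> k"
  using integral_norm_bound_integral[of f S g] assms by (auto simp: has_integral_iff)

lemma primitive_on_norm_diff_le:
  fixes F :: "real \<Rightarrow> 'a::euclidean_space"
  assumes F: "primitive_on {a..b} F f" and m: "primitive_on {a..b} m g"
    and le: "\<And>s. s \<in> {a..b} \<Longrightarrow> norm (f s) \<le> g s" and st: "a \<le> s" "s \<le> t" "t \<le> b"
  shows "norm (F t - F s) \<le> m t - m s"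
proof -
  have 1: "(f has_integral (F t - F s)) {s..t}" "(g has_integral (m t - m s)) {s..t}"
    using st by (auto intro!: primitive_onD[OF F] primitive_onD[OF m])
  then show ?thesis using le st
    by (metis (no_types, lifting) atLeastAtMost_iff has_integral_iff integral_norm_bound_integral order_trans)
qed

text \<open>
  The product rule for primitives. Over \<open>[s, t]\<close> the defect is the integral of
  \<open>p (x r) (Y t - Y r) + p (X s - X r) (y r)\<close>. If \<open>m\<close> is a primitive of \<open>norm x + norm y\<close>, the differences of \<open>X\<close>
  and \<open>Y\<close> are at most \<open>m t - m s\<close>, so that the defect is quadratic in the increment of \<open>m\<close> and vanishes.
\<close>
lemma primitive_on_bilinear:
  fixes p :: "'a::euclidean_space \<Rightarrow> 'b::euclidean_space \<Rightarrow> 'c::euclidean_space"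
  assumes p: "bilinear p"
    and X: "primitive_on {a..b} X x" and x: "x absolutely_integrable_on {a..b}"
    and Y: "primitive_on {a..b} Y y" and y: "y absolutely_integrable_on {a..b}"
  shows "primitive_on {a..b} (\<lambda>t. p (X t) (Y t)) (\<lambda>s. p (x s) (Y s) + p (X s) (y s))"
  unfolding primitive_on_def
proof (intro ballI impI)
  fix c d assume cd: "c \<in> {a..b}" "d \<in> {a..b}" "c \<le> d"
  interpret p: bounded_bilinear p using p by (simp add: bilinear_conv_bounded_bilinear)
  obtain B where B: "B \<ge> 0" "\<And>x y. norm (p x y) \<le> norm x * norm y * B"
    using p.nonneg_bounded by blast
  let ?k = "\<lambda>s. p (x s) (Y s) + p (X s) (y s)"
  have X': "primitive_on {c..d} X x" and Y': "primitive_on {c..d} Y y"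
    using cd by (auto intro: primitive_on_subset[OF X] primitive_on_subset[OF Y])
  have x': "x absolutely_integrable_on {c..d}" and y': "y absolutely_integrable_on {c..d}"
    using x y cd by (auto intro: absolutely_integrable_on_subinterval)
  have "?k absolutely_integrable_on {c..d}"
    by (intro set_integral_add absolutely_integrable_bilinear_left[OF p x' primitive_on_continuous[OF Y']]
       absolutely_integrable_bilinear_right[OF p primitive_on_continuous[OF X'] y'])
  then have k: "?k integrable_on {c..d}"
    by (simp add: absolutely_integrable_on_def)
  define n where "n s = norm (x s) + norm (y s)" for s
  have n: "n integrable_on {c..d}"
    using x' y' unfolding n_def by (auto simp: absolutely_integrable_on_def intro: integrable_add)
  define m where "m t = integral {c..t} n" for t
  have m: "primitive_on {c..d} m n"
    unfolding m_def by (rule primitive_on_integral[OF n])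
  have dX: "norm (X t - X s) \<le> m t - m s" if "c \<le> s" "s \<le> t" "t \<le> d" for s t
    using that by (intro primitive_on_norm_diff_le[OF X' m]) (auto simp: n_def)
  have dY: "norm (Y t - Y s) \<le> m t - m s" if "c \<le> s" "s \<le> t" "t \<le> d" for s t
    using that by (intro primitive_on_norm_diff_le[OF Y' m]) (auto simp: n_def)
  have mono: "m s \<le> m t" if "c \<le> s" "s \<le> t" "t \<le> d" for s t
    using dX[OF that] norm_ge_zero[of "X t - X s"] by linarith
  define F where "F t = p (X t) (Y t) - integral {c..t} ?k" for t
  have "F d = F c"
  proof (rule constant_if_quadratic_increments[OF cd(3) B(1), of m])
    show "continuous_on {c..d} m" by (rule primitive_on_continuous[OF m])
    show "m s \<le> m t" if "c \<le> s" "s \<le> t" "t \<le> d" for s t using that by (rule mono)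
    fix s t assume st: "c \<le> s" "s \<le> t" "t \<le> d"
    have xi: "(x has_integral (X t - X s)) {s..t}" and yi: "(y has_integral (Y t - Y s)) {s..t}"
      using st by (auto intro!: primitive_onD[OF X'] primitive_onD[OF Y'])
    have "((\<lambda>r. p (x r) (Y t)) has_integral p (X t - X s) (Y t)) {s..t}"
      using has_integral_linear[OF xi p.bounded_linear_left[of "Y t"]] by (simp add: o_def)
    moreover have "((\<lambda>r. p (X s) (y r)) has_integral p (X s) (Y t - Y s)) {s..t}"
      using has_integral_linear[OF yi p.bounded_linear_right[of "X s"]] by (simp add: o_def)
    moreover have "(?k has_integral (integral {c..t} ?k - integral {c..s} ?k)) {s..t}"
      using st by (intro primitive_onD[OF primitive_on_integral[OF k]]) auto
    ultimately have "((\<lambda>r. p (x r) (Y t) + p (X s) (y r) - ?k r) has_integral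
        (p (X t - X s) (Y t) + p (X s) (Y t - Y s) - (integral {c..t} ?k - integral {c..s} ?k))) {s..t}"
      by (intro has_integral_diff has_integral_add)
    moreover have "p (X t - X s) (Y t) + p (X s) (Y t - Y s) - (integral {c..t} ?k - integral {c..s} ?k) = F t - F s"
      by (simp add: F_def p.diff_left p.diff_right)
    ultimately have Fi: "((\<lambda>r. p (x r) (Y t) + p (X s) (y r) - ?k r) has_integral (F t - F s)) {s..t}"
      by simp
    have ni: "((\<lambda>r. B * (m t - m s) * n r) has_integral (B * (m t - m s) * (m t - m s))) {s..t}"
      using st by (intro has_integral_mult_right primitive_onD[OF m]) auto
    have "norm (F t - F s) \<le> B * (m t - m s) * (m t - m s)"
    proof (rule has_integral_norm_le[OF Fi ni])
      fix r assume r: "r \<in> {s..t}"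
      have "norm (p (x r) (Y t - Y r)) \<le> norm (x r) * norm (Y t - Y r) * B" by (rule B)
      also have "\<dots> \<le> norm (x r) * (m t - m s) * B"
        using r st dY[of r t] mono[of s r] B(1) by (intro mult_right_mono mult_left_mono) auto
      finally have 1: "norm (p (x r) (Y t - Y r)) \<le> norm (x r) * (m t - m s) * B" .
      have "norm (p (X s - X r) (y r)) \<le> norm (X s - X r) * norm (y r) * B" by (rule B)
      also have "\<dots> \<le> (m t - m s) * norm (y r) * B"
        using r st dX[of s r] mono[of r t] B(1)
        by (intro mult_right_mono mult_left_mono) (auto simp: norm_minus_commute)
      finally have 2: "norm (p (X s - X r) (y r)) \<le> (m t - m s) * norm (y r) * B" .
      have "p (x r) (Y t) + p (X s) (y r) - ?k r = p (x r) (Y t - Y r) + p (X s - X r) (y r)"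
        by (simp add: p.diff_left p.diff_right)
      then show "norm (p (x r) (Y t) + p (X s) (y r) - ?k r) \<le> B * (m t - m s) * n r"
        using 1 2 norm_triangle_ineq[of "p (x r) (Y t - Y r)" "p (X s - X r) (y r)"]
        by (simp add: n_def algebra_simps)
    qed
    then show "norm (F t - F s) \<le> B * (m t - m s)\<^sup>2" by (simp add: power2_eq_square mult.assoc)
  qed
  then have "integral {c..d} ?k = p (X d) (Y d) - p (X c) (Y c)"
    by (simp add: F_def algebra_simps)
  then show "(?k has_integral (p (X d) (Y d) - p (X c) (Y c))) {c..d}"
    using k by (simp add: has_integral_iff)
qed

section \<open>Existence for linear equations with integrable coefficients\<close>

text \<open>
  The substitution rule for \<open>exp (lam * m)\<close>, as an inequality. It replaces the factorials of the usual Picard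
  estimate by a weight for which the iteration is a contraction on the whole half line.
\<close>
lemma primitive_on_exp_weight:
  assumes m: "primitive_on {0..T} m a" and a: "a absolutely_integrable_on {0..T}"
    and nn: "\<And>s. s \<in> {0..T} \<Longrightarrow> a s \<ge> 0" and lam: "lam > (0::real)" and T: "0 \<le> T"
  shows "integral {0..T} (\<lambda>s. a s * exp (lam * m s)) \<le> (exp (lam * m T) - exp (lam * m 0)) / lam"
proof -
  let ?e = "\<lambda>s. exp (lam * m s)"
  have cm: "continuous_on {0..T} m" by (rule primitive_on_continuous[OF m])
  have mono: "m s \<le> m t" if "0 \<le> s" "s \<le> t" "t \<le> T" for s t
  proof -
    have "(a has_integral (m t - m s)) {s..t}" by (rule primitive_onD[OF m]) (use that in auto)
    then have "0 \<le> m t - m s" by (rule has_integral_nonneg) (use nn that in auto)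
    then show ?thesis by simp
  qed
  have "(\<lambda>s. a s * ?e s) absolutely_integrable_on {0..T}"
    by (rule absolutely_integrable_bilinear_left[OF bilinear_times a]) (intro continuous_intros cm)
  then have int: "(\<lambda>s. a s * ?e s) integrable_on {0..T}" by (simp add: absolutely_integrable_on_def)
  define F where "F t = integral {0..t} (\<lambda>s. a s * ?e s) - ?e t / lam" for t
  have "F T \<le> F 0"
  proof (rule nonincreasing_if_quadratic_increments[OF T _ cm mono, where C = "lam * ?e T"])
    fix s t assume st: "0 \<le> s" "s \<le> t" "t \<le> T"
    let ?d = "m t - m s"
    have d: "?d \<ge> 0" using mono st by simp
    have "((\<lambda>r. a r * ?e r) has_integral
        (integral {0..t} (\<lambda>s. a s * ?e s) - integral {0..s} (\<lambda>s. a s * ?e s))) {s..t}"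
      by (rule primitive_onD[OF primitive_on_integral[OF int]]) (use st in auto)
    moreover have "((\<lambda>r. a r * ?e t) has_integral (?d * ?e t)) {s..t}"
      by (intro has_integral_mult_left primitive_onD[OF m]) (use st in auto)
    ultimately have "integral {0..t} (\<lambda>s. a s * ?e s) - integral {0..s} (\<lambda>s. a s * ?e s) \<le> ?d * ?e t"
      by (rule has_integral_le) (use nn mono st lam in \<open>auto intro!: mult_left_mono\<close>)
    moreover have "?e t = ?e s * exp (lam * ?d)"
      by (simp add: algebra_simps flip: exp_add)
    then have "?e t - ?e s \<ge> ?e s * (lam * ?d)"
      using exp_ge_add_one_self[of "lam * ?d"] mult_left_mono[of "1 + lam * ?d" "exp (lam * ?d)" "?e s"]
      by (simp add: algebra_simps)
    then have "(?e t - ?e s) / lam \<ge> ?e s * ?d"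
      using lam by (simp add: field_simps)
    ultimately have 1: "F t - F s \<le> ?d * (?e t - ?e s)"
      by (simp add: F_def diff_divide_distrib algebra_simps)
    have "?e s = ?e t * exp (- (lam * ?d))"
      by (simp add: algebra_simps flip: exp_add)
    then have "?e s \<ge> ?e t * (1 - lam * ?d)"
      using exp_ge_add_one_self[of "- (lam * ?d)"] by (simp add: mult_left_mono)
    then have "?e t - ?e s \<le> lam * ?e t * ?d" by (simp add: algebra_simps)
    also have "\<dots> \<le> lam * ?e T * ?d"
      using d lam mono[of t T] st by (intro mult_right_mono mult_left_mono) auto
    finally have "?d * (?e t - ?e s) \<le> ?d * (lam * ?e T * ?d)"
      using d by (rule mult_left_mono)
    with 1 show "F t - F s \<le> lam * ?e T * ?d\<^sup>2" by (simp add: power2_eq_square algebra_simps)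
  qed (use lam in auto)
  then show ?thesis by (simp add: F_def diff_divide_distrib)
qed

text \<open>
  The Picard series: its \<open>n\<close>-th term is at most \<open>C * exp (lam * m t) / 2 ^ n\<close>, where \<open>m\<close> is a primitive of
  \<open>norm a\<close> and \<open>lam\<close> is twice the bound of the bilinear map.
\<close>
lemma linear_ode_exists_forward:
  fixes p :: "'b::euclidean_space \<Rightarrow> 'a::euclidean_space \<Rightarrow> 'a" and a :: "real \<Rightarrow> 'b"
  assumes p: "bilinear p" and a: "\<And>T. a absolutely_integrable_on {0..T}"
  obtains X where "X 0 = x0" "primitive_on {0..} X (\<lambda>s. p (a s) (X s))"
proof -
  interpret p: bounded_bilinear p using p by (simp add: bilinear_conv_bounded_bilinear)
  obtain B where B: "B > 0" "\<And>x y. norm (p x y) \<le> norm x * norm y * B"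
    using p.pos_bounded by blast
  define m where "m t = integral {0..t} (\<lambda>s. norm (a s))" for t
  have na: "(\<lambda>s. norm (a s)) absolutely_integrable_on {0..T}" for T
    using a[of T] by (auto simp: absolutely_integrable_on_def)
  have m: "primitive_on {0..T} m (\<lambda>s. norm (a s))" for T
    unfolding m_def using a[of T] by (intro primitive_on_integral) (simp add: absolutely_integrable_on_def)
  have cm: "continuous_on {0..T} m" for T by (rule primitive_on_continuous[OF m])
  have m_mono: "m s \<le> m t" if "0 \<le> s" "s \<le> t" for s t
  proof -
    have "((\<lambda>s. norm (a s)) has_integral (m t - m s)) {s..t}"
      by (rule primitive_onD[OF m[of t]]) (use that in auto)
    then have "0 \<le> m t - m s" by (rule has_integral_nonneg) auto
    then show ?thesis by simp
  qed
  define lam where "lam = 2 * B"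
  have lam: "lam > 0" using B by (simp add: lam_def)
  let ?e = "\<lambda>t. exp (lam * m t)"
  define C where "C = norm x0"
  define x where "x = rec_nat (\<lambda>t. x0) (\<lambda>n xn t. integral {0..t} (\<lambda>s. p (a s) (xn s)))"
  have x0: "x 0 = (\<lambda>t. x0)" and xS: "x (Suc n) = (\<lambda>t. integral {0..t} (\<lambda>s. p (a s) (x n s)))" for n
    by (simp_all add: x_def)
  have ai: "(\<lambda>s. p (a s) (y s)) absolutely_integrable_on {0..T}" if "continuous_on {0..T} y" for y T
    by (rule absolutely_integrable_bilinear_left[OF p a that])
  have i: "(\<lambda>s. p (a s) (y s)) integrable_on {0..T}" if "continuous_on {0..T} y" for y T
    using ai[OF that] by (simp add: absolutely_integrable_on_def)
  have cx: "continuous_on {0..T} (x n)" for n T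
  proof (induction n)
    case (Suc n)
    then show ?case unfolding xS by (intro indefinite_integral_continuous_1 i)
  qed (simp add: x0)
  have bx: "norm (x n t) \<le> C * ?e t / 2 ^ n" if "0 \<le> t" for n t
    using that
  proof (induction n arbitrary: t)
    case 0
    have "m t \<ge> 0" using m_mono[of 0 t] 0 by (simp add: m_def)
    then have "?e t \<ge> 1" using lam by simp
    then show ?case using mult_left_mono[of 1 "?e t" C] by (simp add: x0 C_def)
  next
    case (Suc n)
    have ie: "(\<lambda>s. norm (a s) * ?e s) integrable_on {0..t}"
    proof -
      have "continuous_on {0..t} ?e" by (intro continuous_intros cm)
      from absolutely_integrable_bilinear_left[OF bilinear_times na[of t] this]
      show ?thesis by (simp add: absolutely_integrable_on_def)
    qed
    have "norm (x (Suc n) t) \<le> integral {0..t} (\<lambda>s. B * C / 2 ^ n * (norm (a s) * ?e s))"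
      unfolding xS
    proof (rule integral_norm_bound_integral[OF i[OF cx]])
      show "(\<lambda>s. B * C / 2 ^ n * (norm (a s) * ?e s)) integrable_on {0..t}"
        using ie by (rule integrable_on_mult_right)
      fix s assume s: "s \<in> {0..t}"
      have "norm (p (a s) (x n s)) \<le> norm (a s) * norm (x n s) * B" by (rule B)
      also have "\<dots> \<le> norm (a s) * (C * ?e s / 2 ^ n) * B"
        using Suc.IH[of s] s B by (intro mult_right_mono mult_left_mono) auto
      finally show "norm (p (a s) (x n s)) \<le> B * C / 2 ^ n * (norm (a s) * ?e s)" by (simp add: algebra_simps)
    qed
    also have "\<dots> = B * C / 2 ^ n * integral {0..t} (\<lambda>s. norm (a s) * ?e s)" by simp
    also have "\<dots> \<le> B * C / 2 ^ n * ((?e t - ?e 0) / lam)"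
      using B Suc.prems by (intro mult_left_mono primitive_on_exp_weight[OF m na]) (auto simp: C_def lam)
    also have "\<dots> \<le> B * C / 2 ^ n * (?e t / lam)"
      using B lam by (intro mult_left_mono divide_right_mono) (auto simp: C_def)
    also have "\<dots> = C * ?e t / 2 ^ Suc n" using B by (simp add: lam_def)
    finally show ?case .
  qed
  have geo: "summable (\<lambda>n. c / 2 ^ n)" "(\<Sum>n<k. c / 2 ^ n) \<le> 2 * c" if "c \<ge> 0" for c :: real and k
  proof -
    have "(\<lambda>n. c * (1 / 2) ^ n) sums (c * 2)" using geometric_sums[of "1/2 :: real"] by (intro sums_mult) simp
    then have s: "(\<lambda>n. c / 2 ^ n) sums (c * 2)" by (simp add: power_divide)
    then show "summable (\<lambda>n. c / 2 ^ n)" by (rule sums_summable)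
    then show "(\<Sum>n<k. c / 2 ^ n) \<le> 2 * c"
      using sum_le_suminf[of "\<lambda>n. c / 2 ^ n" "{..<k}"] that sums_unique[OF s] by simp
  qed
  have sx: "summable (\<lambda>n. x n t)" if "0 \<le> t" for t
  proof (rule summable_comparison_test')
    show "summable (\<lambda>n. C * ?e t / 2 ^ n)" by (rule geo) (simp add: C_def)
    show "norm (x n t) \<le> C * ?e t / 2 ^ n" for n using that by (rule bx)
  qed
  define S where "S k t = (\<Sum>n<k. x n t)" for k t
  define X where "X t = (\<Sum>n. x n t)" for t
  have SX: "(\<lambda>k. S k t) \<longlonglongrightarrow> X t" if "0 \<le> t" for t
    unfolding S_def X_def using summable_LIMSEQ[OF sx[OF that]] .
  have cS: "continuous_on {0..T} (S k)" for k T
    unfolding S_def by (intro continuous_intros cx)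
  have bS: "norm (S k t) \<le> 2 * (C * ?e t)" if "0 \<le> t" for k t
  proof -
    have "norm (S k t) \<le> (\<Sum>n<k. C * ?e t / 2 ^ n)"
      unfolding S_def by (rule sum_norm_le) (use bx that in auto)
    also have "\<dots> \<le> 2 * (C * ?e t)" by (rule geo) (simp add: C_def)
    finally show ?thesis .
  qed
  have SS: "S (Suc k) t = x0 + integral {0..t} (\<lambda>s. p (a s) (S k s))" for k t
  proof -
    have "S (Suc k) t = x0 + (\<Sum>n<k. x (Suc n) t)"
      unfolding S_def sum.lessThan_Suc_shift by (simp add: x0)
    also have "(\<Sum>n<k. x (Suc n) t) = integral {0..t} (\<lambda>s. \<Sum>n<k. p (a s) (x n s))"
      unfolding xS by (rule integral_sum[symmetric]) (use i cx in auto)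
    finally show ?thesis by (simp add: S_def p.sum_right)
  qed
  have X: "(\<lambda>s. p (a s) (X s)) integrable_on {0..t}" "X t = x0 + integral {0..t} (\<lambda>s. p (a s) (X s))"
    if t: "0 \<le> t" for t
  proof -
    let ?h = "\<lambda>s. norm (a s) * (2 * (C * ?e t)) * B"
    have h: "?h integrable_on {0..t}"
      using na[of t] by (intro integrable_on_mult_left) (auto simp: absolutely_integrable_on_def)
    have le: "norm (p (a s) (S k s)) \<le> ?h s" if s: "s \<in> {0..t}" for k s
    proof -
      have "norm (p (a s) (S k s)) \<le> norm (a s) * norm (S k s) * B" by (rule B)
      also have "\<dots> \<le> norm (a s) * (2 * (C * ?e s)) * B"
        using bS[of s k] s B by (intro mult_right_mono mult_left_mono) auto
      also have "\<dots> \<le> ?h s"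
        using m_mono[of s t] s B lam by (intro mult_right_mono mult_left_mono) (auto simp: C_def)
      finally show ?thesis .
    qed
    have conv: "(\<lambda>k. p (a s) (S k s)) \<longlonglongrightarrow> p (a s) (X s)" if "s \<in> {0..t}" for s
      using SX[of s] that by (intro p.tendsto tendsto_const) auto
    show "(\<lambda>s. p (a s) (X s)) integrable_on {0..t}"
      by (rule dominated_convergence(1)[OF i[OF cS] h le conv])
    have "(\<lambda>k. integral {0..t} (\<lambda>s. p (a s) (S k s))) \<longlonglongrightarrow> integral {0..t} (\<lambda>s. p (a s) (X s))"
      by (rule dominated_convergence(2)[OF i[OF cS] h le conv])
    then have "(\<lambda>k. S (Suc k) t) \<longlonglongrightarrow> x0 + integral {0..t} (\<lambda>s. p (a s) (X s))"
      unfolding SS by (intro tendsto_intros)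
    with LIMSEQ_Suc[OF SX[OF t]] show "X t = x0 + integral {0..t} (\<lambda>s. p (a s) (X s))"
      by (rule LIMSEQ_unique)
  qed
  show ?thesis
  proof (rule that)
    show "X 0 = x0" using X(2)[of 0] by simp
    show "primitive_on {0..} X (\<lambda>s. p (a s) (X s))"
      unfolding primitive_on_def
    proof (intro ballI impI)
      fix s t :: real assume st: "s \<in> {0..}" "t \<in> {0..}" "s \<le> t"
      have "((\<lambda>s. p (a s) (X s)) has_integral
        (integral {0..t} (\<lambda>s. p (a s) (X s)) - integral {0..s} (\<lambda>s. p (a s) (X s)))) {s..t}"
        by (rule primitive_onD[OF primitive_on_integral[OF X(1)[of t]]]) (use st in auto)
      then show "((\<lambda>s. p (a s) (X s)) has_integral (X t - X s)) {s..t}"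
        using X(2)[of s] X(2)[of t] st by simp
    qed
  qed
qed

lemma primitive_on_glue:
  assumes "primitive_on S F f" "primitive_on T F f" "c \<in> S" "c \<in> T"
    "\<And>x. x \<in> S \<Longrightarrow> x \<le> c" "\<And>x. x \<in> T \<Longrightarrow> c \<le> x"
  shows "primitive_on (S \<union> T) F f"
  unfolding primitive_on_def
proof (intro ballI impI)
  fix a b assume ab: "a \<in> S \<union> T" "b \<in> S \<union> T" "a \<le> b"
  consider "a \<in> S" "b \<in> S" | "a \<in> T" "b \<in> T" | "a \<in> S" "b \<in> T" | "a \<in> T" "b \<in> S" using ab by blast
  then show "(f has_integral (F b - F a)) {a..b}"
  proof cases
    case 3
    then have *: "(f has_integral (F c - F a)) {a..c}" "(f has_integral (F b - F c)) {c..b}"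
      using assms by (auto simp: primitive_on_def)
    show ?thesis
      using has_integral_combine[OF _ _ *] assms 3 by simp
  next
    case 4
    then have "a = c" "b = c" using ab assms(5,6) by force+
    then show ?thesis using assms by (auto simp: primitive_on_def)
  qed (use assms ab in \<open>auto simp: primitive_on_def\<close>)
qed

text \<open>
  The solution for negative times is the forward solution of the time-reversed equation.
\<close>
lemma linear_ode_exists:
  fixes p :: "'b::euclidean_space \<Rightarrow> 'a::euclidean_space \<Rightarrow> 'a" and a :: "real \<Rightarrow> 'b"
  assumes p: "bilinear p" and a: "locally_integrable a"
  obtains X where "X 0 = x0" "primitive_on UNIV X (\<lambda>s. p (a s) (X s))"
proof -
  have "a absolutely_integrable_on {0..T}" for T using a by (simp add: locally_integrable_def)
  then obtain Y where Y: "Y 0 = x0" "primitive_on {0..} Y (\<lambda>s. p (a s) (Y s))"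
    using linear_ode_exists_forward[OF p] by blast
  have "(\<lambda>s. - a (- s)) absolutely_integrable_on {0..T}" for T
  proof -
    have "a absolutely_integrable_on {-T..-0}" using a by (simp add: locally_integrable_def)
    then have "(\<lambda>s. a (- s)) absolutely_integrable_on {0..T}"
      using absolutely_integrable_reflect_real[where f = "\<lambda>s. a (- s)" and a = 0 and b = T] by simp
    then show ?thesis by (auto simp: absolutely_integrable_on_def intro: integrable_neg)
  qed
  then obtain W where W: "W 0 = x0" "primitive_on {0..} W (\<lambda>s. p (- a (- s)) (W s))"
    using linear_ode_exists_forward[OF p] by blast
  define X where "X t = (if t \<ge> 0 then Y t else W (- t))" for t
  have X_neg: "X t = W (- t)" if "t \<le> 0" for t using that Y(1) W(1) by (cases "t = 0") (auto simp: X_def)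
  have "primitive_on {..0} X (\<lambda>s. p (a s) (X s))"
    unfolding primitive_on_def
  proof (intro ballI impI)
    fix s t :: real assume st: "s \<in> {..0}" "t \<in> {..0}" "s \<le> t"
    have "((\<lambda>s. p (- a (- s)) (W s)) has_integral (W (- s) - W (- t))) {-t..-s}"
      by (rule primitive_onD[OF W(2)]) (use st in auto)
    from has_integral_neg[OF this]
    have "((\<lambda>s. - p (- a (- s)) (W s)) has_integral (W (- t) - W (- s))) {-t..-s}" by simp
    then have "((\<lambda>s. p (a (- s)) (W s)) has_integral (W (- t) - W (- s))) {-t..-s}"
      using bilinear_lneg[OF p] by simp
    then have "((\<lambda>s. p (a s) (W (- s))) has_integral (W (- t) - W (- s))) {s..t}"
      using has_integral_reflect_real[of "\<lambda>s. p (a s) (W (- s))" "W (- t) - W (- s)" t s] by simp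
    then have "((\<lambda>s. p (a s) (X s)) has_integral (W (- t) - W (- s))) {s..t}"
      by (rule has_integral_eq[rotated]) (use st X_neg in auto)
    moreover have "X s = W (- s)" "X t = W (- t)" using st X_neg by auto
    ultimately show "((\<lambda>s. p (a s) (X s)) has_integral (X t - X s)) {s..t}" by simp
  qed
  moreover have "primitive_on {0..} X (\<lambda>s. p (a s) (X s))"
    unfolding primitive_on_def
  proof (intro ballI impI)
    fix s t :: real assume st: "s \<in> {0..}" "t \<in> {0..}" "s \<le> t"
    have "((\<lambda>s. p (a s) (Y s)) has_integral (Y t - Y s)) {s..t}"
      by (rule primitive_onD[OF Y(2)]) (use st in auto)
    then have "((\<lambda>s. p (a s) (X s)) has_integral (Y t - Y s)) {s..t}"
      by (rule has_integral_eq[rotated]) (use st in \<open>auto simp: X_def\<close>)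
    then show "((\<lambda>s. p (a s) (X s)) has_integral (X t - X s)) {s..t}" using st by (simp add: X_def)
  qed
  ultimately have "primitive_on ({..0} \<union> {0..}) X (\<lambda>s. p (a s) (X s))"
    by (rule primitive_on_glue[where c = 0]) auto
  moreover have "{..0} \<union> {0::real..} = UNIV" by auto
  moreover have "X 0 = x0" using Y(1) by (simp add: X_def)
  ultimately show ?thesis using that by simp
qed

section \<open>Fundamental matrix, variation of constants, and Gronwall\<close>

lemma bilinear_flip_neg: "bilinear p \<Longrightarrow> bilinear (\<lambda>x y. - p y x)"
  unfolding bilinear_def by (simp add: linear_compose_neg)

lemma matrix_mult_neg_left: "(- A) ** (B :: real^'k^'n) = - (A ** B)"
  by (rule bilinear_lneg[OF bilinear_matrix_mult])

lemma matrix_vector_neg_left: "(- A) *v (x :: real^'n) = - (A *v x)"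
  by (rule bilinear_lneg[OF bilinear_matrix_vector_mult])

lemma matrix_vector_neg_right: "A *v (- (x :: real^'n)) = - (A *v x)"
  by (rule bilinear_rneg[OF bilinear_matrix_vector_mult])

lemma locally_integrableD: "locally_integrable f \<Longrightarrow> f absolutely_integrable_on {a..b}"
  by (simp add: locally_integrable_def)

lemma primitive_on_zero:
  assumes "primitive_on {a..b} F f" "\<And>s. s \<in> {a..b} \<Longrightarrow> f s = 0" "a \<le> b"
  shows "F b = F a"
proof -
  have "(f has_integral (F b - F a)) {a..b}"
    using assms(3) by (intro primitive_onD[OF assms(1)]) auto
  moreover have "(f has_integral 0) {a..b}"
    by (rule has_integral_is_0) (rule assms(2))
  ultimately have "F b - F a = 0" by (rule has_integral_unique)
  then show ?thesis by simp
qed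

lemma primitive_on_eq:
  assumes "primitive_on S F f" "\<And>s. s \<in> S \<Longrightarrow> F s = G s" "\<And>s. f s = g s"
  shows "primitive_on S G g"
proof -
  have "f = g" using assms(3) by auto
  then show ?thesis using assms(1,2) by (simp add: primitive_on_def)
qed

text \<open>
  A solution \<open>Y\<close> of the adjoint equation \<open>Y' = - Y M\<close> is an integrating factor. It removes \<open>M\<close> from an
  inhomogeneous vector equation, and it is constant along fundamental matrices, which gives their uniqueness
  and invertibility at once.
\<close>
lemma adjoint_solution:
  fixes M :: "real \<Rightarrow> real^'n^'n"
  assumes M: "M absolutely_integrable_on {a..b}"
    and Y: "primitive_on {a..b} Y (\<lambda>s. - (Y s ** M s))"
  shows "primitive_on {a..b} z (\<lambda>s. M s *v z s + g s) \<Longrightarrow> g absolutely_integrable_on {a..b} \<Longrightarrow>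
      primitive_on {a..b} (\<lambda>t. Y t *v z t) (\<lambda>s. Y s *v g s)" (is "PROP ?vec")
    and "primitive_on {a..b} X (\<lambda>s. M s ** X s) \<Longrightarrow> a \<le> b \<Longrightarrow> Y b ** X b = Y a ** X a" (is "PROP ?mat")
proof -
  note cY = primitive_on_continuous[OF Y]
  have YM: "(\<lambda>s. - (Y s ** M s)) absolutely_integrable_on {a..b}"
    using absolutely_integrable_bilinear_right[OF bilinear_matrix_mult cY M]
    by (auto simp: absolutely_integrable_on_def intro: integrable_neg)
  show "PROP ?vec"
  proof -
    assume z: "primitive_on {a..b} z (\<lambda>s. M s *v z s + g s)" and g: "g absolutely_integrable_on {a..b}"
    have "(\<lambda>s. M s *v z s + g s) absolutely_integrable_on {a..b}"
      by (intro set_integral_add g absolutely_integrable_bilinear_left[OF bilinear_matrix_vector_mult M]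
          primitive_on_continuous[OF z])
    from primitive_on_bilinear[OF bilinear_matrix_vector_mult Y YM z this]
    show "primitive_on {a..b} (\<lambda>t. Y t *v z t) (\<lambda>s. Y s *v g s)"
      by (rule primitive_on_eq)
        (auto simp: matrix_vector_neg_left matrix_vector_mul_assoc matrix_vector_right_distrib)
  qed
  show "PROP ?mat"
  proof -
    assume X: "primitive_on {a..b} X (\<lambda>s. M s ** X s)" and ab: "a \<le> b"
    have "(\<lambda>s. M s ** X s) absolutely_integrable_on {a..b}"
      by (intro absolutely_integrable_bilinear_left[OF bilinear_matrix_mult M] primitive_on_continuous[OF X])
    from primitive_on_bilinear[OF bilinear_matrix_mult Y YM X this]
    show "Y b ** X b = Y a ** X a"
      by (rule primitive_on_zero) (auto simp: matrix_mult_neg_left matrix_mul_assoc ab)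
  qed
qed

lemma matrix_inv_left: "invertible (X :: real^'n^'n) \<Longrightarrow> matrix_inv X ** X = mat 1"
  and matrix_inv_right: "invertible (X :: real^'n^'n) \<Longrightarrow> X ** matrix_inv X = mat 1"
  unfolding invertible_def matrix_inv_def by (auto intro: someI2_ex)

lemma matrix_inv_eqI:
  assumes "(Y :: real^'n^'n) ** X = mat 1"
  shows "matrix_inv X = Y" "X ** Y = mat 1" "invertible X"
proof -
  show 1: "X ** Y = mat 1" using assms matrix_left_right_inverse by blast
  then show inv: "invertible X" using assms by (auto simp: invertible_def)
  have "matrix_inv X ** X = mat 1" using inv by (rule matrix_inv_left)
  then have "matrix_inv X ** X ** Y = Y" by simp
  then show "matrix_inv X = Y" using 1 by (simp flip: matrix_mul_assoc)
qed

text \<open>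
  The solution \<open>Y\<close> of the adjoint equation with \<open>Y 0 = I\<close> is a left inverse of every fundamental matrix
  normalised at 0. Hence there is only one, the description in the definition is met, and \<open>Y\<close> is its inverse.
\<close>
lemma fundamental_matrix:
  fixes M :: "real \<Rightarrow> real^'n^'n"
  assumes M: "locally_integrable M"
  shows "fundamental_matrix M 0 = mat 1"
    and "primitive_on UNIV (fundamental_matrix M) (\<lambda>s. M s ** fundamental_matrix M s)"
    and "primitive_on UNIV (\<lambda>t. matrix_inv (fundamental_matrix M t))
           (\<lambda>s. - (matrix_inv (fundamental_matrix M s) ** M s))"
    and "invertible (fundamental_matrix M t)"
proof -
  obtain X where X: "X 0 = mat 1" "primitive_on UNIV X (\<lambda>s. M s ** X s)"
    using linear_ode_exists[OF bilinear_matrix_mult M] by blast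
  obtain Y where Y: "Y 0 = mat 1" "primitive_on UNIV Y (\<lambda>s. - (Y s ** M s))"
    using linear_ode_exists[OF bilinear_flip_neg[OF bilinear_matrix_mult] M] by blast
  have YX: "Y t ** X' t = mat 1" if X': "X' 0 = mat 1" "primitive_on UNIV X' (\<lambda>s. M s ** X' s)" for X' t
  proof (cases "t \<ge> 0")
    case True
    then show ?thesis
      using adjoint_solution(2)[OF locally_integrableD[OF M] primitive_on_subset[OF Y(2)] primitive_on_subset[OF X'(2)], of 0 t]
        X' Y(1) by simp
  next
    case False
    then show ?thesis
      using adjoint_solution(2)[OF locally_integrableD[OF M] primitive_on_subset[OF Y(2)] primitive_on_subset[OF X'(2)], of t 0]
        X' Y(1) by simp
  qed
  note YX_inv = matrix_inv_eqI[OF YX[OF X]]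
  have "fundamental_matrix M = X"
    unfolding fundamental_matrix_def
  proof (rule the_equality)
    show "continuous_on UNIV X \<and> X 0 = mat 1
      \<and> (\<forall>a b. a \<le> b \<longrightarrow> ((\<lambda>s. M s ** X s) has_integral (X b - X a)) {a..b})"
      using X primitive_on_UNIV_continuous by (auto simp: primitive_on_def)
    fix X' assume "continuous_on UNIV X' \<and> X' 0 = mat 1
      \<and> (\<forall>a b. a \<le> b \<longrightarrow> ((\<lambda>s. M s ** X' s) has_integral (X' b - X' a)) {a..b})"
    then have "X' 0 = mat 1" "primitive_on UNIV X' (\<lambda>s. M s ** X' s)" by (auto simp: primitive_on_def)
    from YX[OF this] have "X t ** (Y t ** X' t) = X t ** mat 1" for t by simp
    then have "X' t = X t" for t by (simp add: matrix_mul_assoc YX_inv(2))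
    then show "X' = X" by auto
  qed
  with X Y YX_inv show "fundamental_matrix M 0 = mat 1"
    and "primitive_on UNIV (fundamental_matrix M) (\<lambda>s. M s ** fundamental_matrix M s)"
    and "primitive_on UNIV (\<lambda>t. matrix_inv (fundamental_matrix M t))
           (\<lambda>s. - (matrix_inv (fundamental_matrix M s) ** M s))"
    and "invertible (fundamental_matrix M t)"
    by simp_all
qed

lemma Phi_self: "locally_integrable M \<Longrightarrow> Phi M t t = mat 1"
  by (simp add: Phi_def fundamental_matrix(4) matrix_inv_right)

lemma Phi_trans: "locally_integrable M \<Longrightarrow> Phi M t s ** Phi M s u = Phi M t u"
proof -
  assume M: "locally_integrable M"
  have "Phi M t s ** Phi M s u = fundamental_matrix M t **
      (matrix_inv (fundamental_matrix M s) ** fundamental_matrix M s) ** matrix_inv (fundamental_matrix M u)"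
    unfolding Phi_def by (simp add: matrix_mul_assoc)
  then show ?thesis by (simp add: Phi_def fundamental_matrix(4)[OF M] matrix_inv_left)
qed

lemma continuous_on_bilinear:
  fixes p :: "'a::euclidean_space \<Rightarrow> 'b::euclidean_space \<Rightarrow> 'c::real_normed_vector"
  assumes "bilinear p" "continuous_on S f" "continuous_on S g"
  shows "continuous_on S (\<lambda>x. p (f x) (g x))"
  using assms by (auto simp: bilinear_conv_bounded_bilinear intro: bounded_bilinear.continuous_on)

lemma continuous_on_Phi: "locally_integrable M \<Longrightarrow> continuous_on S (\<lambda>s. Phi M t s)"
  unfolding Phi_def
  by (intro continuous_on_bilinear[OF bilinear_matrix_mult] continuous_on_const
      continuous_on_subset[OF primitive_on_UNIV_continuous[OF fundamental_matrix(3)]]) auto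

lemma Phi_solution:
  assumes M: "locally_integrable M"
  shows "primitive_on UNIV (\<lambda>t. Phi M t s *v x) (\<lambda>r. M r *v (Phi M r s *v x))"
  unfolding primitive_on_def
proof (intro ballI impI)
  fix a b :: real assume "a \<le> b"
  let ?X = "fundamental_matrix M" and ?y = "matrix_inv (fundamental_matrix M s) *v x"
  have "((\<lambda>s. M s ** ?X s) has_integral (?X b - ?X a)) {a..b}"
    by (rule primitive_onD[OF fundamental_matrix(2)[OF M]]) (use \<open>a \<le> b\<close> in auto)
  from has_integral_linear[OF this bounded_bilinear.bounded_linear_left[OF
      bilinear_matrix_vector_mult[unfolded bilinear_conv_bounded_bilinear], of ?y]]
  show "((\<lambda>r. M r *v (Phi M r s *v x)) has_integral (Phi M b s *v x - Phi M a s *v x)) {a..b}"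
    by (simp add: o_def Phi_def matrix_vector_mult_diff_rdistrib flip: matrix_vector_mul_assoc)
qed

lemma primitive_on_oriented_integral:
  assumes "primitive_on {a..b} F f" "u \<in> {a..b}" "t \<in> {a..b}"
  shows "oriented_integral u t f = F t - F u"
  using primitive_onD[OF assms(1), of u t] primitive_onD[OF assms(1), of t u] assms(2,3)
  by (auto simp: oriented_integral_def has_integral_iff)

lemma oriented_integral_primitive:
  assumes f: "f integrable_on {a..b}" and u: "u \<in> {a..b}"
  shows "primitive_on {a..b} (\<lambda>t. oriented_integral u t f) f"
proof -
  note p = primitive_on_integral[OF f]
  from p have "primitive_on {a..b} (\<lambda>t. integral {a..t} f - integral {a..u} f) f"
    by (auto simp: primitive_on_def)
  then show ?thesis
    by (rule primitive_on_eq) (auto simp: primitive_on_oriented_integral[OF p u])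
qed

lemma oriented_integral_linear:
  assumes f: "f integrable_on {a..b}" and u: "u \<in> {a..b}" "t \<in> {a..b}" and L: "bounded_linear L"
  shows "oriented_integral u t (\<lambda>s. L (f s)) = L (oriented_integral u t f)"
proof -
  have "primitive_on {a..b} (\<lambda>t. L (oriented_integral u t f)) (\<lambda>s. L (f s))"
    unfolding primitive_on_def
  proof (intro ballI impI)
    fix c d assume "c \<in> {a..b}" "d \<in> {a..b}" "c \<le> d"
    from has_integral_linear[OF primitive_onD[OF oriented_integral_primitive[OF f u(1)] this] L]
    show "((\<lambda>s. L (f s)) has_integral L (oriented_integral u d f) - L (oriented_integral u c f)) {c..d}"
      by (simp add: o_def bounded_linear.linear[OF L] linear_diff)
  qed
  from primitive_on_oriented_integral[OF this u] show ?thesis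
    by (simp add: oriented_integral_def linear_0[OF bounded_linear.linear[OF L]])
qed

text \<open>
  Both directions are the product rule: for \<open>Y z\<close>, where \<open>Y\<close> is the inverse of the fundamental matrix \<open>X\<close>, and
  for \<open>X w\<close>, where \<open>w\<close> is a primitive of \<open>Y g\<close>.
\<close>
lemma variation_of_constants:
  fixes M :: "real \<Rightarrow> real^'n^'n"
  assumes M: "locally_integrable M" and g: "g absolutely_integrable_on {a..b}" and u: "u \<in> {a..b}"
  shows "primitive_on {a..b} z (\<lambda>s. M s *v z s + g s) \<longleftrightarrow>
    (\<forall>t\<in>{a..b}. z t = Phi M t u *v z u + oriented_integral u t (\<lambda>s. Phi M t s *v g s))"
proof -
  define X where "X = fundamental_matrix M"
  define Y where "Y t = matrix_inv (X t)" for t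
  have Phi: "Phi M t s = X t ** Y s" for t s by (simp add: Phi_def X_def Y_def)
  have X: "primitive_on {a..b} X (\<lambda>s. M s ** X s)" 
    unfolding X_def by (rule primitive_on_subset[OF fundamental_matrix(2)[OF M]]) auto
  have Y: "primitive_on {a..b} Y (\<lambda>s. - (Y s ** M s))" 
    unfolding X_def Y_def by (rule primitive_on_subset[OF fundamental_matrix(3)[OF M]]) auto
  have XY: "X t ** Y t = mat 1" for t
    using fundamental_matrix(4)[OF M] by (simp add: X_def Y_def matrix_inv_right)
  have Yg: "(\<lambda>s. Y s *v g s) absolutely_integrable_on {a..b}"
    by (rule absolutely_integrable_bilinear_right[OF bilinear_matrix_vector_mult primitive_on_continuous[OF Y] g])
  then have Ygi: "(\<lambda>s. Y s *v g s) integrable_on {a..b}" by (simp add: absolutely_integrable_on_def)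
  have X_lin: "oriented_integral u t (\<lambda>s. Phi M t s *v g s) = X t *v oriented_integral u t (\<lambda>s. Y s *v g s)"
    if "t \<in> {a..b}" for t
    using oriented_integral_linear[OF Ygi u that matrix_vector_mul_bounded_linear[of "X t"]]
    by (simp add: Phi matrix_vector_mul_assoc)
  let ?w = "\<lambda>t. Y u *v z u + oriented_integral u t (\<lambda>s. Y s *v g s)"
  have rhs: "Phi M t u *v z u + oriented_integral u t (\<lambda>s. Phi M t s *v g s) = X t *v ?w t"
    if "t \<in> {a..b}" for t
    using X_lin[OF that] by (simp add: Phi matrix_vector_mul_assoc matrix_vector_right_distrib)
  show ?thesis
  proof
    assume z: "primitive_on {a..b} z (\<lambda>s. M s *v z s + g s)"
    have Yz: "primitive_on {a..b} (\<lambda>t. Y t *v z t) (\<lambda>s. Y s *v g s)"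
      by (rule adjoint_solution(1)[OF locally_integrableD[OF M] Y z g])
    have "X t *v (Y t *v z t) = X t *v ?w t" if "t \<in> {a..b}" for t
      using primitive_on_oriented_integral[OF Yz u that] by simp
    then show "\<forall>t\<in>{a..b}. z t = Phi M t u *v z u + oriented_integral u t (\<lambda>s. Phi M t s *v g s)"
      by (simp add: rhs matrix_vector_mul_assoc XY)
  next
    assume z: "\<forall>t\<in>{a..b}. z t = Phi M t u *v z u + oriented_integral u t (\<lambda>s. Phi M t s *v g s)"
    have w: "primitive_on {a..b} ?w (\<lambda>s. Y s *v g s)"
      using oriented_integral_primitive[OF Ygi u] by (simp add: primitive_on_def)
    have "(\<lambda>s. M s ** X s) absolutely_integrable_on {a..b}"
      by (intro absolutely_integrable_bilinear_left[OF bilinear_matrix_mult locally_integrableD[OF M]]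
          primitive_on_continuous[OF X])
    from primitive_on_bilinear[OF bilinear_matrix_vector_mult X this w Yg]
    have p: "primitive_on {a..b} (\<lambda>t. X t *v ?w t) (\<lambda>s. M s *v (X s *v ?w s) + g s)"
      by (rule primitive_on_eq) (auto simp: matrix_vector_mul_assoc matrix_mul_assoc XY)
    show "primitive_on {a..b} z (\<lambda>s. M s *v z s + g s)"
      unfolding primitive_on_def
    proof (intro ballI impI)
      fix c d assume cd: "c \<in> {a..b}" "d \<in> {a..b}" "c \<le> d"
      have eq: "z t = X t *v ?w t" if "t \<in> {a..b}" for t using z rhs that by auto
      have "((\<lambda>s. M s *v (X s *v ?w s) + g s) has_integral (z d - z c)) {c..d}"
        using primitive_onD[OF p cd] eq cd by simp
      then show "((\<lambda>s. M s *v z s + g s) has_integral (z d - z c)) {c..d}"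
        by (rule has_integral_eq[rotated]) (use eq cd in auto)
    qed
  qed
qed

text \<open>
  With \<open>m\<close> a primitive of \<open>mn M\<close>, one step from \<open>s\<close> to \<open>t\<close> changes \<open>vn z\<close> at most by the factor
  \<open>1 + (m t - m s) \<le> exp (m t - m s)\<close>, up to an error quadratic in \<open>m t - m s\<close>. Hence \<open>vn z * exp (- m)\<close> does not
  increase and \<open>vn z * exp m\<close> does not decrease. The estimate is in the norm \<open>vn\<close>, without any factor from the
  equivalence of norms and without \<open>mn (mat 1)\<close>, which may exceed 1.
\<close>
lemma gronwall:
  fixes M :: "real \<Rightarrow> real^'n^'n"
  assumes norms: "vector_matrix_norm vn mn" and M: "M absolutely_integrable_on {a..b}" and ab: "a \<le> b"
    and z: "primitive_on {a..b} z (\<lambda>s. M s *v z s)"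
  shows "vn (z b) \<le> exp (integral {a..b} (\<lambda>s. mn (M s))) * vn (z a)"
    and "vn (z a) \<le> exp (integral {a..b} (\<lambda>s. mn (M s))) * vn (z b)"
proof -
  note N = vector_matrix_normD[OF norms]
  let ?k = "\<lambda>s. mn (M s)"
  define m where "m t = integral {a..t} ?k" for t
  have k: "?k absolutely_integrable_on {a..b}"
    by (rule is_norm_absolutely_integrable[OF N(2) M]) simp
  have m: "primitive_on {a..b} m ?k"
    unfolding m_def using k by (intro primitive_on_integral) (simp add: absolutely_integrable_on_def)
  have cm: "continuous_on {a..b} m" by (rule primitive_on_continuous[OF m])
  have mono: "m s \<le> m t" if "a \<le> s" "s \<le> t" "t \<le> b" for s t
  proof -
    have "(?k has_integral (m t - m s)) {s..t}" by (rule primitive_onD[OF m]) (use that in auto)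
    then have "0 \<le> m t - m s" by (rule has_integral_nonneg) (simp add: is_norm_ge_0[OF N(2)])
    then show ?thesis by simp
  qed
  have m0: "0 \<le> m t" if "t \<in> {a..b}" for t using mono[of a t] that by (simp add: m_def)
  have "continuous_on {a..b} (\<lambda>t. vn (z t))"
    by (intro continuous_on_compose2[OF continuous_on_is_norm[OF N(1), of UNIV] primitive_on_continuous[OF z]]) auto
  then have "bounded ((\<lambda>t. vn (z t)) ` {a..b})"
    by (intro compact_imp_bounded compact_continuous_image) auto
  then obtain B where B0: "\<forall>x\<in>(\<lambda>t. vn (z t)) ` {a..b}. norm x \<le> B"
    unfolding bounded_iff by blast
  have B: "vn (z t) \<le> B" if "t \<in> {a..b}" for t
  proof -
    have "\<bar>vn (z t)\<bar> \<le> B" using B0 that by auto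
    then show ?thesis by simp
  qed
  have Bnn: "B \<ge> 0" using B[of a] is_norm_ge_0[OF N(1), of "z a"] ab by simp
  have incr: "vn (z t - z s) \<le> c * (m t - m s)"
    if st: "a \<le> s" "s \<le> t" "t \<le> b" and c: "\<And>r. r \<in> {s..t} \<Longrightarrow> vn (z r) \<le> c" for s t c
  proof -
    have zi: "((\<lambda>s. M s *v z s) has_integral (z t - z s)) {s..t}" by (rule primitive_onD[OF z]) (use st in auto)
    have ki: "((\<lambda>r. c * ?k r) has_integral (c * (m t - m s))) {s..t}"
      by (intro has_integral_mult_right primitive_onD[OF m]) (use st in auto)
    have "vn (integral {s..t} (\<lambda>s. M s *v z s)) \<le> integral {s..t} (\<lambda>r. c * ?k r)"
    proof (rule is_norm_integral_le[OF N(1)])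
      fix r assume r: "r \<in> {s..t}"
      have "vn (M r *v z r) \<le> mn (M r) * vn (z r)" by (rule N)
      also have "\<dots> \<le> mn (M r) * c" by (intro mult_left_mono c r is_norm_ge_0[OF N(2)])
      finally show "vn (M r *v z r) \<le> c * mn (M r)" by (simp add: mult.commute)
    qed (use zi ki in \<open>auto simp: has_integral_iff\<close>)
    then show ?thesis unfolding integral_unique[OF zi] integral_unique[OF ki] .
  qed
  have incrB: "vn (z t - z s) \<le> B * (m t - m s)" if "a \<le> s" "s \<le> t" "t \<le> b" for s t
    by (rule incr) (use that B in auto)
  have fwd: "vn (z t) \<le> vn (z s) * exp (m t - m s) + B * (m t - m s)\<^sup>2" if st: "a \<le> s" "s \<le> t" "t \<le> b" for s t
  proof -
    have "vn (z r) \<le> vn (z s) + B * (m t - m s)" if "r \<in> {s..t}" for r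
    proof -
      have "vn (z r) \<le> vn (z s) + vn (z r - z s)" using is_norm_abs_diff[OF N(1), of "z r" "z s"] by simp
      also have "\<dots> \<le> vn (z s) + B * (m r - m s)" using incrB[of s r] that st by simp
      also have "\<dots> \<le> vn (z s) + B * (m t - m s)" using mono[of r t] that st Bnn by (simp add: mult_left_mono)
      finally show ?thesis .
    qed
    from incr[OF st this] have "vn (z t - z s) \<le> (vn (z s) + B * (m t - m s)) * (m t - m s)" .
    then have "vn (z t) \<le> vn (z s) * (1 + (m t - m s)) + B * (m t - m s)\<^sup>2"
      using is_norm_abs_diff[OF N(1), of "z t" "z s"] by (simp add: power2_eq_square algebra_simps)
    also have "\<dots> \<le> vn (z s) * exp (m t - m s) + B * (m t - m s)\<^sup>2"
      by (intro add_right_mono mult_left_mono exp_ge_add_one_self is_norm_ge_0[OF N(1)])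
    finally show ?thesis .
  qed
  have bwd: "vn (z s) \<le> vn (z t) * exp (m t - m s) + B * (m t - m s)\<^sup>2" if st: "a \<le> s" "s \<le> t" "t \<le> b" for s t
  proof -
    have "vn (z r) \<le> vn (z t) + B * (m t - m s)" if "r \<in> {s..t}" for r
    proof -
      have "vn (z r) \<le> vn (z t) + vn (z t - z r)"
        using is_norm_abs_diff[OF N(1), of "z t" "z r"] by simp
      also have "\<dots> \<le> vn (z t) + B * (m t - m r)" using incrB[of r t] that st by simp
      also have "\<dots> \<le> vn (z t) + B * (m t - m s)" using mono[of s r] that st Bnn by (simp add: mult_left_mono)
      finally show ?thesis .
    qed
    from incr[OF st this] have "vn (z t - z s) \<le> (vn (z t) + B * (m t - m s)) * (m t - m s)" .
    then have "vn (z s) \<le> vn (z t) * (1 + (m t - m s)) + B * (m t - m s)\<^sup>2"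
      using is_norm_abs_diff[OF N(1), of "z t" "z s"] by (simp add: power2_eq_square algebra_simps)
    also have "\<dots> \<le> vn (z t) * exp (m t - m s) + B * (m t - m s)\<^sup>2"
      by (intro add_right_mono mult_left_mono exp_ge_add_one_self is_norm_ge_0[OF N(1)])
    finally show ?thesis .
  qed
  have "vn (z b) * exp (- m b) \<le> vn (z a) * exp (- m a)"
  proof (rule nonincreasing_if_quadratic_increments[OF ab Bnn cm mono])
    fix s t assume st: "a \<le> s" "s \<le> t" "t \<le> b"
    have "vn (z t) * exp (- m t) \<le> (vn (z s) * exp (m t - m s) + B * (m t - m s)\<^sup>2) * exp (- m t)"
      using fwd[OF st] by (intro mult_right_mono) auto
    also have "\<dots> = vn (z s) * exp (- m s) + B * (m t - m s)\<^sup>2 * exp (- m t)"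
      by (simp add: algebra_simps flip: exp_add)
    also have "\<dots> \<le> vn (z s) * exp (- m s) + B * (m t - m s)\<^sup>2 * 1"
      using m0[of t] st Bnn by (intro add_left_mono mult_left_mono) auto
    finally show "vn (z t) * exp (- m t) - vn (z s) * exp (- m s) \<le> B * (m t - m s)\<^sup>2" by simp
  qed
  then show "vn (z b) \<le> exp (integral {a..b} ?k) * vn (z a)"
    by (simp add: m_def[of a] exp_minus field_simps flip: m_def)
  have "- (vn (z b) * exp (m b)) \<le> - (vn (z a) * exp (m a))"
  proof (rule nonincreasing_if_quadratic_increments[OF ab _ cm mono, where C = "B * exp (m b)" and F = "\<lambda>t. - (vn (z t) * exp (m t))"])
    fix s t assume st: "a \<le> s" "s \<le> t" "t \<le> b"
    have "vn (z s) * exp (m s) \<le> (vn (z t) * exp (m t - m s) + B * (m t - m s)\<^sup>2) * exp (m s)"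
      using bwd[OF st] by (intro mult_right_mono) auto
    also have "\<dots> = vn (z t) * exp (m t) + B * (m t - m s)\<^sup>2 * exp (m s)"
      by (simp add: algebra_simps flip: exp_add)
    also have "\<dots> \<le> vn (z t) * exp (m t) + B * (m t - m s)\<^sup>2 * exp (m b)"
      using mono[of s b] st Bnn by (intro add_left_mono mult_left_mono) auto
    finally show "- (vn (z t) * exp (m t)) - - (vn (z s) * exp (m s)) \<le> B * exp (m b) * (m t - m s)\<^sup>2"
      by (simp add: algebra_simps)
  qed (use Bnn in auto)
  then show "vn (z a) \<le> exp (integral {a..b} ?k) * vn (z b)"
    by (simp add: m_def[of a] mult.commute flip: m_def)
qed

lemma Phi_bound:
  fixes M :: "real \<Rightarrow> real^'n^'n"
  assumes norms: "vector_matrix_norm vn mn" and M: "locally_integrable M"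
  shows "vn (Phi M t s *v x) \<le> exp (integral {min s t..max s t} (\<lambda>s. mn (M s))) * vn x"
proof (cases "s \<le> t")
  case True
  then show ?thesis
    using gronwall(1)[OF norms locally_integrableD[OF M] True primitive_on_subset[OF Phi_solution[OF M, of s x]]]
    by (simp add: Phi_self[OF M] min_def max_def)
next
  case False
  then have "t \<le> s" by simp
  then show ?thesis
    using gronwall(2)[OF norms locally_integrableD[OF M] \<open>t \<le> s\<close> primitive_on_subset[OF Phi_solution[OF M, of s x]]]
    by (simp add: Phi_self[OF M] min_def max_def)
qed

lemma is_norm_oriented_integral_le:
  fixes N :: "'a::euclidean_space \<Rightarrow> real"
  assumes N: "is_norm N" and f: "f integrable_on {min u t..max u t}" and k: "k integrable_on {min u t..max u t}"
    and le: "\<And>s. s \<in> {min u t..max u t} \<Longrightarrow> N (f s) \<le> k s"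
  shows "N (oriented_integral u t f) \<le> integral {min u t..max u t} k"
  using is_norm_integral_le[OF N f k le]
  by (auto simp: oriented_integral_def is_norm_minus[OF N] min_def max_def split: if_splits)

lemma E_mat_vector:
  fixes M M0 :: "real \<Rightarrow> real^'n^'n"
  assumes M: "locally_integrable M" and M0: "locally_integrable M0"
  shows "E_mat M M0 t u *v v = Phi M t u *v v + oriented_integral u t (\<lambda>s. Phi M t s *v (M0 s *v v))"
proof -
  have "(\<lambda>s. Phi M t s ** M0 s) absolutely_integrable_on {min u t..max u t}"
    by (intro absolutely_integrable_bilinear_right[OF bilinear_matrix_mult] continuous_on_Phi locally_integrableD M M0)
  then have "(\<lambda>s. Phi M t s ** M0 s) integrable_on {min u t..max u t}"
    by (simp add: absolutely_integrable_on_def)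
  from oriented_integral_linear[OF this, of u t "\<lambda>A. A *v v"]
  show ?thesis
    by (simp add: E_mat_def matrix_vector_mult_add_rdistrib matrix_vector_mul_assoc
        bounded_bilinear.bounded_linear_left[OF bilinear_matrix_vector_mult[unfolded bilinear_conv_bounded_bilinear]])
qed

text \<open>
  \<open>E(t,u) v = 0\<close> means \<open>v = - \<integral>[u,t] \<Phi>(u,s) M\<^sub>0(s) v ds\<close>, which is impossible for \<open>v \<noteq> 0\<close> if this integral
  operator has norm less than 1.
\<close>
lemma E_mat_invertible:
  fixes M M0 :: "real \<Rightarrow> real^'n^'n"
  assumes norms: "vector_matrix_norm vn mn" and M: "locally_integrable M" and M0: "locally_integrable M0"
    and small: "exp (integral {min u t..max u t} (\<lambda>s. mn (M s))) * integral {min u t..max u t} (\<lambda>s. mn (M0 s)) < 1"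
  shows "invertible (E_mat M M0 t u)"
proof -
  note N = vector_matrix_normD[OF norms]
  let ?I = "{min u t..max u t}"
  let ?e = "exp (integral ?I (\<lambda>s. mn (M s)))"
  have int: "(\<lambda>s. mn (Q s)) integrable_on {c..d}" if "locally_integrable Q" for Q :: "real \<Rightarrow> real^'n^'n" and c d
    using is_norm_absolutely_integrable[OF N(2) locally_integrableD[OF that]]
    by (simp add: absolutely_integrable_on_def)
  have "v = 0" if "E_mat M M0 t u *v v = 0" for v
  proof -
    let ?f = "\<lambda>s. Phi M u s *v (M0 s *v v)"
    have g: "(\<lambda>s. M0 s *v v) absolutely_integrable_on ?I"
      by (intro absolutely_integrable_bilinear_left[OF bilinear_matrix_vector_mult] locally_integrableD M0 continuous_on_const)
    have g': "(\<lambda>s. Phi M r s *v (M0 s *v v)) integrable_on ?I" for r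
      using absolutely_integrable_bilinear_right[OF bilinear_matrix_vector_mult continuous_on_Phi[OF M] g]
      by (simp add: absolutely_integrable_on_def)
    have "Phi M u t *v (E_mat M M0 t u *v v) = v + oriented_integral u t ?f"
      using oriented_integral_linear[OF g'[of t], of u t "(*v) (Phi M u t)"]
      by (simp add: E_mat_vector[OF M M0] matrix_vector_right_distrib matrix_vector_mul_assoc Phi_trans[OF M]
          Phi_self[OF M] matrix_mul_assoc)
    then have v: "v = - oriented_integral u t ?f" using that by (simp add: eq_neg_iff_add_eq_0)
    have "vn (oriented_integral u t ?f) \<le> integral ?I (\<lambda>s. ?e * vn v * mn (M0 s))"
    proof (rule is_norm_oriented_integral_le[OF N(1) g'])
      show "(\<lambda>s. ?e * vn v * mn (M0 s)) integrable_on ?I"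
        by (intro integrable_on_mult_right int M0)
      fix s assume s: "s \<in> ?I"
      have "vn (?f s) \<le> exp (integral {min s u..max s u} (\<lambda>s. mn (M s))) * vn (M0 s *v v)"
        by (rule Phi_bound[OF norms M])
      also have "\<dots> \<le> ?e * (mn (M0 s) * vn v)"
        using s by (intro mult_mono N is_norm_ge_0[OF N(1)])
          (auto intro!: integral_subset_le int M is_norm_ge_0[OF N(2)])
      finally show "vn (?f s) \<le> ?e * vn v * mn (M0 s)" by (simp add: mult_ac)
    qed
    also have "\<dots> = ?e * integral ?I (\<lambda>s. mn (M0 s)) * vn v" by simp
    finally have "vn v \<le> ?e * integral ?I (\<lambda>s. mn (M0 s)) * vn v"
      by (subst v) (simp add: is_norm_minus[OF N(1)])
    then show "v = 0"
      using small is_norm_pos[OF N(1), of v] mult_less_cancel_right2[of _ "vn v"]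
      by (smt (verit))
  qed
  then obtain B where "B ** E_mat M M0 t u = mat 1"
    using matrix_left_invertible_ker by blast
  then show ?thesis by (rule matrix_inv_eqI(3))
qed

section \<open>The grid\<close>

locale time_grid =
  fixes \<tau> \<zeta> :: "int \<Rightarrow> real" and \<gamma> :: "real \<Rightarrow> real" and \<theta> :: real
  assumes A: "condition_A \<tau> \<zeta> \<gamma> \<theta>"
begin

abbreviation cell :: "int \<Rightarrow> real set" where "cell j \<equiv> {\<tau> j..\<tau> (j + 1)}"

lemma tau_step: "\<tau> i < \<tau> (i + 1)"
  and zeta_mem: "\<zeta> i \<in> cell i"
  and gamma_eq: "\<tau> i \<le> t \<Longrightarrow> t < \<tau> (i + 1) \<Longrightarrow> \<gamma> t = \<zeta> i"
  and cell_length: "\<tau> (i + 1) - \<tau> i \<le> \<theta>"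
  using A by (auto simp: condition_A_def)

lemma tau_le_zeta: "\<tau> i \<le> \<zeta> i" and zeta_le_tau: "\<zeta> i \<le> \<tau> (i + 1)"
  using zeta_mem[of i] by auto

lemma tau_less: "i < j \<Longrightarrow> \<tau> i < \<tau> j"
proof (induction j rule: int_gr_induct)
  case base then show ?case by (rule tau_step)
next
  case (step j) then show ?case using tau_step[of j] by simp
qed

lemma tau_le: "i \<le> j \<Longrightarrow> \<tau> i \<le> \<tau> j"
  using tau_less[of i j] by (cases "i = j") auto

lemma tau_less_iff: "\<tau> i < \<tau> j \<longleftrightarrow> i < j"
  using tau_less[of i j] tau_le[of j i] by force

lemma ex_cell: "\<exists>i. \<tau> i \<le> t \<and> t < \<tau> (i + 1)"
proof -
  have "eventually (\<lambda>i. \<tau> i \<le> t) at_bot" "eventually (\<lambda>i. t < \<tau> i) at_top"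
    using A by (auto simp: condition_A_def filterlim_at_bot filterlim_at_top_dense)
  then obtain i0 i1 where i0: "\<tau> i0 \<le> t" and i1: "t < \<tau> i1"
    by (meson eventually_at_bot_linorder eventually_at_top_linorder order_refl)
  have "\<not> (\<forall>i\<ge>i0. \<tau> i \<le> t)" 
  proof
    assume *: "\<forall>i\<ge>i0. \<tau> i \<le> t"
    have "i0 < i1" using i0 i1 tau_less_iff[of i0 i1] by linarith
    then have "\<tau> i1 \<le> t" using * by simp
    then show False using i1 by simp
  qed
  moreover have "(\<forall>i\<ge>i0. \<tau> i \<le> t)" if "\<forall>i. \<tau> i \<le> t \<longrightarrow> \<tau> (i + 1) \<le> t"
  proof (intro allI impI)
    fix i assume "i \<ge> i0"
    then show "\<tau> i \<le> t" by (induction i rule: int_ge_induct) (use i0 that in auto)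
  qed
  ultimately show ?thesis by (meson not_le)
qed

lemma cell_unique:
  assumes "\<tau> i \<le> t" "t < \<tau> (i + 1)" "\<tau> j \<le> t" "t < \<tau> (j + 1)"
  shows "i = j"
proof -
  have "\<tau> i < \<tau> (j + 1)" "\<tau> j < \<tau> (i + 1)" using assms by linarith+
  then show ?thesis by (simp add: tau_less_iff)
qed

lemma grid_index: "\<tau> (grid_index \<tau> t) \<le> t" "t < \<tau> (grid_index \<tau> t + 1)"
proof -
  have "\<exists>!i. \<tau> i \<le> t \<and> t < \<tau> (i + 1)" using ex_cell[of t] cell_unique by blast
  from theI'[OF this] show "\<tau> (grid_index \<tau> t) \<le> t" "t < \<tau> (grid_index \<tau> t + 1)"
    by (auto simp: grid_index_def)
qed

lemma grid_index_eq: "\<tau> j \<le> t \<Longrightarrow> t < \<tau> (j + 1) \<Longrightarrow> grid_index \<tau> t = j"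
  using grid_index[of t] cell_unique by blast

lemma grid_index_mono: "s \<le> t \<Longrightarrow> grid_index \<tau> s \<le> grid_index \<tau> t"
  using grid_index[of s] grid_index[of t] tau_less_iff[of "grid_index \<tau> s" "grid_index \<tau> t + 1"] by simp

text \<open>
  This is how solutions given by different formulas on different cells are glued.
\<close>
lemma primitive_on_cells:
  assumes "\<And>j. primitive_on (cell j) F f"
  shows "primitive_on UNIV F f"
proof -
  have block: "primitive_on {\<tau> j..\<tau> k} F f" if "j < k" for j k
    using that
  proof (induction k rule: int_gr_induct)
    case base show ?case by (rule assms)
  next
    case (step k)
    have "{\<tau> j..\<tau> (k + 1)} = {\<tau> j..\<tau> k} \<union> cell k"
      using tau_less[OF step(1)] tau_step[of k] by (simp add: ivl_disj_un_two_touch)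
    moreover have "primitive_on ({\<tau> j..\<tau> k} \<union> cell k) F f"
      by (rule primitive_on_glue[OF step(2) assms, where c = "\<tau> k"])
        (use tau_less[OF step(1)] tau_step[of k] in auto)
    ultimately show ?case by simp
  qed
  show ?thesis
    unfolding primitive_on_def
  proof (intro ballI impI)
    fix a b :: real assume "a \<le> b"
    let ?i = "grid_index \<tau> a" and ?j = "grid_index \<tau> b + 1"
    have "?i < ?j" using grid_index_mono[OF \<open>a \<le> b\<close>] by simp
    from block[OF this] show "(f has_integral (F b - F a)) {a..b}"
      by (rule primitive_onD) (use grid_index[of a] grid_index[of b] \<open>a \<le> b\<close> in auto)
  qed
qed

lemma primitive_on_UNIV_iff_cells: "primitive_on UNIV F f \<longleftrightarrow> (\<forall>j. primitive_on (cell j) F f)"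
  using primitive_on_cells primitive_on_subset by blast

end

lemma primitive_on_spike:
  assumes "finite T" "\<And>s. s \<in> {a..b} - T \<Longrightarrow> f s = g s"
  shows "primitive_on {a..b} F f \<longleftrightarrow> primitive_on {a..b} F g"
proof -
  have "(f has_integral y) {c..d} \<longleftrightarrow> (g has_integral y) {c..d}" if "c \<in> {a..b}" "d \<in> {a..b}" for c d y
    by (rule has_integral_spike_finite_eq[OF assms(1)]) (use that assms(2) in force)
  then show ?thesis by (simp add: primitive_on_def)
qed

lemma oriented_integral_add:
  assumes f: "f integrable_on {a..b}" and g: "g integrable_on {a..b}" and u: "u \<in> {a..b}" "t \<in> {a..b}"
  shows "oriented_integral u t (\<lambda>s. f s + g s) = oriented_integral u t f + oriented_integral u t g"
proof -
  have "primitive_on {a..b} (\<lambda>t. oriented_integral u t f + oriented_integral u t g) (\<lambda>s. f s + g s)"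
    unfolding primitive_on_def
  proof (intro ballI impI)
    fix c d assume cd: "c \<in> {a..b}" "d \<in> {a..b}" "c \<le> d"
    from has_integral_add[OF primitive_onD[OF oriented_integral_primitive[OF f u(1)] cd]
        primitive_onD[OF oriented_integral_primitive[OF g u(1)] cd]]
    show "((\<lambda>s. f s + g s) has_integral oriented_integral u d f + oriented_integral u d g -
        (oriented_integral u c f + oriented_integral u c g)) {c..d}"
      by (simp add: algebra_simps)
  qed
  from primitive_on_oriented_integral[OF this u] show ?thesis
    by (simp add: oriented_integral_def)
qed

lemma two_sided_recursion:
  fixes S :: "int \<Rightarrow> real^'n^'n"
  assumes S: "\<And>j. invertible (S j)"
  shows "\<exists>C :: int \<Rightarrow> real^'n^'n. \<forall>j. C (j + 1) = S j ** C j \<and> invertible (C j)"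
proof -
  define U where "U = rec_nat (mat 1) (\<lambda>n A. S (int n) ** A)"
  define V where "V = rec_nat (mat 1) (\<lambda>n A. matrix_inv (S (- int n - 1)) ** A)"
  have U: "U 0 = mat 1" "U (Suc n) = S (int n) ** U n" for n by (simp_all add: U_def)
  have V: "V 0 = mat 1" "V (Suc n) = matrix_inv (S (- int n - 1)) ** V n" for n by (simp_all add: V_def)
  have one: "invertible (mat 1 :: real^'n^'n)" by (auto simp: invertible_def)
  have inv: "invertible (matrix_inv (S j))" for j
    using matrix_inv_eqI(3)[OF matrix_inv_right[OF S]] .
  have iU: "invertible (U n)" for n by (induction n) (simp_all add: U one S invertible_mult)
  have iV: "invertible (V n)" for n by (induction n) (simp_all add: V one inv invertible_mult)
  define C where "C j = (if j \<ge> 0 then U (nat j) else V (nat (- j)))" for j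
  show ?thesis
  proof (intro exI[of _ C] allI conjI)
    fix j
    show "invertible (C j)" by (simp add: C_def iU iV)
    show "C (j + 1) = S j ** C j"
    proof (cases "j \<ge> 0")
      case True
      then have "nat (j + 1) = Suc (nat j)" by simp
      then show ?thesis using True by (simp add: C_def U)
    next
      case False
      define n where "n = nat (- j - 1)"
      have n: "nat (- j) = Suc n" "- int n - 1 = j" "nat (- (j + 1)) = n" using False by (auto simp: n_def)
      have "S j ** C j = S j ** matrix_inv (S j) ** V n"
        using False n by (simp add: C_def V matrix_mul_assoc)
      also have "\<dots> = V n" by (simp add: matrix_inv_right[OF S])
      also have "\<dots> = C (j + 1)"
      proof (cases "j = -1")
        case True then show ?thesis using n by (simp add: C_def U V)
      next
        case False2: False then show ?thesis using False n by (simp add: C_def)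
      qed
      finally show ?thesis by simp
    qed
  qed
qed

section \<open>The linear equation and its transition matrix\<close>

locale linear_depcag = time_grid \<tau> \<zeta> \<gamma> \<theta> for \<tau> \<zeta> :: "int \<Rightarrow> real" and \<gamma> :: "real \<Rightarrow> real" and \<theta> :: real +
  fixes vn :: "real^'n \<Rightarrow> real" and mn :: "real^'n^'n \<Rightarrow> real" and M M0 :: "real \<Rightarrow> real^'n^'n"
  assumes norms: "vector_matrix_norm vn mn"
    and M: "locally_integrable M" and M0: "locally_integrable M0"
    and C: "condition_C mn \<tau> \<zeta> M M0"
begin

lemmas N = vector_matrix_normD[OF norms]

abbreviation E :: "int \<Rightarrow> real \<Rightarrow> real^'n^'n" where "E j t \<equiv> E_mat M M0 t (\<zeta> j)"
abbreviation Z :: "real \<Rightarrow> real \<Rightarrow> real^'n^'n" where "Z \<equiv> Z_mat \<tau> \<zeta> M M0"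

definition solves :: "(real \<Rightarrow> real^'n) \<Rightarrow> (real \<Rightarrow> real^'n) \<Rightarrow> bool" where
  "solves f z \<longleftrightarrow> primitive_on UNIV z (\<lambda>s. M s *v z s + M0 s *v z (\<gamma> s) + f s)"

lemma mn_integrable: "locally_integrable Q \<Longrightarrow> (\<lambda>s. mn (Q s)) integrable_on {a..b}" for Q :: "real \<Rightarrow> real^'n^'n"
  using is_norm_absolutely_integrable[OF N(2) locally_integrableD] by (simp add: absolutely_integrable_on_def)

lemma mn_integral_mono:
  "locally_integrable Q \<Longrightarrow> {a..b} \<subseteq> {c..d} \<Longrightarrow> integral {a..b} (\<lambda>s. mn (Q s)) \<le> integral {c..d} (\<lambda>s. mn (Q s))"
  for Q :: "real \<Rightarrow> real^'n^'n"
  by (intro integral_subset_le mn_integrable) (auto simp: is_norm_ge_0[OF N(2)])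

lemma mn_integral_nonneg: "0 \<le> integral {a..b} (\<lambda>s. mn (Q s))" for Q :: "real \<Rightarrow> real^'n^'n"
  by (cases "(\<lambda>s. mn (Q s)) integrable_on {a..b}")
    (auto intro!: Henstock_Kurzweil_Integration.integral_nonneg simp: is_norm_ge_0[OF N(2)] not_integrable_integral)

text \<open>
  In condition (C) the logarithm of \<open>\<rho>\<^sup>\<plusminus>(M\<^sub>0)\<close> is the integral of \<open>|M\<^sub>0|\<close> over the half cell, so its bounds
  \<open>\<nu>\<^sup>\<plusminus> < 1\<close> are exactly the smallness that makes \<open>E\<close> invertible.
\<close>
lemma E_invertible: assumes t: "t \<in> cell j" shows "invertible (E j t)"
proof (rule E_mat_invertible[OF norms M M0])
  let ?I = "{min (\<zeta> j) t..max (\<zeta> j) t}"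
  obtain \<nu>p \<nu>m where nu: "\<nu>p < 1" "\<nu>m < 1" "rho_plus mn \<tau> \<zeta> M j * ln (rho_plus mn \<tau> \<zeta> M0 j) \<le> \<nu>p"
    "rho_minus mn \<tau> \<zeta> M j * ln (rho_minus mn \<tau> \<zeta> M0 j) \<le> \<nu>m"
    using C unfolding condition_C_def by blast
  have le: "exp (integral ?I (\<lambda>s. mn (M s))) * integral ?I (\<lambda>s. mn (M0 s))
    \<le> exp (integral {a..b} (\<lambda>s. mn (M s))) * integral {a..b} (\<lambda>s. mn (M0 s))" if "?I \<subseteq> {a..b}" for a b
    using that by (intro mult_mono) (auto intro!: mn_integral_mono M M0 mn_integral_nonneg)
  show "exp (integral ?I (\<lambda>s. mn (M s))) * integral ?I (\<lambda>s. mn (M0 s)) < 1"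
  proof (cases "\<zeta> j \<le> t")
    case True
    then show ?thesis using le[of "\<zeta> j" "\<tau> (j + 1)"] t nu by (auto simp: rho_minus_def)
  next
    case False
    then show ?thesis using le[of "\<tau> j" "\<zeta> j"] t nu by (auto simp: rho_plus_def)
  qed
qed

text \<open>
  Put \<open>Z(t,u) = W(t) W(u)\<^sup>-\<^sup>1\<close> with \<open>W = E(\<cdot>,\<zeta>\<^sub>j) C\<^sub>j\<close> on cell \<open>j\<close>. The matrices \<open>C\<^sub>j\<close> are chosen recursively so that
  the two expressions for \<open>W\<close> agree at each common node.
\<close>
lemma Z_exists:
  "\<exists>Z. (\<forall>j. \<forall>t\<in>cell j. \<forall>u\<in>cell j. Z t u = E j t ** matrix_inv (E j u)) \<and> (\<forall>t u s. Z t u ** Z u s = Z t s)"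
proof -
  define S where "S j = matrix_inv (E (j + 1) (\<tau> (j + 1))) ** E j (\<tau> (j + 1))" for j
  have mem: "\<tau> (j + 1) \<in> cell j" "\<tau> (j + 1) \<in> cell (j + 1)" for j using tau_step[of j] tau_step[of "j + 1"] by auto
  have inv_inv: "invertible (matrix_inv A)" if "invertible A" for A :: "real^'n^'n"
    using matrix_inv_eqI(3)[OF matrix_inv_right[OF that]] .
  have "invertible (S j)" for j unfolding S_def
    by (rule invertible_mult[OF inv_inv[OF E_invertible[OF mem(2)]] E_invertible[OF mem(1)]])
  from two_sided_recursion[of S, OF this]
  obtain Cf :: "int \<Rightarrow> real^'n^'n" where Cf: "Cf (j + 1) = S j ** Cf j" "invertible (Cf j)" for j by blast
  define W where "W t = (let j = grid_index \<tau> t in E j t ** Cf j)" for t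
  have W: "W t = E j t ** Cf j" if t: "t \<in> cell j" for t j
  proof (cases "t = \<tau> (j + 1)")
    case True
    then have "grid_index \<tau> t = j + 1" using tau_step[of "j + 1"] by (intro grid_index_eq) auto
    then have "W t = E (j + 1) t ** Cf (j + 1)" by (simp only: W_def Let_def)
    also have "\<dots> = E (j + 1) t ** (matrix_inv (E (j + 1) t) ** E j t ** Cf j)"
      unfolding Cf(1)[of j] S_def True ..
    also have "\<dots> = (E (j + 1) t ** matrix_inv (E (j + 1) t)) ** E j t ** Cf j" by (simp add: matrix_mul_assoc)
    also have "\<dots> = E j t ** Cf j" using matrix_inv_right[OF E_invertible[of t "j + 1"]] mem(2)[of j] True by simp
    finally show ?thesis .
  next
    case False
    then have "grid_index \<tau> t = j" using t by (intro grid_index_eq) auto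
    then show ?thesis by (simp add: W_def)
  qed
  have Winv: "invertible (W t)" for t
    using grid_index[of t] unfolding W_def Let_def by (intro invertible_mult E_invertible Cf(2)) auto
  show ?thesis
  proof (intro exI[of _ "\<lambda>t u. W t ** matrix_inv (W u)"] conjI allI ballI)
    fix j t u assume t: "t \<in> cell j" and u: "u \<in> cell j"
    have "matrix_inv (Cf j) ** matrix_inv (E j u) ** (E j u ** Cf j)
       = matrix_inv (Cf j) ** (matrix_inv (E j u) ** E j u) ** Cf j" by (simp add: matrix_mul_assoc)
    also have "\<dots> = mat 1" by (simp add: matrix_inv_left[OF E_invertible[OF u]] matrix_inv_left[OF Cf(2)])
    finally have "matrix_inv (W u) = matrix_inv (Cf j) ** matrix_inv (E j u)"
      unfolding W[OF u] by (rule matrix_inv_eqI(1))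
    then have "W t ** matrix_inv (W u) = E j t ** (Cf j ** matrix_inv (Cf j)) ** matrix_inv (E j u)"
      by (simp add: W[OF t] matrix_mul_assoc)
    then show "W t ** matrix_inv (W u) = E j t ** matrix_inv (E j u)" by (simp add: matrix_inv_right Cf(2))
  next
    fix t u s
    have "W t ** matrix_inv (W u) ** (W u ** matrix_inv (W s))
      = W t ** (matrix_inv (W u) ** W u) ** matrix_inv (W s)" by (simp add: matrix_mul_assoc)
    then show "W t ** matrix_inv (W u) ** (W u ** matrix_inv (W s)) = W t ** matrix_inv (W s)"
      by (simp add: matrix_inv_left Winv)
  qed
qed

text \<open>
  The cocycle property composes the prescribed values within cells to the value between any two times; the node
  \<open>\<tau>\<^sub>0\<close> serves as a common intermediate point.
\<close>
lemma Z_unique: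
  fixes Z1 Z2 :: "real \<Rightarrow> real \<Rightarrow> real^'n^'n"
  assumes cells: "\<And>j t u. t \<in> cell j \<Longrightarrow> u \<in> cell j \<Longrightarrow> Z1 t u = Z2 t u"
    and "\<And>t u s. Z1 t u ** Z1 u s = Z1 t s" "\<And>t u s. Z2 t u ** Z2 u s = Z2 t s"
  shows "Z1 = Z2"
proof -
  have mem: "\<tau> i \<in> cell i" "\<tau> (i + 1) \<in> cell i" for i using tau_step[of i] by auto
  have trans: "Z1 t u = Z2 t u" if "Z1 t s = Z2 t s" "Z1 s u = Z2 s u" for t s u
    using that assms(2)[of t s u] assms(3)[of t s u] by simp
  have nodes: "Z1 (\<tau> i) (\<tau> 0) = Z2 (\<tau> i) (\<tau> 0) \<and> Z1 (\<tau> 0) (\<tau> i) = Z2 (\<tau> 0) (\<tau> i)" for i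
  proof (induction i rule: int_induct[where k = 0])
    case base then show ?case using cells[OF mem(1) mem(1), of 0] by simp
  next
    case (step1 i)
    then show ?case using trans[OF cells[OF mem(2) mem(1), of i]] trans[OF _ cells[OF mem(1) mem(2), of i]] by blast
  next
    case (step2 i)
    then show ?case
      using trans[OF cells[OF mem(1) mem(2), of "i - 1"]] trans[OF _ cells[OF mem(2) mem(1), of "i - 1"]] by simp
  qed
  have "Z1 t (\<tau> 0) = Z2 t (\<tau> 0) \<and> Z1 (\<tau> 0) t = Z2 (\<tau> 0) t" for t
  proof -
    have t: "t \<in> cell (grid_index \<tau> t)" using grid_index[of t] by auto
    show ?thesis using trans[OF cells[OF t mem(1)]] trans[OF _ cells[OF mem(1) t]] nodes by blast
  qed
  then have "Z1 t (\<tau> 0) ** Z1 (\<tau> 0) u = Z2 t (\<tau> 0) ** Z2 (\<tau> 0) u" for t u by simp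
  then show ?thesis by (intro ext) (simp only: assms(2,3))
qed

lemma Z_cell: "t \<in> cell j \<Longrightarrow> u \<in> cell j \<Longrightarrow> Z t u = E j t ** matrix_inv (E j u)"
  and Z_trans: "Z t u ** Z u s = Z t s"
proof -
  let ?P = "\<lambda>Z. (\<forall>j. \<forall>t\<in>cell j. \<forall>u\<in>cell j. Z t u = E j t ** matrix_inv (E j u)) \<and> (\<forall>t u s. Z t u ** Z u s = Z t s)"
  have "\<exists>!Z. ?P Z"
  proof (rule ex_ex1I[OF Z_exists])
    fix Z1 Z2 assume "?P Z1" "?P Z2"
    then show "Z1 = Z2" by (intro Z_unique) auto
  qed
  from theI'[OF this] have "?P Z" unfolding Z_mat_def .
  then show "t \<in> cell j \<Longrightarrow> u \<in> cell j \<Longrightarrow> Z t u = E j t ** matrix_inv (E j u)"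
    and "Z t u ** Z u s = Z t s" by blast+
qed

lemma Z_self: "Z t t = mat 1"
proof -
  have t: "t \<in> cell (grid_index \<tau> t)" using grid_index[of t] by auto
  show ?thesis by (simp add: Z_cell[OF t t] matrix_inv_right E_invertible[OF t])
qed

lemma Phi_force_integrable:
  fixes f :: "real \<Rightarrow> real^'n"
  assumes "f absolutely_integrable_on {a..b}"
  shows "(\<lambda>s. Phi M t s *v f s) absolutely_integrable_on {a..b}"
  by (rule absolutely_integrable_bilinear_right[OF bilinear_matrix_vector_mult continuous_on_Phi[OF M] assms])

text \<open>
  On a cell, \<open>z(\<gamma>(s))\<close> equals \<open>z(\<zeta>\<^sub>j)\<close> except at the right end point, a null set. The equation is then an
  ordinary one with force \<open>M\<^sub>0 z(\<zeta>\<^sub>j) + f\<close>, and variation of constants from \<open>\<zeta>\<^sub>j\<close> applies.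
\<close>
lemma solves_iff:
  assumes f: "locally_integrable f"
  shows "solves f z \<longleftrightarrow> (\<forall>j. \<forall>t\<in>cell j.
    z t = E j t *v z (\<zeta> j) + oriented_integral (\<zeta> j) t (\<lambda>s. Phi M t s *v f s))"
proof -
  have "primitive_on (cell j) z (\<lambda>s. M s *v z s + M0 s *v z (\<gamma> s) + f s) \<longleftrightarrow>
    (\<forall>t\<in>cell j. z t = E j t *v z (\<zeta> j) + oriented_integral (\<zeta> j) t (\<lambda>s. Phi M t s *v f s))" for j
  proof -
    have i1: "(\<lambda>s. M0 s *v z (\<zeta> j)) absolutely_integrable_on cell j"
      by (intro absolutely_integrable_bilinear_left[OF bilinear_matrix_vector_mult] locally_integrableD M0 continuous_on_const)
    have i2: "f absolutely_integrable_on cell j" by (rule locally_integrableD[OF f])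
    have "primitive_on (cell j) z (\<lambda>s. M s *v z s + M0 s *v z (\<gamma> s) + f s) \<longleftrightarrow>
      primitive_on (cell j) z (\<lambda>s. M s *v z s + (M0 s *v z (\<zeta> j) + f s))"
      by (rule primitive_on_spike[of "{\<tau> (j + 1)}"]) (auto simp: gamma_eq[of j])
    also have "\<dots> \<longleftrightarrow> (\<forall>t\<in>cell j. z t = Phi M t (\<zeta> j) *v z (\<zeta> j) +
        oriented_integral (\<zeta> j) t (\<lambda>s. Phi M t s *v (M0 s *v z (\<zeta> j) + f s)))"
      by (rule variation_of_constants[OF M set_integral_add(1)[OF i1 i2] zeta_mem])
    also have "\<dots> \<longleftrightarrow> (\<forall>t\<in>cell j. z t = E j t *v z (\<zeta> j) +
        oriented_integral (\<zeta> j) t (\<lambda>s. Phi M t s *v f s))"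
    proof (rule ball_cong[OF refl])
      fix t assume t: "t \<in> cell j"
      have "oriented_integral (\<zeta> j) t (\<lambda>s. Phi M t s *v (M0 s *v z (\<zeta> j) + f s)) =
        oriented_integral (\<zeta> j) t (\<lambda>s. Phi M t s *v (M0 s *v z (\<zeta> j)))
        + oriented_integral (\<zeta> j) t (\<lambda>s. Phi M t s *v f s)"
        unfolding matrix_vector_right_distrib
        by (rule oriented_integral_add[OF _ _ zeta_mem t])
          (use Phi_force_integrable[OF i1] Phi_force_integrable[OF i2] in \<open>auto simp: absolutely_integrable_on_def\<close>)
      then show "(z t = Phi M t (\<zeta> j) *v z (\<zeta> j) +
        oriented_integral (\<zeta> j) t (\<lambda>s. Phi M t s *v (M0 s *v z (\<zeta> j) + f s))) \<longleftrightarrow>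
        (z t = E j t *v z (\<zeta> j) + oriented_integral (\<zeta> j) t (\<lambda>s. Phi M t s *v f s))"
        by (simp add: E_mat_vector[OF M M0] add.assoc)
    qed
    finally show ?thesis .
  qed
  then show ?thesis by (simp add: solves_def primitive_on_UNIV_iff_cells)
qed

lemma homogeneous_solution:
  assumes z: "solves (\<lambda>_. 0) z"
  shows "z t = Z t u *v z u"
proof -
  have 0: "locally_integrable (\<lambda>_. 0 :: real^'n)" by (simp add: locally_integrable_def)
  have cell: "z t = Z t u *v z u" if t: "t \<in> cell j" and u: "u \<in> cell j" for j t u
  proof -
    have E: "z s = E j s *v z (\<zeta> j)" if "s \<in> cell j" for s
      using z that unfolding solves_iff[OF 0] by (simp add: oriented_integral_def)
    have "Z t u *v z u = E j t *v ((matrix_inv (E j u) ** E j u) *v z (\<zeta> j))"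
      by (simp add: Z_cell[OF t u] E[OF u] matrix_vector_mul_assoc matrix_mul_assoc)
    also have "\<dots> = z t" by (simp add: matrix_inv_left E_invertible[OF u] E[OF t])
    finally show ?thesis by simp
  qed
  have mem: "\<tau> i \<in> cell i" "\<tau> (i + 1) \<in> cell i" for i using tau_step[of i] by auto
  have trans: "z t = Z t u *v z u" if "z t = Z t s *v z s" "z s = Z s u *v z u" for t s u
    by (subst that(1), subst that(2)) (simp add: matrix_vector_mul_assoc Z_trans)
  have nodes: "z (\<tau> i) = Z (\<tau> i) (\<tau> 0) *v z (\<tau> 0)" for i
  proof (induction i rule: int_induct[where k = 0])
    case base then show ?case by (simp add: Z_self)
  next
    case (step1 i)
    show ?case by (rule trans[OF cell[OF mem(2) mem(1)] step1(2)])
  next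
    case (step2 i)
    show ?case using trans[OF cell[OF mem(1) mem(2), of "i - 1"]] step2(2) by simp
  qed
  have base: "z t = Z t (\<tau> 0) *v z (\<tau> 0)" for t
  proof -
    have t: "t \<in> cell (grid_index \<tau> t)" using grid_index[of t] by auto
    show ?thesis by (rule trans[OF cell[OF t mem(1)] nodes])
  qed
  have "Z t u *v z u = Z t u *v (Z u (\<tau> 0) *v z (\<tau> 0))"
    by (subst base[of u]) (rule refl)
  then show ?thesis using base[of t] by (simp add: matrix_vector_mul_assoc Z_trans)
qed

end

section \<open>The weight of the Green function\<close>

lemma le_two_sinh_half:
  fixes u :: real
  assumes "0 \<le> u"
  shows "u \<le> exp (u / 2) - exp (- u / 2)"
proof -
  define f where "f v = exp (v / 2) - exp (- v / 2) - v" for v :: real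
  have "f 0 \<le> f u"
  proof (rule DERIV_nonneg_imp_nondecreasing[OF assms])
    fix v :: real assume "0 \<le> v"
    have "(f has_real_derivative (exp (v / 2) / 2 + exp (- v / 2) / 2 - 1)) (at v)"
      unfolding f_def by (auto intro!: derivative_eq_intros)
    moreover have "exp (v / 2) / 2 + exp (- v / 2) / 2 - 1 = (exp (v / 4) - exp (- v / 4))\<^sup>2 / 2"
    proof -
      have "exp (v / 2) = (exp (v / 4))\<^sup>2" "exp (- v / 2) = (exp (- v / 4))\<^sup>2"
        "exp (v / 4) * exp (- v / 4) = 1"
        by (simp_all add: exp_double[symmetric] flip: exp_add)
      then show ?thesis by (simp add: power2_diff field_simps)
    qed
    moreover have "0 \<le> (exp (v / 4) - exp (- v / 4))\<^sup>2 / 2" by simp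
    ultimately show "\<exists>y. (f has_real_derivative y) (at v) \<and> 0 \<le> y" by metis
  qed
  then show ?thesis by (simp add: f_def)
qed

text \<open>
  The comparison of a step of length \<open>u\<close>, weighted by its larger end value 1, with the integral of
  \<open>exp (- s)\<close> over the step. The factor \<open>exp (x / 2)\<close>, and not \<open>exp x\<close>, is what leaves room for the local term of the
  Green function.
\<close>
lemma step_le_exp_diff:
  fixes u x :: real
  assumes "0 \<le> u" "u \<le> x"
  shows "u \<le> exp (x / 2) * (1 - exp (- u))"
proof -
  have "u \<le> exp (u / 2) * (1 - exp (- u))"
    using le_two_sinh_half[OF assms(1)] by (simp add: right_diff_distrib flip: exp_add)
  also have "\<dots> \<le> exp (x / 2) * (1 - exp (- u))"
    using assms by (intro mult_right_mono) auto
  finally show ?thesis .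
qed

text \<open>
  Here \<open>u\<close> and \<open>v\<close> are the scaled distances of \<open>t\<close> to the ends of its cell: the first summand is the weight of all
  other cells, \<open>u + v\<close> that of the cell of \<open>t\<close>, and \<open>max u v\<close> that of the local term. For given \<open>u + v\<close> the worst
  case is \<open>t\<close> at an end of the cell.
\<close>
lemma green_constant:
  fixes u v x :: real
  assumes "0 \<le> u" "0 \<le> v" "u + v \<le> x"
  shows "exp (x / 2) * (exp (- u) + exp (- v)) + (u + v) + max u v \<le> 2 * exp x"
proof -
  define d where "d = u + v"
  define w where "w = exp (d / 2)"
  define y where "y = exp (x / 2)"
  have d: "0 \<le> d" "d \<le> x" using assms by (auto simp: d_def)
  have w: "1 \<le> w" and wy: "w \<le> y" using d by (auto simp: w_def y_def)
  \<comment> \<open>Moving \<open>t\<close> to an end of the cell: \<open>exp (- u) + exp (- v) \<le> 1 + exp (- u - v)\<close>.\<close>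
  have "(1 - exp (- u)) * (1 - exp (- v)) \<ge> 0" using assms by (intro mult_nonneg_nonneg) auto
  then have "exp (- u) + exp (- v) \<le> 1 + exp (- d)"
    by (simp add: algebra_simps d_def flip: exp_add)
  moreover have "exp (- d) = 1 / w\<^sup>2"
  proof -
    have "w\<^sup>2 = exp d" unfolding w_def by (simp flip: exp_double)
    then show ?thesis by (simp add: exp_minus inverse_eq_divide)
  qed
  ultimately have "exp (x / 2) * (exp (- u) + exp (- v)) \<le> y * (1 + 1 / w\<^sup>2)"
    by (simp add: y_def)
  moreover have "(u + v) + max u v \<le> 2 * d" using assms by (auto simp: d_def)
  moreover have "d / 2 \<le> w - 1" using exp_ge_add_one_self[of "d / 2"] unfolding w_def by linarith
  ultimately have 1: "exp (x / 2) * (exp (- u) + exp (- v)) + (u + v) + max u v \<le> y * (1 + 1 / w\<^sup>2) + 4 * w - 4"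
    by linarith
  \<comment> \<open>The extreme case \<open>y = w\<close>; the difference of the two sides increases with \<open>y\<close>.\<close>
  have "w * (1 + 1 / w\<^sup>2) + 4 * w - 4 \<le> 2 * w\<^sup>2"
  proof -
    have "0 \<le> (w - 1)\<^sup>2 * (2 * w - 1) / w" using w by simp
    also have "\<dots> = 2 * w\<^sup>2 - (w * (1 + 1 / w\<^sup>2) + 4 * w - 4)"
      using w by (simp add: field_simps power2_eq_square)
    finally show ?thesis by simp
  qed
  moreover have "(y - w) * (1 + 1 / w\<^sup>2) \<le> (y - w) * (2 * (y + w))"
  proof (rule mult_left_mono)
    have "1 / w\<^sup>2 \<le> 1" using w by (simp add: field_simps)
    then have "1 + 1 / w\<^sup>2 \<le> 2" by simp
    also have "2 \<le> 2 * (y + w)" using w order_trans[OF w wy] by simp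
    finally show "1 + 1 / w\<^sup>2 \<le> 2 * (y + w)" .
  qed (use wy in simp)
  moreover have "y * (1 + q) + 4 * w - 4 \<le> 2 * y\<^sup>2"
    if "w * (1 + q) + 4 * w - 4 \<le> 2 * w\<^sup>2" "(y - w) * (1 + q) \<le> (y - w) * (2 * (y + w))" for q
    using that by (simp add: algebra_simps power2_eq_square)
  ultimately have "y * (1 + 1 / w\<^sup>2) + 4 * w - 4 \<le> 2 * y\<^sup>2" by blast
  also have "y\<^sup>2 = exp x" by (simp add: y_def flip: exp_double)
  finally show ?thesis using 1 by linarith
qed

lemma integrable_on_UNIV_exhaust:
  fixes g :: "real \<Rightarrow> real"
  assumes nn: "\<And>s. 0 \<le> g s" and int: "\<And>n. g integrable_on {l n..u n}" and B: "\<And>n. integral {l n..u n} g \<le> B"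
    and inc: "\<And>n. {l n..u n} \<subseteq> {l (Suc n)..u (Suc n)}"
    and ex: "\<And>s. \<exists>N. \<forall>n\<ge>N. s \<in> {l n..u n}"
  shows "g integrable_on UNIV" "integral UNIV g \<le> B"
proof -
  define f where "f n s = (if s \<in> {l n..u n} then g s else 0)" for n s
  have fi: "f n integrable_on UNIV" "integral UNIV (f n) = integral {l n..u n} g" for n
    unfolding f_def using int[of n] by (simp_all only: integrable_restrict_UNIV integral_restrict_UNIV)
  have "0 \<le> integral UNIV (f n)" for n
    unfolding fi by (rule Henstock_Kurzweil_Integration.integral_nonneg[OF int nn])
  then have bd: "bounded (range (\<lambda>n. integral UNIV (f n)))"
    using B unfolding bounded_iff by (intro exI[of _ B]) (auto simp: fi)
  have conv: "(\<lambda>n. f n s) \<longlonglongrightarrow> g s" for s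
  proof -
    obtain N where "\<forall>n\<ge>N. s \<in> {l n..u n}" using ex by blast
    then have "eventually (\<lambda>n. f n s = g s) sequentially"
      unfolding eventually_sequentially f_def by (intro exI[of _ N]) simp
    then show ?thesis by (rule tendsto_eventually)
  qed
  have "f n s \<le> f (Suc n) s" for n s
    using inc[of n] nn by (auto simp: f_def)
  then have *: "g integrable_on UNIV \<and> (\<lambda>n. integral UNIV (f n)) \<longlonglongrightarrow> integral UNIV g"
    by (intro monotone_convergence_increasing fi conv bd)
  then show "g integrable_on UNIV" by simp
  show "integral UNIV g \<le> B"
    using * by (intro LIMSEQ_le_const2[of "\<lambda>n. integral UNIV (f n)"]) (auto simp: fi B)
qed

text \<open>
  Lets integrability on the whole line be split into a local part, checked on bounded pieces, and a global bound.
\<close>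
lemma locally_integrable_dominated:
  fixes g :: "real \<Rightarrow> 'a::euclidean_space"
  assumes g: "locally_integrable g" and k: "k integrable_on UNIV" and le: "\<And>s. norm (g s) \<le> k s"
  shows "g absolutely_integrable_on UNIV"
proof (rule dominated_convergence_absolutely_integrable[OF _ k le])
  show "(\<lambda>s. if s \<in> {- real n..real n} then g s else 0) absolutely_integrable_on UNIV" for n
    unfolding absolutely_integrable_restrict_UNIV using g by (rule locally_integrableD)
  show "(\<lambda>n. if s \<in> {- real n..real n} then g s else 0) \<longlonglongrightarrow> g s" for s
  proof (rule tendsto_eventually)
    obtain N where "\<bar>s\<bar> \<le> real N" using real_arch_simple by blast
    then show "eventually (\<lambda>n. (if s \<in> {- real n..real n} then g s else 0) = g s) sequentially"
      unfolding eventually_sequentially by (intro exI[of _ N]) auto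
  qed
qed

lemma locally_integrable_restrict:
  assumes "locally_integrable f" "S \<in> sets lebesgue"
  shows "locally_integrable (\<lambda>s. if s \<in> S then f s else 0)"
  unfolding locally_integrable_def
proof (intro allI)
  fix a b
  have "integrable lebesgue (\<lambda>x. indicator S x *\<^sub>R (indicator {a..b} x *\<^sub>R f x))"
    using assms(2) locally_integrableD[OF assms(1), of a b] unfolding set_integrable_def
    by (rule integrable_mult_indicator)
  moreover have "indicator S x *\<^sub>R (indicator {a..b} x *\<^sub>R f x) = indicator {a..b} x *\<^sub>R (if x \<in> S then f x else 0)" for x
    by (simp add: indicator_def)
  ultimately show "(\<lambda>s. if s \<in> S then f s else 0) absolutely_integrable_on {a..b}"
    by (simp add: set_integrable_def)
qed

lemma locally_integrable_diff: "locally_integrable f \<Longrightarrow> locally_integrable g \<Longrightarrow> locally_integrable (\<lambda>s. f s - g s)"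
  by (auto simp: locally_integrable_def intro: set_integral_diff)

lemma absolutely_integrable_matrix_vector:
  fixes f :: "real \<Rightarrow> real^'n"
  shows "f absolutely_integrable_on S \<Longrightarrow> (\<lambda>s. A *v f s) absolutely_integrable_on S"
  using absolutely_integrable_linear[OF _ matrix_vector_mul_bounded_linear] by (auto simp: o_def)

lemma locally_integrable_matrix_vector:
  fixes f :: "real \<Rightarrow> real^'n"
  shows "locally_integrable f \<Longrightarrow> locally_integrable (\<lambda>s. A *v f s)"
  by (simp add: locally_integrable_def absolutely_integrable_matrix_vector)

lemma integral_matrix_vector:
  fixes f :: "real \<Rightarrow> real^'n"
  shows "f integrable_on S \<Longrightarrow> integral S (\<lambda>s. A *v f s) = A *v integral S f"
  using integral_linear[OF _ matrix_vector_mul_bounded_linear] by (auto simp: o_def)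

context time_grid
begin

lemma zeta_mono: "i \<le> j \<Longrightarrow> \<zeta> i \<le> \<zeta> j"
  using zeta_le_tau[of i] tau_le_zeta[of j] tau_le[of "i + 1" j] by (cases "i = j") force+

text \<open>
  The grid point to which the Green function carries an impulse at time \<open>s\<close>.
\<close>
definition node :: "real \<Rightarrow> real" where
  "node s = (let r = grid_index \<tau> s in if s < \<zeta> r then \<tau> r else \<tau> (r + 1))"

text \<open>
  Seen through the points \<open>\<zeta>\<^sub>r\<close> instead of the nodes, \<open>node\<close> is a plain step function, with the single value
  \<open>\<tau>\<^sub>r\<^sub>+\<^sub>1\<close> on \<open>[\<zeta>\<^sub>r, \<zeta>\<^sub>r\<^sub>+\<^sub>1)\<close>.
\<close>
lemma node_eq: assumes "\<zeta> r \<le> s" "s < \<zeta> (r + 1)" shows "node s = \<tau> (r + 1)"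
proof (cases "s < \<tau> (r + 1)")
  case True
  then have "grid_index \<tau> s = r" using assms tau_le_zeta[of r] by (intro grid_index_eq) auto
  then show ?thesis using assms by (simp add: node_def)
next
  case False
  then have "grid_index \<tau> s = r + 1" using assms zeta_le_tau[of "r + 1"] by (intro grid_index_eq) auto
  then show ?thesis using assms by (simp add: node_def)
qed

lemma node_le: assumes "s < \<zeta> j" shows "node s \<le> \<tau> j"
proof -
  let ?r = "grid_index \<tau> s"
  have "\<tau> ?r < \<tau> (j + 1)" using grid_index(1)[of s] assms zeta_le_tau[of j] by linarith
  then have "?r \<le> j" by (simp add: tau_less_iff)
  then consider "?r = j" | "?r + 1 \<le> j" by linarith
  then show ?thesis
  proof cases
    case 2
    then show ?thesis using tau_le[of ?r j] tau_le[of "?r + 1" j] by (simp add: node_def Let_def)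
  qed (use assms in \<open>simp add: node_def\<close>)
qed

lemma node_ge: assumes "\<zeta> j \<le> s" shows "\<tau> (j + 1) \<le> node s"
proof -
  let ?r = "grid_index \<tau> s"
  have "\<tau> j < \<tau> (?r + 1)" using grid_index(2)[of s] assms tau_le_zeta[of j] by linarith
  then have "j \<le> ?r" by (simp add: tau_less_iff)
  then consider "?r = j" | "j + 1 \<le> ?r" by linarith
  then show ?thesis
  proof cases
    case 2
    then show ?thesis using tau_le[of "j + 1" ?r] tau_le[of "j + 1" "?r + 1"] by (simp add: node_def Let_def)
  qed (use assms in \<open>simp add: node_def\<close>)
qed

lemma locally_integrable_if_zeta_cells:
  fixes f :: "real \<Rightarrow> 'a::euclidean_space"
  assumes f: "\<And>j. f absolutely_integrable_on {\<zeta> j..\<zeta> (j + 1)}"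
  shows "locally_integrable f"
proof -
  have block: "f absolutely_integrable_on {\<zeta> j..\<zeta> k}" if "j < k" for j k
    using that
  proof (induction k rule: int_gr_induct)
    case base show ?case by (rule f)
  next
    case (step k)
    have "{\<zeta> j..\<zeta> (k + 1)} = {\<zeta> j..\<zeta> k} \<union> {\<zeta> k..\<zeta> (k + 1)}"
      using zeta_mono[of j k] zeta_mono[of k "k + 1"] step(1) by (simp add: ivl_disj_un_two_touch)
    then show ?case using step(2) f[of k] by (simp add: absolutely_integrable_Un)
  qed
  show ?thesis
    unfolding locally_integrable_def
  proof (intro allI)
    fix a b :: real
    show "f absolutely_integrable_on {a..b}"
    proof (cases "a \<le> b")
      case True
      let ?i = "grid_index \<tau> a - 1" and ?j = "grid_index \<tau> b + 1"
      have "?i < ?j" using grid_index_mono[OF True] by simp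
      moreover have "\<zeta> ?i \<le> a" using zeta_le_tau[of ?i] grid_index(1)[of a] by simp
      moreover have "b \<le> \<zeta> ?j" using tau_le_zeta[of ?j] grid_index(2)[of b] by simp
      ultimately show ?thesis
        by (intro absolutely_integrable_on_subinterval[OF block[of ?i ?j]]) auto
    qed simp
  qed
qed

text \<open>
  A majorant of \<open>exp (- \<alpha> * \<bar>t - node s\<bar>)\<close> that is constant on each cell: in the cell of \<open>s\<close> it takes the end
  nearer to \<open>t\<close>, and it is 1 on the cell of \<open>t\<close>.
\<close>
definition step_weight :: "real \<Rightarrow> real \<Rightarrow> real \<Rightarrow> real" where
  "step_weight \<alpha> t s = (let j = grid_index \<tau> t; r = grid_index \<tau> s in
     if j < r then exp (- \<alpha> * (\<tau> r - t)) else if r < j then exp (- \<alpha> * (t - \<tau> (r + 1))) else 1)"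

text \<open>
  By \<open>step_le_exp_diff\<close>, the weight of each cell other than that of \<open>t\<close> is at most \<open>x\<close> times a difference of
  exponentials at its ends. These differences telescope to the left and to the right of the cell of \<open>t\<close>.
\<close>
lemma step_weight_integral:
  fixes \<alpha> t :: real
  assumes \<alpha>: "\<alpha> > 0"
  defines "x \<equiv> exp (\<alpha> * \<theta> / 2) / \<alpha>" and "j \<equiv> grid_index \<tau> t"
  shows "step_weight \<alpha> t integrable_on UNIV"
    and "integral UNIV (step_weight \<alpha> t) \<le>
      x * (exp (- \<alpha> * (t - \<tau> j)) + exp (- \<alpha> * (\<tau> (j + 1) - t))) + (\<tau> (j + 1) - \<tau> j)"
proof -
  let ?w = "step_weight \<alpha> t"
  have len: "\<tau> (r + 1) - \<tau> r \<le> x * (1 - exp (- \<alpha> * (\<tau> (r + 1) - \<tau> r)))" for r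
  proof -
    have "\<alpha> * (\<tau> (r + 1) - \<tau> r) \<le> exp (\<alpha> * \<theta> / 2) * (1 - exp (- (\<alpha> * (\<tau> (r + 1) - \<tau> r))))"
      using \<alpha> tau_step[of r] cell_length[of r] by (intro step_le_exp_diff) auto
    then show ?thesis using \<alpha> by (simp add: x_def field_simps)
  qed
  have cell_int: "(?w has_integral (c * (\<tau> (r + 1) - \<tau> r))) (cell r)"
    if c: "\<And>s. \<tau> r \<le> s \<Longrightarrow> s < \<tau> (r + 1) \<Longrightarrow> ?w s = c" for r c
  proof -
    have "((\<lambda>_. c) has_integral (c * (\<tau> (r + 1) - \<tau> r))) (cell r)"
      using has_integral_const_real[of c "\<tau> r" "\<tau> (r + 1)"] tau_step[of r] by (simp add: mult.commute)
    then show ?thesis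
      by (rule has_integral_spike_finite[of "{\<tau> (r + 1)}", rotated 2]) (use c in auto)
  qed
  have right: "?w integrable_on {\<tau> (j + 1)..\<tau> (j + 1 + int n)} \<and>
    integral {\<tau> (j + 1)..\<tau> (j + 1 + int n)} ?w \<le>
      x * (exp (- \<alpha> * (\<tau> (j + 1) - t)) - exp (- \<alpha> * (\<tau> (j + 1 + int n) - t)))" for n
  proof (induction n)
    case (Suc n)
    let ?r = "j + 1 + int n"
    let ?c = "exp (- \<alpha> * (\<tau> ?r - t))"
    have r: "j + 1 + int (Suc n) = ?r + 1" by simp
    have "(?w has_integral (?c * (\<tau> (?r + 1) - \<tau> ?r))) (cell ?r)"
    proof (rule cell_int)
      fix s assume "\<tau> ?r \<le> s" "s < \<tau> (?r + 1)"
      then have "grid_index \<tau> s = ?r" by (rule grid_index_eq)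
      then show "?w s = ?c" by (simp add: step_weight_def flip: j_def)
    qed
    moreover have "(?w has_integral (integral {\<tau> (j + 1)..\<tau> ?r} ?w)) {\<tau> (j + 1)..\<tau> ?r}"
      using Suc by (simp add: integrable_integral)
    ultimately have i: "(?w has_integral (integral {\<tau> (j + 1)..\<tau> ?r} ?w + ?c * (\<tau> (?r + 1) - \<tau> ?r))) {\<tau> (j + 1)..\<tau> (?r + 1)}"
      using tau_le[of "j + 1" ?r] tau_step[of ?r] by (intro has_integral_combine[of _ "\<tau> ?r"]) auto
    have "?c * (\<tau> (?r + 1) - \<tau> ?r) \<le> ?c * (x * (1 - exp (- \<alpha> * (\<tau> (?r + 1) - \<tau> ?r))))"
      by (intro mult_left_mono len) auto
    also have "\<dots> = x * (?c - exp (- \<alpha> * (\<tau> (?r + 1) - t)))"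
      by (simp add: algebra_simps flip: exp_add)
    finally show ?case using i Suc unfolding r by (simp add: has_integral_iff algebra_simps)
  qed (simp add: integrable_negligible)
  have left: "?w integrable_on {\<tau> (j - int n)..\<tau> j} \<and>
    integral {\<tau> (j - int n)..\<tau> j} ?w \<le>
      x * (exp (- \<alpha> * (t - \<tau> j)) - exp (- \<alpha> * (t - \<tau> (j - int n))))" for n
  proof (induction n)
    case (Suc n)
    let ?r = "j - int (Suc n)"
    let ?c = "exp (- \<alpha> * (t - \<tau> (?r + 1)))"
    have r: "j - int n = ?r + 1" by simp
    have "(?w has_integral (?c * (\<tau> (?r + 1) - \<tau> ?r))) (cell ?r)"
    proof (rule cell_int)
      fix s assume "\<tau> ?r \<le> s" "s < \<tau> (?r + 1)"
      then have "grid_index \<tau> s = ?r" by (rule grid_index_eq)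
      then show "?w s = ?c" by (simp add: step_weight_def flip: j_def)
    qed
    moreover have "(?w has_integral (integral {\<tau> (?r + 1)..\<tau> j} ?w)) {\<tau> (?r + 1)..\<tau> j}"
      using Suc unfolding r by (simp add: integrable_integral)
    ultimately have i: "(?w has_integral (?c * (\<tau> (?r + 1) - \<tau> ?r) + integral {\<tau> (?r + 1)..\<tau> j} ?w)) {\<tau> ?r..\<tau> j}"
      using tau_le[of "?r + 1" j] tau_step[of ?r] by (intro has_integral_combine[of _ "\<tau> (?r + 1)"]) auto
    have "?c * (\<tau> (?r + 1) - \<tau> ?r) \<le> ?c * (x * (1 - exp (- \<alpha> * (\<tau> (?r + 1) - \<tau> ?r))))"
      by (intro mult_left_mono len) auto
    also have "\<dots> = x * (?c - exp (- \<alpha> * (t - \<tau> ?r)))"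
      by (simp add: algebra_simps flip: exp_add)
    finally show ?case using i Suc unfolding r by (simp add: has_integral_iff algebra_simps)
  qed (simp add: integrable_negligible)
  have mid: "(?w has_integral (\<tau> (j + 1) - \<tau> j)) (cell j)"
    using cell_int[of j 1] grid_index_eq[of j] by (simp add: step_weight_def flip: j_def)
  have x: "x \<ge> 0" using \<alpha> by (simp add: x_def)
  let ?B = "x * (exp (- \<alpha> * (t - \<tau> j)) + exp (- \<alpha> * (\<tau> (j + 1) - t))) + (\<tau> (j + 1) - \<tau> j)"
  have block: "?w integrable_on {\<tau> (j - int n)..\<tau> (j + 1 + int n)} \<and>
    integral {\<tau> (j - int n)..\<tau> (j + 1 + int n)} ?w \<le> ?B" for n
  proof -
    have l: "(?w has_integral (integral {\<tau> (j - int n)..\<tau> j} ?w)) {\<tau> (j - int n)..\<tau> j}"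
      and r: "(?w has_integral (integral {\<tau> (j + 1)..\<tau> (j + 1 + int n)} ?w)) {\<tau> (j + 1)..\<tau> (j + 1 + int n)}"
      using left[of n] right[of n] by (simp_all add: integrable_integral)
    have o: "\<tau> (j - int n) \<le> \<tau> j" "\<tau> j \<le> \<tau> (j + 1)" "\<tau> (j + 1) \<le> \<tau> (j + 1 + int n)"
      by (auto intro: tau_le)
    have "(?w has_integral (integral {\<tau> (j - int n)..\<tau> j} ?w + (\<tau> (j + 1) - \<tau> j)
        + integral {\<tau> (j + 1)..\<tau> (j + 1 + int n)} ?w)) {\<tau> (j - int n)..\<tau> (j + 1 + int n)}"
      using o by (intro has_integral_combine[OF _ _ has_integral_combine[OF _ _ l mid] r]) auto
    moreover have "integral {\<tau> (j - int n)..\<tau> j} ?w + (\<tau> (j + 1) - \<tau> j) + integral {\<tau> (j + 1)..\<tau> (j + 1 + int n)} ?w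
      \<le> x * exp (- \<alpha> * (t - \<tau> j)) + (\<tau> (j + 1) - \<tau> j) + x * exp (- \<alpha> * (\<tau> (j + 1) - t))"
    proof (intro add_mono order_refl)
      show "integral {\<tau> (j - int n)..\<tau> j} ?w \<le> x * exp (- \<alpha> * (t - \<tau> j))"
        by (rule order_trans[OF conjunct2[OF left] mult_left_mono[OF _ x]]) simp
      show "integral {\<tau> (j + 1)..\<tau> (j + 1 + int n)} ?w \<le> x * exp (- \<alpha> * (\<tau> (j + 1) - t))"
        by (rule order_trans[OF conjunct2[OF right] mult_left_mono[OF _ x]]) simp
    qed
    ultimately show ?thesis by (simp add: has_integral_iff algebra_simps)
  qed
  have nn: "0 \<le> ?w s" for s by (simp add: step_weight_def Let_def)
  have inc: "{\<tau> (j - int n)..\<tau> (j + 1 + int n)} \<subseteq> {\<tau> (j - int (Suc n))..\<tau> (j + 1 + int (Suc n))}" for n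
    using tau_le[of "j - int (Suc n)" "j - int n"] tau_le[of "j + 1 + int n" "j + 1 + int (Suc n)"] by auto
  have ex: "\<exists>N. \<forall>n\<ge>N. s \<in> {\<tau> (j - int n)..\<tau> (j + 1 + int n)}" for s
  proof (intro exI allI impI)
    fix n assume n: "n \<ge> nat \<bar>grid_index \<tau> s - j\<bar>"
    then have "j - int n \<le> grid_index \<tau> s" "grid_index \<tau> s + 1 \<le> j + 1 + int n" by linarith+
    from this[THEN tau_le] show "s \<in> {\<tau> (j - int n)..\<tau> (j + 1 + int n)}"
      using grid_index[of s] by simp
  qed
  show "?w integrable_on UNIV" "integral UNIV ?w \<le> ?B"
    by (rule integrable_on_UNIV_exhaust[OF nn conjunct1[OF block] conjunct2[OF block] inc ex])+
qed

end

section \<open>Bounded solutions of the inhomogeneous equation\<close>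

lemma green_constant_scaled:
  fixes \<alpha> a b \<theta> :: real
  assumes \<alpha>: "\<alpha> > 0" and ab: "0 \<le> a" "0 \<le> b" "a + b \<le> \<theta>"
  shows "exp (\<alpha> * \<theta> / 2) / \<alpha> * (exp (- \<alpha> * a) + exp (- \<alpha> * b)) + (a + b) + max a b \<le> 2 * exp (\<alpha> * \<theta>) / \<alpha>"
proof -
  have 1: "exp (\<alpha> * \<theta> / 2) * (exp (- (\<alpha> * a)) + exp (- (\<alpha> * b))) + (\<alpha> * a + \<alpha> * b) + max (\<alpha> * a) (\<alpha> * b)
    \<le> 2 * exp (\<alpha> * \<theta>)" (is "?X \<le> _")
    using ab \<alpha> by (intro green_constant) (auto simp flip: distrib_left)
  have "max (\<alpha> * a) (\<alpha> * b) = \<alpha> * max a b"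
    using \<alpha> by (simp add: max_mult_distrib_left)
  then have "exp (\<alpha> * \<theta> / 2) / \<alpha> * (exp (- \<alpha> * a) + exp (- \<alpha> * b)) + (a + b) + max a b = ?X / \<alpha>"
    using \<alpha> by (simp add: field_simps)
  also have "\<dots> \<le> 2 * exp (\<alpha> * \<theta>) / \<alpha>" using 1 \<alpha> by (intro divide_right_mono) auto
  finally show ?thesis .
qed

locale dichotomic_depcag = linear_depcag \<tau> \<zeta> \<gamma> \<theta> vn mn M M0
  for \<tau> \<zeta> :: "int \<Rightarrow> real" and \<gamma> :: "real \<Rightarrow> real" and \<theta> :: real
    and vn :: "real^'n \<Rightarrow> real" and mn :: "real^'n^'n \<Rightarrow> real" and M M0 :: "real \<Rightarrow> real^'n^'n" +
  fixes P :: "real^'n^'n" and K \<alpha> :: real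
  assumes dich: "exponential_dichotomy mn \<tau> \<zeta> M M0 P K \<alpha>"
begin

abbreviation Zp :: "real \<Rightarrow> real \<Rightarrow> real^'n^'n" where "Zp \<equiv> Z_proj \<tau> \<zeta> M M0 P"
abbreviation G :: "real \<Rightarrow> real \<Rightarrow> real^'n^'n" where "G \<equiv> Green \<tau> \<zeta> M M0 P"
abbreviation R :: real where "R \<equiv> rho mn \<tau> \<zeta> M"

lemma K_ge_1: "K \<ge> 1" and alpha_pos: "\<alpha> > 0"
  and Zp_bound: "mn (Zp t s) \<le> K * exp (- \<alpha> * \<bar>t - s\<bar>)"
  using dich by (auto simp: exponential_dichotomy_def)

lemma R_ge_1: "R \<ge> 1" using C by (simp add: condition_C_def)

text \<open>
  If \<open>z\<close> is bounded, \<open>P z(0) = Z\<^sub>P(0,s) z(s)\<close> decays as \<open>s \<rightarrow> -\<infinity>\<close> and \<open>(I - P) z(0) = - Z\<^sub>P(0,s) z(s)\<close> decays as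
  \<open>s \<rightarrow> \<infinity>\<close>. Neither depends on \<open>s\<close>, so both vanish.
\<close>
lemma bounded_homogeneous_solution_zero:
  assumes z: "solves (\<lambda>_. 0) z" and B: "\<And>t. vn (z t) \<le> B"
  shows "z t = 0"
proof -
  have zero: "v = 0" if le: "\<And>n. vn v \<le> K * exp (- \<alpha> * real n) * B" for v
  proof -
    have "(\<lambda>n. exp (- \<alpha>) ^ n) \<longlonglongrightarrow> 0" using alpha_pos by (intro LIMSEQ_power_zero) simp
    then have "(\<lambda>n. exp (- \<alpha> * real n)) \<longlonglongrightarrow> 0" by (simp add: mult.commute flip: exp_of_nat_mult)
    then have "(\<lambda>n. K * exp (- \<alpha> * real n) * B) \<longlonglongrightarrow> K * 0 * B" by (intro tendsto_intros)
    then have "vn v \<le> K * 0 * B" by (rule LIMSEQ_le_const) (use le in auto)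
    then show "v = 0" using is_norm_pos[OF N(1), of v] by fastforce
  qed
  have Zz: "Z 0 s *v z s = z 0" for s using homogeneous_solution[OF z, of 0 s] by simp
  have bound: "vn (Zp 0 s *v z s) \<le> K * exp (- \<alpha> * \<bar>s\<bar>) * B" for s
  proof -
    have "vn (Zp 0 s *v z s) \<le> mn (Zp 0 s) * vn (z s)" by (rule N)
    also have "\<dots> \<le> (K * exp (- \<alpha> * \<bar>s\<bar>)) * B"
      using Zp_bound[of 0 s] B[of s] K_ge_1 is_norm_ge_0[OF N(1), of "z s"] by (intro mult_mono) auto
    finally show ?thesis .
  qed
  have "P *v z 0 = 0"
  proof (rule zero)
    fix n
    have "Zp 0 (- real n) *v z (- real n) = P *v (Z 0 (- real n) *v z (- real n))"
      by (simp add: Z_proj_def Z_self matrix_vector_mul_assoc)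
    then show "vn (P *v z 0) \<le> K * exp (- \<alpha> * real n) * B" using bound[of "- real n"] by (simp add: Zz)
  qed
  moreover have "(mat 1 - P) *v z 0 = 0"
  proof (rule zero)
    fix n
    show "vn ((mat 1 - P) *v z 0) \<le> K * exp (- \<alpha> * real n) * B"
    proof (cases "n = 0")
      case True
      \<comment> \<open>At \<open>s = 0\<close> the dichotomy kernel has the factor \<open>P\<close> instead of \<open>I - P\<close>, so \<open>s = 1\<close> is used.\<close>
      have "Zp 0 1 = - ((mat 1 - P) ** Z 0 1)" by (simp add: Z_proj_def Z_self)
      then have eq: "Zp 0 1 *v z 1 = - ((mat 1 - P) *v z 0)"
        by (simp add: matrix_vector_neg_left Zz flip: matrix_vector_mul_assoc)
      have "0 \<le> B" using B[of 0] is_norm_ge_0[OF N(1), of "z 0"] by simp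
      then have "K * exp (- \<alpha> * \<bar>1\<bar>) * B \<le> K * 1 * B"
        using alpha_pos K_ge_1 by (intro mult_right_mono mult_left_mono) auto
      then show ?thesis using bound[of 1] True by (simp add: eq is_norm_minus[OF N(1)])
    next
      case False
      then have "Zp 0 (real n) = - ((mat 1 - P) ** Z 0 (real n))" by (simp add: Z_proj_def Z_self)
      then have "Zp 0 (real n) *v z (real n) = - ((mat 1 - P) *v z 0)"
        by (simp add: matrix_vector_neg_left Zz flip: matrix_vector_mul_assoc)
      then show ?thesis using bound[of "real n"] by (simp add: is_norm_minus[OF N(1)])
    qed
  qed
  ultimately have "P *v z 0 + (mat 1 - P) *v z 0 = 0" by simp
  then have "z 0 = 0" by (simp add: matrix_vector_mult_diff_rdistrib)
  then show ?thesis using homogeneous_solution[OF z, of t 0] by simp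
qed

text \<open>
  The part \<open>\<plusminus>\<Phi>(t,s)\<close> of the Green function between \<open>t\<close> and \<open>\<zeta>\<^sub>j\<close>. It carries the sign of the oriented integral
  from \<open>\<zeta>\<^sub>j\<close> to \<open>t\<close>.
\<close>
definition local_kernel :: "real \<Rightarrow> real \<Rightarrow> real^'n^'n" where
  "local_kernel t s = (let c = \<zeta> (grid_index \<tau> t) in
     if c \<le> s \<and> s < t then Phi M t s else if t \<le> s \<and> s < c then - Phi M t s else 0)"

lemma Green_eq: "G t s = Zp t (node s) ** Phi M (node s) s + local_kernel t s"
  by (simp add: Green_def local_kernel_def node_def Let_def)

lemma exp_mn_integral_le_R:
  assumes "{a..b} \<subseteq> cell r"
  shows "exp (integral {a..b} (\<lambda>s. mn (M s))) \<le> R"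
proof -
  have "integral {\<tau> r..\<zeta> r} (\<lambda>s. mn (M s)) + integral {\<zeta> r..\<tau> (r + 1)} (\<lambda>s. mn (M s)) = integral (cell r) (\<lambda>s. mn (M s))"
    using tau_le_zeta[of r] zeta_le_tau[of r] by (intro Henstock_Kurzweil_Integration.integral_combine mn_integrable M)
  then have "exp (integral (cell r) (\<lambda>s. mn (M s))) = rho_plus mn \<tau> \<zeta> M r * rho_minus mn \<tau> \<zeta> M r"
    by (simp add: rho_plus_def rho_minus_def flip: exp_add)
  also have "\<dots> \<le> R"
    unfolding rho_def using C by (intro cSUP_upper) (auto simp: condition_C_def)
  finally show ?thesis using mn_integral_mono[OF M assms] by (meson exp_le_cancel_iff order_trans)
qed

text \<open>
  Within one cell \<open>\<Phi>\<close> costs at most the factor \<open>\<rho>(M)\<close>; every use of \<open>\<Phi>\<close> in the Green function stays in one cell.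
\<close>
lemma Phi_le_R: assumes "a \<in> cell r" "b \<in> cell r" shows "vn (Phi M a b *v x) \<le> R * vn x"
proof -
  have "exp (integral {min b a..max b a} (\<lambda>s. mn (M s))) \<le> R"
    using assms by (intro exp_mn_integral_le_R[of _ _ r]) auto
  then show ?thesis using Phi_bound[OF norms M, of a b x] is_norm_ge_0[OF N(1), of x]
    by (meson mult_right_mono order_trans)
qed

lemma node_mem: "node s \<in> cell (grid_index \<tau> s)"
  using tau_step[of "grid_index \<tau> s"] by (auto simp: node_def Let_def)

lemma node_weight: "exp (- \<alpha> * \<bar>t - node s\<bar>) \<le> step_weight \<alpha> t s"
proof -
  let ?j = "grid_index \<tau> t" and ?r = "grid_index \<tau> s"
  consider "?r = ?j" | "?j < ?r" | "?r < ?j" by linarith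
  then show ?thesis
  proof cases
    case 2
    then have "\<tau> (?j + 1) \<le> \<tau> ?r" by (intro tau_le) simp
    then have "\<tau> ?r - t \<le> \<bar>t - node s\<bar>" using node_mem[of s] grid_index(2)[of t] by auto
    then show ?thesis using 2 alpha_pos by (simp add: step_weight_def)
  next
    case 3
    then have "\<tau> (?r + 1) \<le> \<tau> ?j" by (intro tau_le) simp
    then have "t - \<tau> (?r + 1) \<le> \<bar>t - node s\<bar>" using node_mem[of s] grid_index(1)[of t] by auto
    then show ?thesis using 3 alpha_pos by (simp add: step_weight_def)
  qed (use alpha_pos in \<open>simp add: step_weight_def\<close>)
qed

text \<open>
  A majorant of the operator norm of the Green function, transported plus local part.
\<close>
definition green_weight :: "real \<Rightarrow> real \<Rightarrow> real" where
  "green_weight t s = K * R * step_weight \<alpha> t s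
     + R * (let c = \<zeta> (grid_index \<tau> t) in if s \<in> {min t c..max t c} then 1 else 0)"

lemma transported_bound: "vn (Zp t (node s) *v (Phi M (node s) s *v x)) \<le> K * R * step_weight \<alpha> t s * vn x"
proof -
  have s: "s \<in> cell (grid_index \<tau> s)" using grid_index[of s] by auto
  have "vn (Zp t (node s) *v (Phi M (node s) s *v x)) \<le> mn (Zp t (node s)) * vn (Phi M (node s) s *v x)"
    by (rule N)
  also have "\<dots> \<le> (K * step_weight \<alpha> t s) * (R * vn x)"
  proof (rule mult_mono)
    have "mn (Zp t (node s)) \<le> K * exp (- \<alpha> * \<bar>t - node s\<bar>)" by (rule Zp_bound)
    also have "\<dots> \<le> K * step_weight \<alpha> t s" using K_ge_1 by (intro mult_left_mono node_weight) auto
    finally show "mn (Zp t (node s)) \<le> K * step_weight \<alpha> t s" .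
    show "vn (Phi M (node s) s *v x) \<le> R * vn x" by (rule Phi_le_R[OF node_mem s])
    show "0 \<le> K * step_weight \<alpha> t s" using K_ge_1 by (auto simp: step_weight_def Let_def)
  qed (rule is_norm_ge_0[OF N(1)])
  finally show ?thesis by (simp add: mult_ac)
qed

lemma local_bound:
  "vn (local_kernel t s *v x) \<le> R * (let c = \<zeta> (grid_index \<tau> t) in if s \<in> {min t c..max t c} then 1 else 0) * vn x"
proof -
  let ?j = "grid_index \<tau> t"
  have t: "t \<in> cell ?j" using grid_index[of t] by auto
  have nn: "0 \<le> R * vn x" using R_ge_1 is_norm_ge_0[OF N(1)] by simp
  show ?thesis
  proof (cases "s \<in> {min t (\<zeta> ?j)..max t (\<zeta> ?j)}")
    case True
    then have "s \<in> cell ?j" using t zeta_mem[of ?j] by auto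
    from Phi_le_R[OF t this, of x] show ?thesis
      using True nn by (auto simp: local_kernel_def Let_def matrix_vector_neg_left is_norm_minus[OF N(1)] is_norm_zero[OF N(1)])
  next
    case False
    then show ?thesis by (auto simp: local_kernel_def Let_def is_norm_zero[OF N(1)])
  qed
qed

lemma Green_bound: "vn (G t s *v x) \<le> green_weight t s * vn x"
proof -
  have "vn (G t s *v x) \<le> vn (Zp t (node s) *v (Phi M (node s) s *v x)) + vn (local_kernel t s *v x)"
    unfolding Green_eq matrix_vector_mult_add_rdistrib
    using is_norm_triangle[OF N(1)] by (simp flip: matrix_vector_mul_assoc)
  also have "\<dots> \<le> green_weight t s * vn x"
    unfolding green_weight_def distrib_right by (rule add_mono[OF transported_bound local_bound])
  finally show ?thesis .
qed

lemma green_weight_integral: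
  "green_weight t integrable_on UNIV" "integral UNIV (green_weight t) \<le> 2 * K * (R * exp (\<alpha> * \<theta>)) / \<alpha>"
proof -
  let ?j = "grid_index \<tau> t"
  let ?c = "\<zeta> ?j"
  let ?a = "t - \<tau> ?j" and ?b = "\<tau> (?j + 1) - t"
  let ?x = "exp (\<alpha> * \<theta> / 2) / \<alpha>"
  let ?W = "?x * (exp (- \<alpha> * ?a) + exp (- \<alpha> * ?b)) + (\<tau> (?j + 1) - \<tau> ?j)"
  have loc: "((\<lambda>s. if s \<in> {min t ?c..max t ?c} then 1 else 0) has_integral \<bar>t - ?c\<bar>) UNIV"
  proof -
    have "measure lborel {min t ?c..max t ?c} *\<^sub>R (1 :: real) = \<bar>t - ?c\<bar>" by (simp add: max_def min_def)
    then show ?thesis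
      using has_integral_const_real[of "1 :: real" "min t ?c" "max t ?c"]
      unfolding has_integral_restrict_UNIV by (simp only:)
  qed
  have sw: "(step_weight \<alpha> t has_integral (integral UNIV (step_weight \<alpha> t))) UNIV"
    using step_weight_integral(1)[OF alpha_pos] by (rule integrable_integral)
  have w: "(green_weight t has_integral (K * R * integral UNIV (step_weight \<alpha> t) + R * \<bar>t - ?c\<bar>)) UNIV"
    unfolding green_weight_def Let_def by (intro has_integral_add has_integral_mult_right sw loc)
  then show "green_weight t integrable_on UNIV" by (auto simp: has_integral_iff)
  have ab: "0 \<le> ?a" "0 \<le> ?b" "?a + ?b \<le> \<theta>" using grid_index[of t] cell_length[of ?j] by auto
  have W: "?W + max ?a ?b \<le> 2 * exp (\<alpha> * \<theta>) / \<alpha>"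
    using green_constant_scaled[OF alpha_pos ab] by simp
  have "\<bar>t - ?c\<bar> \<le> max ?a ?b" using zeta_mem[of ?j] by auto
  also have "\<dots> \<le> K * max ?a ?b" using K_ge_1 ab by (simp add: mult_le_cancel_right1 max_def)
  finally have l: "\<bar>t - ?c\<bar> \<le> K * max ?a ?b" .
  have "integral UNIV (green_weight t) = R * (K * integral UNIV (step_weight \<alpha> t) + \<bar>t - ?c\<bar>)"
    using w by (simp add: has_integral_iff algebra_simps)
  also have "\<dots> \<le> R * (K * ?W + K * max ?a ?b)"
    using R_ge_1 K_ge_1 l step_weight_integral(2)[OF alpha_pos, of t]
    by (intro mult_left_mono add_mono) auto
  also have "\<dots> = R * K * (?W + max ?a ?b)" by (simp add: algebra_simps)
  also have "\<dots> \<le> R * K * (2 * exp (\<alpha> * \<theta>) / \<alpha>)"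
    using R_ge_1 K_ge_1 W by (intro mult_left_mono) auto
  finally show "integral UNIV (green_weight t) \<le> 2 * K * (R * exp (\<alpha> * \<theta>)) / \<alpha>" by (simp add: mult_ac)
qed

text \<open>
  The force carried to time 0: from \<open>s\<close> to its node by \<open>\<Phi>\<close>, and then by \<open>Z\<close>. It does not depend on the time \<open>t\<close> at
  which the response is observed.
\<close>
definition pulled_back :: "(real \<Rightarrow> real^'n) \<Rightarrow> real \<Rightarrow> real^'n" where
  "pulled_back f s = Z 0 (node s) *v (Phi M (node s) s *v f s)"

text \<open>
  The stable part of what has acted before \<open>\<zeta>\<^sub>j\<close>, and minus the unstable part of what acts after it. For \<open>t\<close> in
  the \<open>j\<close>-th cell these are the impulses whose node lies before, respectively after, \<open>t\<close>.
\<close>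
definition split_force :: "(real \<Rightarrow> real^'n) \<Rightarrow> int \<Rightarrow> real \<Rightarrow> real^'n" where
  "split_force f j s = (if s < \<zeta> j then P *v pulled_back f s else - ((mat 1 - P) *v pulled_back f s))"

lemma locally_integrable_pulled_back:
  assumes f: "locally_integrable f"
  shows "locally_integrable (pulled_back f)"
proof (rule locally_integrable_if_zeta_cells)
  fix j
  have "(\<lambda>s. Z 0 (\<tau> (j + 1)) *v (Phi M (\<tau> (j + 1)) s *v f s)) absolutely_integrable_on {\<zeta> j..\<zeta> (j + 1)}"
    by (intro absolutely_integrable_matrix_vector Phi_force_integrable locally_integrableD f)
  then show "pulled_back f absolutely_integrable_on {\<zeta> j..\<zeta> (j + 1)}"
    by (rule absolutely_integrable_spike[of _ _ "{\<zeta> (j + 1)}"]) (auto simp: pulled_back_def node_eq[of j])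
qed

lemma locally_integrable_split_force:
  assumes f: "locally_integrable f"
  shows "locally_integrable (split_force f j)"
proof -
  note g = locally_integrable_pulled_back[OF f]
  have "locally_integrable (\<lambda>s. (if s \<in> {..<\<zeta> j} then P *v pulled_back f s else 0)
     - (if s \<in> {\<zeta> j..} then (mat 1 - P) *v pulled_back f s else 0))"
    by (intro locally_integrable_diff locally_integrable_restrict locally_integrable_matrix_vector g) auto
  moreover have "(\<lambda>s. (if s \<in> {..<\<zeta> j} then P *v pulled_back f s else 0)
     - (if s \<in> {\<zeta> j..} then (mat 1 - P) *v pulled_back f s else 0)) = split_force f j"
    by (auto simp: split_force_def fun_eq_iff)
  ultimately show ?thesis by simp
qed

text \<open>
  For \<open>t\<close> in a fixed cell the transported part depends on \<open>t\<close> only through the factor \<open>Z(t,0)\<close>, because the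
  switch of \<open>Z\<^sub>P\<close> at \<open>node s = t\<close> takes place at the same \<open>s = \<zeta>\<^sub>j\<close> for all these \<open>t\<close>.
\<close>
lemma transported_eq:
  "Zp t (node s) *v (Phi M (node s) s *v f s) = Z t 0 *v split_force f (grid_index \<tau> t) s"
proof -
  let ?j = "grid_index \<tau> t"
  show ?thesis
  proof (cases "s < \<zeta> ?j")
    case True
    then have "node s \<le> t" using node_le[OF True] grid_index(1)[of t] by linarith
    then show ?thesis using True
      by (simp add: split_force_def pulled_back_def Z_proj_def matrix_vector_mul_assoc matrix_mul_assoc)
  next
    case False
    then have "t < node s" using node_ge[of ?j s] grid_index(2)[of t] by linarith
    then show ?thesis using False
      by (simp add: split_force_def pulled_back_def Z_proj_def matrix_vector_neg_left matrix_vector_neg_right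
         matrix_mult_neg_left matrix_vector_mul_assoc matrix_mul_assoc)
  qed
qed

text \<open>
  Observed from \<open>t = \<tau>\<^sub>j\<close>, that is, multiplied by \<open>Z(\<tau>\<^sub>j,0)\<close>, it is the transported part of the Green integral,
  which the step weight dominates.
\<close>
lemma absolutely_integrable_split_force:
  assumes f: "locally_integrable f" and F: "\<And>s. vn (f s) \<le> F"
  shows "split_force f j absolutely_integrable_on UNIV"
proof -
  obtain c where c: "c > 0" "\<And>x. norm x \<le> c * vn x" using is_norm_lower[OF N(1)] by blast
  let ?t = "\<tau> j"
  have j: "grid_index \<tau> ?t = j" using tau_step[of j] by (intro grid_index_eq) auto
  have "(\<lambda>s. Z ?t 0 *v split_force f j s) absolutely_integrable_on UNIV"
  proof (rule locally_integrable_dominated)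
    show "locally_integrable (\<lambda>s. Z ?t 0 *v split_force f j s)"
      by (intro locally_integrable_matrix_vector locally_integrable_split_force f)
    show "(\<lambda>s. c * (K * R * F) * step_weight \<alpha> ?t s) integrable_on UNIV"
      by (intro integrable_on_mult_right step_weight_integral(1)[OF alpha_pos])
    fix s
    have "norm (Z ?t 0 *v split_force f j s) \<le> c * vn (Zp ?t (node s) *v (Phi M (node s) s *v f s))"
      using c(2) transported_eq[of ?t s f] unfolding j by simp
    also have "\<dots> \<le> c * (K * R * step_weight \<alpha> ?t s * F)"
    proof (intro mult_left_mono order_trans[OF transported_bound])
      show "0 \<le> K * R * step_weight \<alpha> ?t s" using K_ge_1 R_ge_1 by (auto simp: step_weight_def Let_def)
    qed (use c F in auto)
    finally show "norm (Z ?t 0 *v split_force f j s) \<le> c * (K * R * F) * step_weight \<alpha> ?t s" by (simp add: mult_ac)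
  qed
  then have "(\<lambda>s. Z 0 ?t *v (Z ?t 0 *v split_force f j s)) absolutely_integrable_on UNIV"
    by (rule absolutely_integrable_matrix_vector)
  then show ?thesis by (simp add: matrix_vector_mul_assoc Z_trans Z_self)
qed

lemma local_force_integral:
  assumes f: "locally_integrable f"
  shows "(\<lambda>s. local_kernel t s *v f s) absolutely_integrable_on UNIV"
    and "integral UNIV (\<lambda>s. local_kernel t s *v f s) =
      oriented_integral (\<zeta> (grid_index \<tau> t)) t (\<lambda>s. Phi M t s *v f s)"
proof -
  let ?c = "\<zeta> (grid_index \<tau> t)"
  let ?f = "\<lambda>s. Phi M t s *v f s"
  have i: "?f absolutely_integrable_on {a..b}" for a b by (intro Phi_force_integrable locally_integrableD f)
  have *: "(\<lambda>s. local_kernel t s *v f s) absolutely_integrable_on UNIV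
    \<and> integral UNIV (\<lambda>s. local_kernel t s *v f s) = oriented_integral ?c t ?f"
  proof (cases "?c \<le> t")
    case True
    have eq: "(if s \<in> {?c..t} then ?f s else 0) = local_kernel t s *v f s" if "s \<in> UNIV - {t}" for s
      using True that by (auto simp: local_kernel_def Let_def)
    have "(\<lambda>s. if s \<in> {?c..t} then ?f s else 0) absolutely_integrable_on UNIV"
      unfolding absolutely_integrable_restrict_UNIV by (rule i)
    then have 1: "(\<lambda>s. local_kernel t s *v f s) absolutely_integrable_on UNIV"
      by (rule absolutely_integrable_spike[of _ _ "{t}"]) (use eq in auto)
    have "integral UNIV (\<lambda>s. local_kernel t s *v f s) = integral UNIV (\<lambda>s. if s \<in> {?c..t} then ?f s else 0)"
      by (rule integral_spike[of "{t}"]) (use eq in auto)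
    also have "\<dots> = integral {?c..t} ?f" by (rule integral_restrict_UNIV)
    finally show ?thesis using 1 True by (simp add: oriented_integral_def)
  next
    case False
    have eq: "(if s \<in> {t..?c} then - ?f s else 0) = local_kernel t s *v f s" if "s \<in> UNIV - {?c}" for s
      using False that by (auto simp: local_kernel_def Let_def matrix_vector_neg_left)
    have "(\<lambda>s. - ?f s) absolutely_integrable_on {t..?c}"
      using i[of t ?c] by (auto simp: absolutely_integrable_on_def intro: integrable_neg)
    then have "(\<lambda>s. if s \<in> {t..?c} then - ?f s else 0) absolutely_integrable_on UNIV"
      unfolding absolutely_integrable_restrict_UNIV .
    then have 1: "(\<lambda>s. local_kernel t s *v f s) absolutely_integrable_on UNIV"
      by (rule absolutely_integrable_spike[of _ _ "{?c}"]) (use eq in auto)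
    have "integral UNIV (\<lambda>s. local_kernel t s *v f s) = integral UNIV (\<lambda>s. if s \<in> {t..?c} then - ?f s else 0)"
      by (rule integral_spike[of "{?c}"]) (use eq in auto)
    also have "\<dots> = integral {t..?c} (\<lambda>s. - ?f s)" by (rule integral_restrict_UNIV)
    also have "\<dots> = - integral {t..?c} ?f" by simp
    finally show ?thesis using 1 False by (simp add: oriented_integral_def)
  qed
  from * show "(\<lambda>s. local_kernel t s *v f s) absolutely_integrable_on UNIV" by simp
  from * show "integral UNIV (\<lambda>s. local_kernel t s *v f s) = oriented_integral ?c t ?f" by simp
qed

definition response :: "(real \<Rightarrow> real^'n) \<Rightarrow> real \<Rightarrow> real^'n" where
  "response f t = integral UNIV (\<lambda>s. G t s *v f s)"

lemma Green_split: "G t s *v f s = Z t 0 *v split_force f (grid_index \<tau> t) s + local_kernel t s *v f s"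
  unfolding Green_eq transported_eq[symmetric] by (simp add: matrix_vector_mult_add_rdistrib flip: matrix_vector_mul_assoc)

lemma Green_integrable:
  assumes f: "locally_integrable f" and F: "\<And>s. vn (f s) \<le> F"
  shows "(\<lambda>s. G t s *v f s) absolutely_integrable_on UNIV"
  unfolding Green_split
  by (intro set_integral_add absolutely_integrable_matrix_vector absolutely_integrable_split_force[OF f F] local_force_integral(1)[OF f])

lemma response_bound:
  assumes f: "locally_integrable f" and F: "\<And>s. vn (f s) \<le> F"
  shows "vn (response f t) \<le> 2 * K * (R * exp (\<alpha> * \<theta>)) / \<alpha> * F"
proof -
  have F0: "0 \<le> F" using F[of 0] is_norm_ge_0[OF N(1), of "f 0"] by linarith
  have "vn (response f t) \<le> integral UNIV (\<lambda>s. green_weight t s * F)"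
    unfolding response_def
  proof (rule is_norm_integral_le[OF N(1)])
    show "(\<lambda>s. G t s *v f s) integrable_on UNIV"
      using Green_integrable[OF f F] by (simp add: absolutely_integrable_on_def)
    show "(\<lambda>s. green_weight t s * F) integrable_on UNIV"
      by (intro integrable_on_mult_left green_weight_integral)
    fix s
    have "0 \<le> green_weight t s" using K_ge_1 R_ge_1 by (auto simp: green_weight_def step_weight_def Let_def)
    then show "vn (G t s *v f s) \<le> green_weight t s * F"
      using Green_bound[of t s "f s"] F[of s] by (meson mult_left_mono order_trans)
  qed
  also have "\<dots> = integral UNIV (green_weight t) * F" by simp
  also have "\<dots> \<le> 2 * K * (R * exp (\<alpha> * \<theta>)) / \<alpha> * F"
    by (intro mult_right_mono green_weight_integral F0)
  finally show ?thesis .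
qed

text \<open>
  On the \<open>j\<close>-th cell the response is \<open>Z(t,0) c\<^sub>j\<close> plus the local integral from \<open>\<zeta>\<^sub>j\<close> to \<open>t\<close>, so that its value at
  \<open>\<zeta>\<^sub>j\<close> is \<open>Z(\<zeta>\<^sub>j,0) c\<^sub>j\<close> and the formula of \<open>solves_iff\<close> follows. The point to check is the right end of the cell,
  where the formula of the next cell is in force: by \<open>jump\<close>, the difference \<open>c\<^sub>j\<^sub>+\<^sub>1 - c\<^sub>j\<close> is the force on
  \<open>[\<zeta>\<^sub>j, \<zeta>\<^sub>j\<^sub>+\<^sub>1]\<close>, carried through the common node, and this accounts for the change of base point in the local
  integral.
\<close>
lemma response_solves:
  assumes f: "locally_integrable f" and F: "\<And>s. vn (f s) \<le> F"
  shows "solves f (response f)"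
proof -
  let ?f = "\<lambda>t s. Phi M t s *v f s"
  have fi: "?f t integrable_on {a..b}" for t a b
    using Phi_force_integrable[OF locally_integrableD[OF f]] by (simp add: absolutely_integrable_on_def)
  have si: "split_force f j integrable_on UNIV" for j
    using absolutely_integrable_split_force[OF f F] by (simp add: absolutely_integrable_on_def)
  define c where "c j = integral UNIV (split_force f j)" for j
  have resp: "response f t = Z t 0 *v c j + oriented_integral (\<zeta> j) t (?f t)"
    if t: "\<tau> j \<le> t" "t < \<tau> (j + 1)" for j t
  proof -
    have j: "grid_index \<tau> t = j" using t by (rule grid_index_eq)
    have 1: "(\<lambda>s. Z t 0 *v split_force f j s) integrable_on UNIV"
      using absolutely_integrable_matrix_vector[OF absolutely_integrable_split_force[OF f F], where A = "Z t 0"]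
      by (simp add: absolutely_integrable_on_def)
    have 2: "(\<lambda>s. local_kernel t s *v f s) integrable_on UNIV"
      using local_force_integral(1)[OF f] by (simp add: absolutely_integrable_on_def)
    show ?thesis
      unfolding response_def Green_split j integral_add[OF 1 2] local_force_integral(2)[OF f] integral_matrix_vector[OF si] c_def ..
  qed
  have jump: "c (j + 1) - c j = Z 0 (\<tau> (j + 1)) *v integral {\<zeta> j..\<zeta> (j + 1)} (?f (\<tau> (j + 1)))" for j
  proof -
    let ?q = "\<tau> (j + 1)"
    have "c (j + 1) - c j = integral UNIV (\<lambda>s. split_force f (j + 1) s - split_force f j s)"
      unfolding c_def by (rule integral_diff[OF si si, symmetric])
    also have "\<dots> = integral UNIV (\<lambda>s. if s \<in> {\<zeta> j..\<zeta> (j + 1)} then Z 0 ?q *v ?f ?q s else 0)"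
    proof (rule integral_spike[of "{\<zeta> (j + 1)}"])
      fix s assume s: "s \<in> UNIV - {\<zeta> (j + 1)}"
      consider "s < \<zeta> j" | "\<zeta> j \<le> s" "s < \<zeta> (j + 1)" | "\<zeta> (j + 1) < s" using s by force
      then show "(if s \<in> {\<zeta> j..\<zeta> (j + 1)} then Z 0 ?q *v ?f ?q s else 0) = split_force f (j + 1) s - split_force f j s"
        using zeta_mono[of j "j + 1"]
      proof cases
        case 2
        have "P *v v + (mat 1 - P) *v v = v" for v by (simp add: matrix_vector_mult_diff_rdistrib)
        then show ?thesis using 2 node_eq[OF 2] by (simp add: split_force_def pulled_back_def)
      qed (auto simp: split_force_def)
    qed simp
    also have "\<dots> = integral {\<zeta> j..\<zeta> (j + 1)} (\<lambda>s. Z 0 ?q *v ?f ?q s)" by (rule integral_restrict_UNIV)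
    also have "\<dots> = Z 0 ?q *v integral {\<zeta> j..\<zeta> (j + 1)} (?f ?q)" by (rule integral_matrix_vector[OF fi])
    finally show ?thesis .
  qed
  have closed: "response f t = Z t 0 *v c j + oriented_integral (\<zeta> j) t (?f t)" if t: "t \<in> cell j" for j t
  proof (cases "t = \<tau> (j + 1)")
    case True
    have "c (j + 1) = c j + Z 0 t *v integral {\<zeta> j..\<zeta> (j + 1)} (?f t)" using jump[of j] True by (simp add: algebra_simps)
    then have 1: "Z t 0 *v c (j + 1) = Z t 0 *v c j + integral {\<zeta> j..\<zeta> (j + 1)} (?f t)"
      by (simp add: matrix_vector_right_distrib matrix_vector_mul_assoc Z_trans Z_self)
    have o: "\<zeta> j \<le> t" "t \<le> \<zeta> (j + 1)" using zeta_le_tau[of j] tau_le_zeta[of "j + 1"] True by auto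
    have 2: "integral {\<zeta> j..t} (?f t) + integral {t..\<zeta> (j + 1)} (?f t) = integral {\<zeta> j..\<zeta> (j + 1)} (?f t)"
      using o by (intro Henstock_Kurzweil_Integration.integral_combine fi) auto
    have "response f t = Z t 0 *v c (j + 1) + oriented_integral (\<zeta> (j + 1)) t (?f t)"
      by (rule resp) (use True tau_step[of "j + 1"] in auto)
    also have "oriented_integral (\<zeta> (j + 1)) t (?f t) = - integral {t..\<zeta> (j + 1)} (?f t)"
      using o by (auto simp: oriented_integral_def)
    also have "Z t 0 *v c (j + 1) + - integral {t..\<zeta> (j + 1)} (?f t) = Z t 0 *v c j + integral {\<zeta> j..t} (?f t)"
      unfolding 1 2[symmetric] by simp
    finally show ?thesis using o by (simp add: oriented_integral_def)
  qed (use resp t in auto)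
  have EZ: "Z t (\<zeta> j) = E j t" if "t \<in> cell j" for t j
  proof -
    have "E j (\<zeta> j) = mat 1" by (simp add: E_mat_def Phi_self[OF M] oriented_integral_def)
    moreover have "matrix_inv (mat 1 :: real^'n^'n) = mat 1" by (rule matrix_inv_eqI) simp
    ultimately show ?thesis by (simp add: Z_cell[OF that zeta_mem])
  qed
  show ?thesis
    unfolding solves_iff[OF f]
  proof (intro allI ballI)
    fix j t assume t: "t \<in> cell j"
    have "response f (\<zeta> j) = Z (\<zeta> j) 0 *v c j"
      using closed[OF zeta_mem[of j]] by (simp add: oriented_integral_def)
    then have "E j t *v response f (\<zeta> j) = Z t 0 *v c j"
      by (simp add: EZ[OF t, symmetric] matrix_vector_mul_assoc Z_trans)
    then show "response f t = E j t *v response f (\<zeta> j) + oriented_integral (\<zeta> j) t (?f t)"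
      using closed[OF t] by simp
  qed
qed

lemma solves_diff:
  assumes "solves f z" "solves f w"
  shows "solves (\<lambda>_. 0) (\<lambda>t. z t - w t)"
  unfolding solves_def primitive_on_def
proof (intro ballI impI)
  fix a b :: real assume "a \<le> b"
  then have "((\<lambda>s. (M s *v z s + M0 s *v z (\<gamma> s) + f s) - (M s *v w s + M0 s *v w (\<gamma> s) + f s))
      has_integral ((z b - z a) - (w b - w a))) {a..b}"
    using assms unfolding solves_def primitive_on_def by (intro has_integral_diff) auto
  then show "((\<lambda>s. M s *v (z s - w s) + M0 s *v (z (\<gamma> s) - w (\<gamma> s)) + 0)
      has_integral (z b - w b - (z a - w a))) {a..b}"
    by (simp add: matrix_vector_mult_diff_distrib algebra_simps)
qed

lemma bounded_solution_eq_response: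
  assumes f: "locally_integrable f" and F: "\<And>s. vn (f s) \<le> F"
    and z: "solves f z" and B: "\<And>t. vn (z t) \<le> B"
  shows "z = response f"
proof -
  have "vn (z t - response f t) \<le> B + 2 * K * (R * exp (\<alpha> * \<theta>)) / \<alpha> * F" for t
    using is_norm_diff[OF N(1), of "z t" "response f t"] B[of t] response_bound[OF f F, of t] by linarith
  from bounded_homogeneous_solution_zero[OF solves_diff[OF z response_solves[OF f F]] this]
  show ?thesis by (auto simp: fun_eq_iff)
qed

lemma response_diff:
  assumes "locally_integrable f" "\<And>s. vn (f s) \<le> F" "locally_integrable g" "\<And>s. vn (g s) \<le> F'"
  shows "response f t - response g t = response (\<lambda>s. f s - g s) t"
  using Green_integrable[OF assms(1,2), of t] Green_integrable[OF assms(3,4), of t]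
  by (simp add: response_def matrix_vector_mult_diff_distrib absolutely_integrable_on_def integral_diff)

end

section \<open>Pointwise and Caratheodory solutions\<close>

context time_grid
begin

lemma pointwise_imp_primitive_on_cells:
  fixes z :: "real \<Rightarrow> 'a::euclidean_space"
  assumes z: "continuous_on UNIV z"
    and d: "\<And>i t. t \<in> {\<tau> i<..<\<tau> (i + 1)} \<Longrightarrow> (z has_vector_derivative g t) (at t)"
  shows "primitive_on UNIV z g"
proof (rule primitive_on_cells)
  fix j
  show "primitive_on (cell j) z g"
    unfolding primitive_on_def
  proof (intro ballI impI)
    fix a b assume ab: "a \<in> cell j" "b \<in> cell j" "a \<le> b"
    show "(g has_integral (z b - z a)) {a..b}"
      using ab continuous_on_subset[OF z]
      by (intro fundamental_theorem_of_calculus_interior d[of _ j]) auto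
  qed
qed

text \<open>
  On a closed cell the integrand becomes continuous once its value at the right end is replaced by the left limit.
  This changes the integral nowhere, and the fundamental theorem of calculus applies up to both ends.
\<close>
lemma primitive_one_sided_derivatives:
  fixes z :: "real \<Rightarrow> 'a::euclidean_space"
  assumes z: "primitive_on UNIV z g" and g: "grid_continuous \<tau> g"
  shows "t \<in> {\<tau> i<..<\<tau> (i + 1)} \<Longrightarrow> (z has_vector_derivative g t) (at t)"
    and "(z has_vector_derivative g (\<tau> i)) (at_right (\<tau> i))"
    and "\<exists>d. (z has_vector_derivative d) (at_left (\<tau> i))"
proof -
  have main: "\<exists>L. \<forall>t\<in>cell i. (z has_vector_derivative (if t = \<tau> (i + 1) then L else g t)) (at t within cell i)" for i
  proof -
    obtain L where cg: "continuous_on {\<tau> i..<\<tau> (i + 1)} g" and L: "(g \<longlongrightarrow> L) (at_left (\<tau> (i + 1)))"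
      using g unfolding grid_continuous_def by blast
    let ?g = "\<lambda>t. if t = \<tau> (i + 1) then L else g t"
    have cont: "continuous_on (cell i) ?g"
      unfolding continuous_on_def
    proof
      fix t assume t: "t \<in> cell i"
      show "(?g \<longlongrightarrow> ?g t) (at t within cell i)"
      proof (cases "t = \<tau> (i + 1)")
        case True
        have "(?g \<longlongrightarrow> L) (at_left (\<tau> (i + 1)))"
          by (rule Lim_transform_eventually[OF L]) (auto simp: eventually_at_filter)
        then show ?thesis using True tau_step[of i] by (simp add: at_within_Icc_at_left)
      next
        case False
        then have "(g \<longlongrightarrow> g t) (at t within {\<tau> i..<\<tau> (i + 1)})"
          using cg t unfolding continuous_on_def by auto
        moreover have "at t within {\<tau> i..<\<tau> (i + 1)} = at t within cell i"
          by (rule at_within_nhd[of t "{..<\<tau> (i + 1)}"]) (use False t in auto)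
        ultimately have "(g \<longlongrightarrow> g t) (at t within cell i)" by simp
        moreover have "eventually (\<lambda>s. s \<noteq> \<tau> (i + 1)) (at t within cell i)"
          using t1_space_nhds[OF False] by (auto simp: eventually_at_filter elim: eventually_mono)
        then have "eventually (\<lambda>s. g s = ?g s) (at t within cell i)" by (rule eventually_mono) simp
        ultimately have "(?g \<longlongrightarrow> g t) (at t within cell i)" by (rule Lim_transform_eventually)
        then show ?thesis using False by simp
      qed
    qed
    have "primitive_on (cell i) z g" by (rule primitive_on_subset[OF z]) simp
    then have p: "primitive_on (cell i) z ?g"
      by (subst primitive_on_spike[of "{\<tau> (i + 1)}" _ _ _ g]) auto
    show ?thesis
    proof (intro exI ballI)
      fix t assume t: "t \<in> cell i"
      have "((\<lambda>u. z (\<tau> i) + integral {\<tau> i..u} ?g) has_vector_derivative ?g t) (at t within cell i)"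
        using integral_has_vector_derivative[OF cont t]
        by (auto intro!: derivative_eq_intros)
      then show "(z has_vector_derivative ?g t) (at t within cell i)"
      proof (rule has_vector_derivative_transform[OF t, rotated])
        fix u assume u: "u \<in> cell i"
        have "(?g has_integral (z u - z (\<tau> i))) {\<tau> i..u}" by (rule primitive_onD[OF p]) (use u in auto)
        then show "z u = z (\<tau> i) + integral {\<tau> i..u} ?g" by (simp add: has_integral_iff)
      qed
    qed
  qed
  show "(z has_vector_derivative g t) (at t)" if t: "t \<in> {\<tau> i<..<\<tau> (i + 1)}"
  proof -
    obtain L where L: "\<forall>t\<in>cell i. (z has_vector_derivative (if t = \<tau> (i + 1) then L else g t)) (at t within cell i)"
      using main by blast
    have t': "t \<in> cell i" "t \<noteq> \<tau> (i + 1)" using t by auto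
    then have "(z has_vector_derivative g t) (at t within cell i)" using bspec[OF L t'(1)] by simp
    then show ?thesis using t by (simp add: at_within_Icc_at)
  qed
  show "(z has_vector_derivative g (\<tau> i)) (at_right (\<tau> i))"
  proof -
    obtain L where L: "\<forall>t\<in>cell i. (z has_vector_derivative (if t = \<tau> (i + 1) then L else g t)) (at t within cell i)"
      using main by blast
    have t': "\<tau> i \<in> cell i" "\<tau> i \<noteq> \<tau> (i + 1)" using tau_step[of i] by auto
    then have "(z has_vector_derivative g (\<tau> i)) (at (\<tau> i) within cell i)" using bspec[OF L t'(1)] by simp
    then show ?thesis using tau_step[of i] by (simp add: at_within_Icc_at_right)
  qed
  show "\<exists>d. (z has_vector_derivative d) (at_left (\<tau> i))"
  proof -
    obtain L where L: "\<forall>t\<in>cell (i - 1). (z has_vector_derivative (if t = \<tau> (i - 1 + 1) then L else g t)) (at t within cell (i - 1))"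
      using main by blast
    have "(z has_vector_derivative L) (at (\<tau> i) within cell (i - 1))"
      using bspec[OF L, of "\<tau> i"] tau_step[of "i - 1"] by simp
    then show ?thesis using tau_step[of "i - 1"] by (auto simp: at_within_Icc_at_left)
  qed
qed

text \<open>
  Continuity of \<open>h\<close> in time for frozen arguments suffices: by the Lipschitz condition, moving the argument along the
  continuous function \<open>z\<close> perturbs \<open>h\<close> by a quantity that tends to 0.
\<close>
lemma grid_continuous_rhs:
  fixes vn :: "real^'n \<Rightarrow> real"
  assumes vn: "is_norm vn" and l: "l > 0"
    and lip: "\<And>t z w z' w'. vn (h t z w - h t z' w') \<le> l * (vn (z - z') + vn (w - w'))"
    and M: "grid_continuous \<tau> M" and M0: "grid_continuous \<tau> M0" and h: "\<And>x y. grid_continuous \<tau> (\<lambda>t. h t x y)"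
    and z: "continuous_on UNIV z"
  shows "grid_continuous \<tau> (depcag_rhs \<gamma> M M0 h z)"
proof -
  obtain c where c: "c > 0" "\<And>x. norm x \<le> c * vn x" using is_norm_lower[OF vn] by blast
  have h_lim: "((\<lambda>s. h s (z s) v) \<longlongrightarrow> L) F" if 1: "((\<lambda>s. h s x v) \<longlongrightarrow> L) F" and 2: "(z \<longlongrightarrow> x) F" for x v L and F
  proof -
    have "((\<lambda>s. z s - x) \<longlongrightarrow> x - x) F" by (intro tendsto_diff 2 tendsto_const)
    then have "((\<lambda>s. vn (z s - x)) \<longlongrightarrow> vn (x - x)) F"
      by (rule continuous_on_tendsto_compose[OF continuous_on_is_norm[OF vn, of UNIV]]) auto
    then have "((\<lambda>s. c * (l * vn (z s - x))) \<longlongrightarrow> c * (l * vn (x - x))) F"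
      by (intro tendsto_mult tendsto_const)
    then have lim: "((\<lambda>s. c * (l * vn (z s - x))) \<longlongrightarrow> 0) F" by (simp add: is_norm_zero[OF vn])
    have le: "norm (h s (z s) v - h s x v) \<le> c * (l * vn (z s - x))" for s
    proof -
      have "norm (h s (z s) v - h s x v) \<le> c * vn (h s (z s) v - h s x v)" by (rule c)
      also have "\<dots> \<le> c * (l * vn (z s - x))"
        using lip[of s "z s" v x v] c(1) by (intro mult_left_mono) (auto simp: is_norm_zero[OF vn])
      finally show ?thesis .
    qed
    have "((\<lambda>s. h s (z s) v - h s x v) \<longlongrightarrow> 0) F"
      by (rule Lim_null_comparison[OF always_eventually lim]) (simp add: le)
    from tendsto_add[OF this 1] show ?thesis by simp
  qed
  have zt: "(z \<longlongrightarrow> z t) (at t within S)" for t S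
    by (rule tendsto_within_subset[OF bspec[OF z[unfolded continuous_on_def] UNIV_I] subset_UNIV])
  interpret mv: bounded_bilinear "(*v) :: real^'n^'n \<Rightarrow> real^'n \<Rightarrow> real^'n"
    using bilinear_matrix_vector_mult by (simp add: bilinear_conv_bounded_bilinear)
  show ?thesis
    unfolding grid_continuous_def
  proof (intro allI conjI)
    fix i
    let ?S = "{\<tau> i..<\<tau> (i + 1)}" and ?v = "z (\<zeta> i)"
    let ?g = "\<lambda>s. M s *v z s + M0 s *v ?v + h s (z s) ?v"
    have eq: "depcag_rhs \<gamma> M M0 h z s = ?g s" if "s \<in> ?S" for s
      using that gamma_eq[of i s] by (simp add: depcag_rhs_def)
    have cM: "continuous_on ?S M" "continuous_on ?S M0" "continuous_on ?S (\<lambda>s. h s x ?v)" for x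
      using M M0 h[of x ?v] by (auto simp: grid_continuous_def)
    have "continuous_on ?S ?g"
      unfolding continuous_on_def
    proof
      fix t assume t: "t \<in> ?S"
      have lims: "(M \<longlongrightarrow> M t) (at t within ?S)" "(M0 \<longlongrightarrow> M0 t) (at t within ?S)"
        "((\<lambda>s. h s (z t) ?v) \<longlongrightarrow> h t (z t) ?v) (at t within ?S)"
        using cM t unfolding continuous_on_def by blast+
      show "(?g \<longlongrightarrow> ?g t) (at t within ?S)"
        by (intro tendsto_add mv.tendsto lims(1,2) h_lim[OF lims(3) zt] zt tendsto_const)
    qed
    then show "continuous_on ?S (depcag_rhs \<gamma> M M0 h z)" by (rule continuous_on_eq) (simp add: eq)
    let ?q = "\<tau> (i + 1)"
    obtain LM LM0 Lh where L: "(M \<longlongrightarrow> LM) (at_left ?q)" "(M0 \<longlongrightarrow> LM0) (at_left ?q)" "((\<lambda>s. h s (z ?q) ?v) \<longlongrightarrow> Lh) (at_left ?q)"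
      using M M0 h[of "z ?q" ?v] unfolding grid_continuous_def by blast
    have "(?g \<longlongrightarrow> LM *v z ?q + LM0 *v ?v + Lh) (at_left ?q)"
      by (intro tendsto_add mv.tendsto L(1,2) h_lim[OF L(3) zt] zt tendsto_const)
    moreover have "eventually (\<lambda>s. s \<in> {\<tau> i<..<?q}) (at_left ?q)"
      using tau_step[of i] by (rule eventually_at_leftI[rotated]) auto
    then have "eventually (\<lambda>s. ?g s = depcag_rhs \<gamma> M M0 h z s) (at_left ?q)"
      by (rule eventually_mono) (use eq in auto)
    ultimately show "\<exists>l. (depcag_rhs \<gamma> M M0 h z \<longlongrightarrow> l) (at_left ?q)"
      by (intro exI) (rule Lim_transform_eventually)
  qed
qed

end

section \<open>The nonlinear equation\<close>

text \<open>
  For \<open>d = 0\<close> the right-hand side is \<open>\<infinity>\<close>, since the inverse of 0 is \<open>\<infinity>\<close> in the extended reals.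
\<close>
lemma ereal_le_times_inverse:
  assumes "v * d \<le> c" "0 \<le> d" "0 < c"
  shows "ereal v \<le> ereal c * inverse (ereal d)"
proof (cases "d = 0")
  case True
  then show ?thesis using assms(3) by simp
next
  case False
  then show ?thesis using assms by (simp add: field_simps)
qed

lemma tendsto_divide_2_power: "(\<lambda>n. a / 2 ^ n) \<longlonglongrightarrow> (0 :: real)"
  using tendsto_mult[OF tendsto_const[of a] LIMSEQ_power_zero[of "1/2 :: real"]] by (simp add: power_divide)

locale small_depcag = dichotomic_depcag \<tau> \<zeta> \<gamma> \<theta> vn mn M M0 P K \<alpha>
  for \<tau> \<zeta> :: "int \<Rightarrow> real" and \<gamma> :: "real \<Rightarrow> real" and \<theta> :: real
    and vn :: "real^'n \<Rightarrow> real" and mn :: "real^'n^'n \<Rightarrow> real" and M M0 :: "real \<Rightarrow> real^'n^'n"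
    and P :: "real^'n^'n" and K \<alpha> :: real +
  fixes h :: "real \<Rightarrow> real^'n \<Rightarrow> real^'n \<Rightarrow> real^'n" and r \<mu> l \<rho>s :: real
  assumes B: "condition_B vn \<gamma> M M0 h r \<mu> l"
    and rho_star: "\<rho>s = rho mn \<tau> \<zeta> M * exp (\<alpha> * \<theta>)"
    and small1: "8 * K * l * \<rho>s * inverse \<alpha> \<le> 1"
    and small2: "4 * K * r * \<rho>s * inverse \<alpha> \<le> 1"
begin

definition forcing :: "(real \<Rightarrow> real^'n) \<Rightarrow> real \<Rightarrow> real^'n" where
  "forcing z t = h t (z t) (z (\<gamma> t))"

definition vbounded :: "(real \<Rightarrow> real^'n) \<Rightarrow> bool" where
  "vbounded z \<longleftrightarrow> (\<exists>D. \<forall>t. vn (z t) \<le> D)"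

lemma vbounded_iff: "vbounded z \<longleftrightarrow> bounded (range z)"
proof -
  obtain c where c: "c > 0" "\<And>x. norm x \<le> c * vn x" using is_norm_lower[OF N(1)] by blast
  obtain c' where c': "c' > 0" "\<And>x. vn x \<le> c' * norm x" using is_norm_upper[OF N(1)] by blast
  show ?thesis
  proof
    assume "vbounded z"
    then obtain D where "vn (z t) \<le> D" for t by (auto simp: vbounded_def)
    then have "norm (z t) \<le> c * D" for t using c by (meson mult_left_mono less_imp_le order_trans)
    then show "bounded (range z)" by (auto simp: bounded_iff)
  next
    assume "bounded (range z)"
    then obtain D where "norm (z t) \<le> D" for t by (auto simp: bounded_iff)
    then have "vn (z t) \<le> c' * D" for t using c' by (meson mult_left_mono less_imp_le order_trans)
    then show "vbounded z" by (auto simp: vbounded_def)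
  qed
qed

lemma r_pos: "r > 0" and mu_pos: "\<mu> > 0" and l_pos: "l > 0"
  and growth: "vn (h t x y) \<le> r * (vn x + vn y) + \<mu>"
  and lipschitz: "vn (h t x y - h t x' y') \<le> l * (vn (x - x') + vn (y - y'))"
  using B unfolding condition_B_def by simp_all

lemma forcing_integrable: assumes "continuous_on UNIV z" shows "locally_integrable (forcing z)"
proof -
  have "\<forall>z. continuous_on UNIV z \<longrightarrow> locally_integrable (\<lambda>t. h t (z t) (z (\<gamma> t)))"
    using B unfolding condition_B_def by (elim conjE)
  then show ?thesis using assms unfolding forcing_def[abs_def] by simp
qed

text \<open>
  The bound \<open>2 K \<rho>\<^sup>* / \<alpha>\<close> for the response to a force of norm at most 1.
\<close>
abbreviation kappa :: real where "kappa \<equiv> 2 * K * \<rho>s / \<alpha>"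

lemma rho_pos: "\<rho>s > 0"
  using R_ge_1 by (simp add: rho_star)

lemma kappa_l: "kappa * (2 * l) \<le> 1 / 2"
  using small1 by (simp add: field_simps)

lemma forcing_bound: "(\<And>t. vn (z t) \<le> D) \<Longrightarrow> vn (forcing z t) \<le> 2 * r * D + \<mu>"
proof -
  assume D: "\<And>t. vn (z t) \<le> D"
  have "r * (vn (z t) + vn (z (\<gamma> t))) \<le> r * (D + D)" using D r_pos by (intro mult_left_mono add_mono) auto
  then show ?thesis unfolding forcing_def using growth[of t "z t" "z (\<gamma> t)"] by simp
qed

definition picard :: "(real \<Rightarrow> real^'n) \<Rightarrow> real \<Rightarrow> real^'n" where
  "picard z = response (forcing z)"

lemma picard_bound:
  assumes "continuous_on UNIV z" "\<And>t. vn (z t) \<le> D"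
  shows "vn (picard z t) \<le> kappa * (2 * r * D + \<mu>)"
  using response_bound[OF forcing_integrable[OF assms(1)] forcing_bound[OF assms(2)], of t]
  by (simp add: picard_def rho_star)

lemma picard_solves:
  assumes z: "continuous_on UNIV z" "vbounded z"
  shows "solves (forcing z) (picard z)"
proof -
  obtain D where "vn (z t) \<le> D" for t using z(2) by (auto simp: vbounded_def)
  from response_solves[OF forcing_integrable[OF z(1)] forcing_bound[OF this]] show ?thesis
    by (simp add: picard_def)
qed

lemma solves_continuous: "solves f z \<Longrightarrow> continuous_on UNIV z"
  unfolding solves_def by (rule primitive_on_UNIV_continuous)

lemma picard_continuous: "continuous_on UNIV z \<Longrightarrow> vbounded z \<Longrightarrow> continuous_on UNIV (picard z)"
  by (rule solves_continuous[OF picard_solves])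

lemma picard_vbounded:
  assumes z: "continuous_on UNIV z" "vbounded z"
  shows "vbounded (picard z)"
proof -
  obtain D where "vn (z t) \<le> D" for t using z(2) by (auto simp: vbounded_def)
  from picard_bound[OF z(1) this] show ?thesis unfolding vbounded_def by (intro exI allI)
qed

text \<open>
  A change of \<open>z\<close> by at most \<open>D\<close> changes the force by at most \<open>2 l D\<close>, and \<open>kappa * 2 l \<le> 1 / 2\<close>.
\<close>
lemma picard_contraction:
  assumes z: "continuous_on UNIV z" "vbounded z" and w: "continuous_on UNIV w" "vbounded w"
    and D: "\<And>t. vn (z t - w t) \<le> D"
  shows "vn (picard z t - picard w t) \<le> D / 2"
proof -
  have D0: "D \<ge> 0" using D[of 0] is_norm_ge_0[OF N(1), of "z 0 - w 0"] by linarith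
  obtain Dz Dw where b: "\<And>t. vn (z t) \<le> Dz" "\<And>t. vn (w t) \<le> Dw" using z w by (auto simp: vbounded_def)
  have diff: "vn (forcing z s - forcing w s) \<le> 2 * l * D" for s
  proof -
    have "l * (vn (z s - w s) + vn (z (\<gamma> s) - w (\<gamma> s))) \<le> l * (D + D)"
      using D l_pos by (intro mult_left_mono add_mono) auto
    then show ?thesis unfolding forcing_def using lipschitz[of s "z s" "z (\<gamma> s)" "w s" "w (\<gamma> s)"] by simp
  qed
  have "vn (picard z t - picard w t) = vn (response (\<lambda>s. forcing z s - forcing w s) t)"
    unfolding picard_def
    by (subst response_diff[OF forcing_integrable[OF z(1)] forcing_bound[OF b(1)] forcing_integrable[OF w(1)] forcing_bound[OF b(2)]]) simp
  also have "\<dots> \<le> kappa * (2 * l * D)"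
    using response_bound[OF locally_integrable_diff[OF forcing_integrable[OF z(1)] forcing_integrable[OF w(1)]] diff, of t]
    by (simp add: rho_star mult_ac)
  also have "\<dots> = kappa * (2 * l) * D" by simp
  also have "\<dots> \<le> 1 / 2 * D" using kappa_l D0 by (rule mult_right_mono)
  finally show ?thesis by simp
qed

lemma fixed_point_unique:
  assumes z: "continuous_on UNIV z" "vbounded z" "picard z = z" and w: "continuous_on UNIV w" "vbounded w" "picard w = w"
  shows "w = z"
proof -
  obtain Dz Dw where b: "\<And>t. vn (z t) \<le> Dz" "\<And>t. vn (w t) \<le> Dw" using z w by (auto simp: vbounded_def)
  have "vn (w t - z t) \<le> (Dw + Dz) / 2 ^ n" for t n
  proof (induction n arbitrary: t)
    case 0
    show ?case using is_norm_diff[OF N(1), of "w t" "z t"] b(1)[of t] b(2)[of t] by simp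
  next
    case (Suc n)
    from picard_contraction[OF w(1,2) z(1,2) Suc, of t] show ?case by (simp add: z(3) w(3))
  qed
  moreover have "(\<lambda>n. (Dw + Dz) / 2 ^ n) \<longlonglongrightarrow> 0"
    by (rule tendsto_divide_2_power)
  ultimately have "vn (w t - z t) \<le> 0" for t by (intro LIMSEQ_le_const) auto
  then have "w t - z t = 0" for t using is_norm_pos[OF N(1), of "w t - z t"] by (meson not_le)
  then show ?thesis by (auto simp: fun_eq_iff)
qed

text \<open>
  The Picard iterates converge uniformly, as their consecutive distances halve. The argument is carried out for \<open>vn\<close>
  directly, since the contraction factor is not preserved under the passage to the Euclidean norm.
\<close>
lemma fixed_point_exists: "\<exists>z. continuous_on UNIV z \<and> vbounded z \<and> picard z = z"
proof -
  obtain c where c: "c > 0" "\<And>x. norm x \<le> c * vn x" using is_norm_lower[OF N(1)] by blast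
  define x where "x n = (picard ^^ n) (\<lambda>_. 0)" for n
  have x: "x 0 = (\<lambda>_. 0)" "x (Suc n) = picard (x n)" for n by (simp_all add: x_def)
  have good: "continuous_on UNIV (x n) \<and> vbounded (x n)" for n
  proof (induction n)
    case 0 show ?case by (auto simp: x vbounded_def is_norm_zero[OF N(1)])
  next
    case (Suc n) then show ?case by (simp add: x picard_continuous picard_vbounded)
  qed
  obtain D where D: "vn (x 1 t) \<le> D" for t using good[of 1] by (auto simp: vbounded_def)
  have D0: "D \<ge> 0" using D[of 0] is_norm_ge_0[OF N(1), of "x 1 0"] by linarith
  have step: "vn (x (Suc n) t - x n t) \<le> D / 2 ^ n" for n t
  proof (induction n arbitrary: t)
    case 0 show ?case using D[of t] by (simp add: x(1))
  next
    case (Suc n)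
    have "vn (picard (x (Suc n)) t - picard (x n) t) \<le> D / 2 ^ n / 2"
      using good by (intro picard_contraction Suc) auto
    then show ?case by (simp add: x(2))
  qed
  have dist: "vn (x (n + k) t - x n t) \<le> 2 * D / 2 ^ n - 2 * D / 2 ^ (n + k)" for n k t
  proof (induction k)
    case (Suc k)
    have "vn (x (n + Suc k) t - x n t) \<le> vn (x (Suc (n + k)) t - x (n + k) t) + vn (x (n + k) t - x n t)"
      using is_norm_triangle[OF N(1), of "x (Suc (n + k)) t - x (n + k) t" "x (n + k) t - x n t"] by simp
    also have "\<dots> \<le> D / 2 ^ (n + k) + (2 * D / 2 ^ n - 2 * D / 2 ^ (n + k))" by (intro add_mono step Suc)
    also have "\<dots> = 2 * D / 2 ^ n - 2 * D / 2 ^ (n + Suc k)"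
    proof -
      have "2 * D / 2 ^ (n + Suc k) = D / 2 ^ (n + k)" "2 * D / 2 ^ (n + k) = 2 * (D / 2 ^ (n + k))" by simp_all
      then show ?thesis by linarith
    qed
    finally show ?case .
  qed (simp add: is_norm_zero[OF N(1)])
  have dist': "vn (x m t - x n t) \<le> 2 * D / 2 ^ n" if nm: "n \<le> m" for m n t
  proof -
    obtain k where m: "m = n + k" using le_Suc_ex[OF nm] by blast
    have "0 \<le> 2 * D / 2 ^ (n + k)" using D0 by simp
    then show ?thesis using dist[of n k t] unfolding m by linarith
  qed
  have "uniformly_Cauchy_on UNIV x"
  proof (rule uniformly_Cauchy_onI')
    fix e :: real assume e: "e > 0"
    obtain n where n: "c * (2 * D) / 2 ^ n < e"
      using order_tendstoD(2)[OF tendsto_divide_2_power[of "c * (2 * D)"] e] by (auto simp: eventually_sequentially)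
    show "\<exists>n. \<forall>t\<in>UNIV. \<forall>m\<ge>n. \<forall>k>m. dist (x m t) (x k t) < e"
    proof (intro exI ballI allI impI)
      fix t and m k :: nat assume mk: "n \<le> m" "m < k"
      have "norm (x k t - x m t) \<le> c * vn (x k t - x m t)" by (rule c)
      also have "\<dots> \<le> c * (2 * D / 2 ^ m)" using mk c(1) by (intro mult_left_mono dist') auto
      also have "\<dots> \<le> c * (2 * D / 2 ^ n)" using mk c(1) D0
        by (intro mult_left_mono divide_left_mono) (auto intro: power_increasing)
      also have "\<dots> < e" using n by simp
      finally show "dist (x m t) (x k t) < e" by (simp add: dist_norm norm_minus_commute)
    qed
  qed
  then obtain z where z: "uniform_limit UNIV x z sequentially"
    using Cauchy_uniformly_convergent uniformly_convergent_on_def by blast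
  have cz: "continuous_on UNIV z"
    using good by (intro uniform_limit_theorem[OF _ z]) auto
  have ptw: "(\<lambda>n. x n t) \<longlonglongrightarrow> z t" for t using tendsto_uniform_limitI[OF z] by auto
  have near: "vn (z t - x n t) \<le> 2 * D / 2 ^ n" for n t
  proof (rule LIMSEQ_le_const2)
    show "(\<lambda>m. vn (x m t - x n t)) \<longlonglongrightarrow> vn (z t - x n t)"
      by (intro continuous_on_tendsto_compose[OF continuous_on_is_norm[OF N(1), of UNIV]] tendsto_diff ptw tendsto_const) auto
    show "\<exists>M. \<forall>m\<ge>M. vn (x m t - x n t) \<le> 2 * D / 2 ^ n" using dist' by blast
  qed
  have bz: "vbounded z" unfolding vbounded_def using near[of _ 0] by (auto simp: x(1))
  have "vn (picard z t - z t) \<le> 4 * D / 2 ^ n" for n t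
  proof -
    have "vn (picard z t - picard (x n) t) \<le> 2 * D / 2 ^ n / 2"
      using good by (intro picard_contraction cz bz near) auto
    moreover have "vn (z t - x (Suc n) t) \<le> 2 * D / 2 ^ n / 2" using near[of t "Suc n"] by simp
    moreover have "vn (picard z t - z t) \<le> vn (picard z t - picard (x n) t) + vn (z t - picard (x n) t)"
      using is_norm_diff[OF N(1), of "picard z t - picard (x n) t" "z t - picard (x n) t"] by simp
    moreover have "0 \<le> D / 2 ^ n" using D0 by simp
    ultimately show ?thesis unfolding x(2) by linarith
  qed
  then have "vn (picard z t - z t) \<le> 0" for t by (intro LIMSEQ_le_const[OF tendsto_divide_2_power[of "4 * D"]]) auto
  then have "picard z t - z t = 0" for t using is_norm_pos[OF N(1), of "picard z t - z t"] by (meson not_le)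
  then show ?thesis using cz bz by (auto simp: fun_eq_iff)
qed

lemma caratheodory_iff: "caratheodory_solution \<gamma> M M0 h z \<longleftrightarrow> solves (forcing z) z"
proof -
  have "depcag_rhs \<gamma> M M0 h z = (\<lambda>s. M s *v z s + M0 s *v z (\<gamma> s) + forcing z s)"
    by (simp add: depcag_rhs_def forcing_def fun_eq_iff)
  then show ?thesis
    using solves_continuous[of "forcing z" z]
    by (auto simp: caratheodory_solution_def solves_def primitive_on_def)
qed

text \<open>
  The response is the only bounded solution for its force, so a bounded solution of the nonlinear equation is the
  response to the force that it generates itself.
\<close>
lemma bounded_solution_iff_fixed_point:
  assumes "vbounded z"
  shows "solves (forcing z) z \<longleftrightarrow> continuous_on UNIV z \<and> picard z = z"
proof
  assume z: "solves (forcing z) z"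
  have cz: "continuous_on UNIV z" by (rule solves_continuous[OF z])
  obtain D where D: "vn (z t) \<le> D" for t using assms by (auto simp: vbounded_def)
  show "continuous_on UNIV z \<and> picard z = z"
    using bounded_solution_eq_response[OF forcing_integrable[OF cz] forcing_bound[OF D] z D, symmetric] cz
    unfolding picard_def by (rule conjI[rotated])
next
  assume "continuous_on UNIV z \<and> picard z = z"
  then show "solves (forcing z) z" using picard_solves[OF _ assms] by auto
qed

text \<open>
  The supremum \<open>D\<close> of \<open>vn z\<close> satisfies \<open>D \<le> kappa * (2 r D + \<mu>)\<close>; it remains to solve for \<open>D\<close>.
\<close>
lemma fixed_point_bound:
  assumes z: "continuous_on UNIV z" "vbounded z" "picard z = z"
  shows "vn (z t) * (\<alpha> - 4 * r * K * \<rho>s) \<le> 2 * K * \<mu> * \<rho>s"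
proof -
  define D where "D = (SUP t. vn (z t))"
  have bdd: "bdd_above (range (\<lambda>t. vn (z t)))" using z(2) by (auto simp: vbounded_def bdd_above_def)
  have D: "vn (z t) \<le> D" for t unfolding D_def using bdd by (rule cSUP_upper[OF UNIV_I])
  have "D \<le> kappa * (2 * r * D + \<mu>)"
    unfolding D_def
  proof (rule cSUP_least)
    show "vn (z t) \<le> kappa * (2 * r * (SUP t. vn (z t)) + \<mu>)" for t
      using picard_bound[OF z(1) D, of t] unfolding z(3) D_def .
  qed simp
  then have "\<alpha> * D \<le> 2 * K * \<rho>s * (2 * r * D + \<mu>)"
    using alpha_pos by (simp add: field_simps)
  then have "D * (\<alpha> - 4 * r * K * \<rho>s) \<le> 2 * K * \<mu> * \<rho>s" by (simp add: algebra_simps)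
  moreover have "0 \<le> \<alpha> - 4 * r * K * \<rho>s" using small2 alpha_pos by (simp add: field_simps)
  ultimately show ?thesis using D[of t] by (meson mult_right_mono order_trans)
qed

lemma response_as_Green12:
  assumes f: "(\<lambda>s. G t s *v f s) absolutely_integrable_on UNIV"
  shows "(\<lambda>s. Green1 \<tau> \<zeta> M M0 P t s *v f s) absolutely_integrable_on {..t}"
    and "(\<lambda>s. Green2 \<tau> \<zeta> M M0 P t s *v f s) absolutely_integrable_on {t..}"
    and "response f t = integral {..t} (\<lambda>s. Green1 \<tau> \<zeta> M M0 P t s *v f s)
           - integral {t..} (\<lambda>s. Green2 \<tau> \<zeta> M M0 P t s *v f s)"
proof -
  let ?g = "\<lambda>s. G t s *v f s"
  have i: "?g absolutely_integrable_on {..t}" "?g absolutely_integrable_on {t..}"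
    by (rule set_integrable_subset[OF f]; simp)+
  have eq1: "Green1 \<tau> \<zeta> M M0 P t s *v f s = ?g s" if "s \<in> {..t}" for s
    using that by (simp add: Green1_def)
  show "(\<lambda>s. Green1 \<tau> \<zeta> M M0 P t s *v f s) absolutely_integrable_on {..t}"
    using i(1) by (rule absolutely_integrable_spike[of _ _ "{}"]) (use eq1 in auto)
  have eq2: "Green2 \<tau> \<zeta> M M0 P t s *v f s = - ?g s" if "s \<in> {t..} - {t}" for s
    using that by (simp add: Green2_def matrix_vector_neg_left)
  have "(\<lambda>s. - ?g s) absolutely_integrable_on {t..}"
    using i(2) by (auto simp: absolutely_integrable_on_def intro: integrable_neg)
  then show "(\<lambda>s. Green2 \<tau> \<zeta> M M0 P t s *v f s) absolutely_integrable_on {t..}"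
    by (rule absolutely_integrable_spike[of _ _ "{t}"]) (use eq2 in auto)
  have "integral {t..} (\<lambda>s. Green2 \<tau> \<zeta> M M0 P t s *v f s) = integral {t..} (\<lambda>s. - ?g s)"
    by (rule integral_spike[of "{t}"]) (use eq2 in auto)
  also have "\<dots> = - integral {t..} ?g" by simp
  finally have 2: "integral {t..} (\<lambda>s. Green2 \<tau> \<zeta> M M0 P t s *v f s) = - integral {t..} ?g" .
  have 1: "integral {..t} (\<lambda>s. Green1 \<tau> \<zeta> M M0 P t s *v f s) = integral {..t} ?g"
    by (rule integral_cong) (use eq1 in auto)
  have "{..t} \<union> {t..} = UNIV" "{..t} \<inter> {t..} = {t}" by auto
  then have "response f t = integral {..t} ?g + integral {t..} ?g"
    using integral_Un[of ?g "{..t}" "{t..}"] i unfolding response_def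
    by (simp add: absolutely_integrable_on_def)
  then show "response f t = integral {..t} (\<lambda>s. Green1 \<tau> \<zeta> M M0 P t s *v f s)
           - integral {t..} (\<lambda>s. Green2 \<tau> \<zeta> M M0 P t s *v f s)"
    unfolding 1 2 by simp
qed

end

theorem theorem1:
  fixes vn :: "real ^ 'n \<Rightarrow> real" and mn :: "real ^ 'n ^ 'n \<Rightarrow> real"
    and \<tau> \<zeta> :: "int \<Rightarrow> real" and \<gamma> :: "real \<Rightarrow> real"
    and M M0 :: "real \<Rightarrow> real ^ 'n ^ 'n"
    and h :: "real \<Rightarrow> real ^ 'n \<Rightarrow> real ^ 'n \<Rightarrow> real ^ 'n"
    and P :: "real ^ 'n ^ 'n"
    and \<theta> r \<mu> l K \<alpha> \<rho>s :: real
  assumes norms: "vector_matrix_norm vn mn"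
    and A: "condition_A \<tau> \<zeta> \<gamma> \<theta>"
    and B: "condition_B vn \<gamma> M M0 h r \<mu> l"
    and C: "condition_C mn \<tau> \<zeta> M M0"
    and dich: "exponential_dichotomy mn \<tau> \<zeta> M M0 P K \<alpha>"
    and rho_star: "\<rho>s = rho mn \<tau> \<zeta> M * exp (\<alpha> * \<theta>)"
    and small1: "8 * K * l * \<rho>s * inverse \<alpha> \<le> 1"
    and small2: "4 * K * r * \<rho>s * inverse \<alpha> \<le> 1"
  shows "\<exists>z. caratheodory_solution \<gamma> M M0 h z \<and> bounded (range z)
    \<and> (grid_continuous \<tau> M \<and> grid_continuous \<tau> M0 \<and> (\<forall>x y. grid_continuous \<tau> (\<lambda>t. h t x y))
         \<longrightarrow> pointwise_solution \<tau> \<gamma> M M0 h z)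
    \<and> (\<forall>w. (caratheodory_solution \<gamma> M M0 h w \<or> pointwise_solution \<tau> \<gamma> M M0 h w)
         \<and> bounded (range w) \<longrightarrow> w = z)
    \<and> (\<forall>t. (\<lambda>s. Green1 \<tau> \<zeta> M M0 P t s *v h s (z s) (z (\<gamma> s))) absolutely_integrable_on {..t}
         \<and> (\<lambda>s. Green2 \<tau> \<zeta> M M0 P t s *v h s (z s) (z (\<gamma> s))) absolutely_integrable_on {t..}
         \<and> z t = integral {..t} (\<lambda>s. Green1 \<tau> \<zeta> M M0 P t s *v h s (z s) (z (\<gamma> s)))
               - integral {t..} (\<lambda>s. Green2 \<tau> \<zeta> M M0 P t s *v h s (z s) (z (\<gamma> s))))
    \<and> (\<forall>t. ereal (vn (z t)) \<le> ereal (2 * K * \<mu> * \<rho>s) * inverse (ereal (\<alpha> - 4 * r * K * \<rho>s)))"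
proof -
  interpret small_depcag \<tau> \<zeta> \<gamma> \<theta> vn mn M M0 P K \<alpha> h r \<mu> l \<rho>s
  proof
    show "locally_integrable M" "locally_integrable M0" using B by (auto simp: condition_B_def)
  qed (rule assms)+
  obtain z where z: "continuous_on UNIV z" "vbounded z" "picard z = z" using fixed_point_exists by blast
  have sol: "caratheodory_solution \<gamma> M M0 h z"
    using z bounded_solution_iff_fixed_point by (simp add: caratheodory_iff)
  have pw: "pointwise_solution \<tau> \<gamma> M M0 h z"
    if "grid_continuous \<tau> M" "grid_continuous \<tau> M0" "\<And>x y. grid_continuous \<tau> (\<lambda>t. h t x y)"
  proof -
    have g: "grid_continuous \<tau> (depcag_rhs \<gamma> M M0 h z)"
      by (rule grid_continuous_rhs[OF N(1) l_pos lipschitz that z(1)])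
    have "primitive_on UNIV z (depcag_rhs \<gamma> M M0 h z)"
      using sol by (auto simp: caratheodory_solution_def primitive_on_def)
    from primitive_one_sided_derivatives[OF this g] show ?thesis
      using z(1) by (simp add: pointwise_solution_def)
  qed
  have unique: "w = z" if w: "caratheodory_solution \<gamma> M M0 h w \<or> pointwise_solution \<tau> \<gamma> M M0 h w" "bounded (range w)" for w
  proof -
    have "caratheodory_solution \<gamma> M M0 h w"
    proof (cases "caratheodory_solution \<gamma> M M0 h w")
      case False
      then have "pointwise_solution \<tau> \<gamma> M M0 h w" using w by simp
      then have c: "continuous_on UNIV w"
        and d: "\<And>i t. t \<in> {\<tau> i<..<\<tau> (i + 1)} \<Longrightarrow> (w has_vector_derivative depcag_rhs \<gamma> M M0 h w t) (at t)"
        unfolding pointwise_solution_def by blast+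
      from pointwise_imp_primitive_on_cells[OF c d] c show ?thesis
        by (auto simp: caratheodory_solution_def primitive_on_def)
    qed
    moreover have "vbounded w" using w(2) by (simp add: vbounded_iff)
    ultimately have "continuous_on UNIV w" "picard w = w"
      using bounded_solution_iff_fixed_point[of w] by (auto simp: caratheodory_iff)
    then show "w = z" using \<open>vbounded w\<close> fixed_point_unique[OF z] by blast
  qed
  obtain D where D: "\<And>t. vn (z t) \<le> D" using z(2) by (auto simp: vbounded_def)
  note green = response_as_Green12[OF Green_integrable[OF forcing_integrable[OF z(1)] forcing_bound[OF D]]]
  have rep: "z t = integral {..t} (\<lambda>s. Green1 \<tau> \<zeta> M M0 P t s *v forcing z s)
               - integral {t..} (\<lambda>s. Green2 \<tau> \<zeta> M M0 P t s *v forcing z s)" for t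
    using green(3)[of t] z(3) by (simp add: picard_def)
  have bound: "ereal (vn (z t)) \<le> ereal (2 * K * \<mu> * \<rho>s) * inverse (ereal (\<alpha> - 4 * r * K * \<rho>s))" for t
  proof (rule ereal_le_times_inverse[OF fixed_point_bound[OF z]])
    show "0 \<le> \<alpha> - 4 * r * K * \<rho>s" using small2 alpha_pos by (simp add: field_simps)
    show "0 < 2 * K * \<mu> * \<rho>s" using K_ge_1 mu_pos rho_pos by simp
  qed
  show ?thesis
  proof (intro exI[of _ z] conjI)
    show "bounded (range z)" using z(2) by (simp add: vbounded_iff)
  qed (rule sol | intro allI conjI green(1,2)[unfolded forcing_def] rep[unfolded forcing_def] bound
      | use pw unique in blast)+
qed

end
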